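(* Let $\mathcal{H}$ be a Grothendieck category, let $\mathbf{Sp}\,\mathcal{H}$ denote the set of isomorphism classes of indecomposable injective objects of $\mathcal{H}$ (with a chosen representative for each class), and assume that $\mathbf{Sp}\,\mathcal{H}$ forms a cogenerating subcategory of $\mathcal{H}$. For each $I\in\mathbf{Sp}\,\mathcal{H}$ consider the canonical morphism $$\phi_I: I\longrightarrow \prod_{J\in\mathbf{Sp}\,\mathcal{H}}J^{\mathrm{Rad}(I,J)},$$ where $\mathrm{Rad}(I,J)=\{f\in \mathrm{Hom}_{\mathcal{H}}(I,J)\mid 1_I-gf \text{ is invertible for every } g\in\mathrm{Hom}_{\mathcal{H}}(J,I)\}$. Set $S_I:=\mathrm{Ker}(\phi_I)$ and $\mathcal{S}:=\{S_I\mid I\in\mathbf{Sp}\,\mathcal{H} \text{ and } S_I\neq 0\}$. Then $\mathcal{S}$ is a complete set of pairwise non-isomorphic simple objects of $\mathcal{H}$ (every element of $\mathcal{S}$ is simple, distinct $I$ with $S_I\ne 0$ give non-isomorphic simples, and every simple object of $\mathcal{H}$ is isomorphic to some element of $\mathcal{S}$). Moreover, if $S_I\neq 0$, then $I$ is the injective envelope of the simple object $S_I$.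
   Context: A set of objects of $\mathcal{H}$ forms a cogenerating subcategory if every object of $\mathcal{H}$ admits a monomorphism into a product of objects of that set. For indecomposable injectives this is equivalent to: every injective object of $\mathcal{H}$ is a direct summand of a product of indecomposable injective objects. The canonical morphism $\phi_I$ is the one whose component at the copy of $J$ indexed by $f\in\mathrm{Rad}(I,J)$ is $f: I\to J$. *)

theory Defs
  imports Main "HOL-Algebra.Group"
begin

unbundle cardinal_syntax

section \<open>Categories\<close>

record ('o, 'm) cat =
  Obj :: "'o set"
  Arr :: "'m set"
  Src :: "'m \<Rightarrow> 'o"
  Tgt :: "'m \<Rightarrow> 'o"
  Idn :: "'o \<Rightarrow> 'm"
  Comp :: "'m \<Rightarrow> 'm \<Rightarrow> 'm" (infixl "\<odot>\<index>" 70)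

definition Hom :: "('o, 'm, 'z) cat_scheme \<Rightarrow> 'o \<Rightarrow> 'o \<Rightarrow> 'm set" where
  "Hom C X Y = {f \<in> Arr C. Src C f = X \<and> Tgt C f = Y}"

locale category =
  fixes C :: "('o, 'm, 'z) cat_scheme" (structure)
  assumes Src_closed: "f \<in> Arr C \<Longrightarrow> Src C f \<in> Obj C"
    and Tgt_closed: "f \<in> Arr C \<Longrightarrow> Tgt C f \<in> Obj C"
    and Idn_in_Hom: "X \<in> Obj C \<Longrightarrow> Idn C X \<in> Hom C X X"
    and Comp_in_Hom: "\<lbrakk>f \<in> Hom C X Y; g \<in> Hom C Y Z\<rbrakk> \<Longrightarrow> g \<odot> f \<in> Hom C X Z"
    and Comp_Idn: "f \<in> Hom C X Y \<Longrightarrow> f \<odot> Idn C X = f"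
    and Idn_Comp: "f \<in> Hom C X Y \<Longrightarrow> Idn C Y \<odot> f = f"
    and Comp_assoc: "\<lbrakk>f \<in> Hom C W X; g \<in> Hom C X Y; h \<in> Hom C Y Z\<rbrakk>
      \<Longrightarrow> (h \<odot> g) \<odot> f = h \<odot> (g \<odot> f)"

definition iso_arr :: "('o, 'm, 'z) cat_scheme \<Rightarrow> 'm \<Rightarrow> bool" where
  "iso_arr C f \<longleftrightarrow> f \<in> Arr C \<and>
    (\<exists>g \<in> Hom C (Tgt C f) (Src C f).
      g \<odot>\<^bsub>C\<^esub> f = Idn C (Src C f) \<and> f \<odot>\<^bsub>C\<^esub> g = Idn C (Tgt C f))"

definition isomorphic :: "('o, 'm, 'z) cat_scheme \<Rightarrow> 'o \<Rightarrow> 'o \<Rightarrow> bool" where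
  "isomorphic C X Y \<longleftrightarrow> (\<exists>f \<in> Hom C X Y. iso_arr C f)"

definition mono_arr :: "('o, 'm, 'z) cat_scheme \<Rightarrow> 'm \<Rightarrow> bool" where
  "mono_arr C m \<longleftrightarrow> m \<in> Arr C \<and>
    (\<forall>X \<in> Obj C. \<forall>f \<in> Hom C X (Src C m). \<forall>g \<in> Hom C X (Src C m).
      m \<odot>\<^bsub>C\<^esub> f = m \<odot>\<^bsub>C\<^esub> g \<longrightarrow> f = g)"

definition epi_arr :: "('o, 'm, 'z) cat_scheme \<Rightarrow> 'm \<Rightarrow> bool" where
  "epi_arr C e \<longleftrightarrow> e \<in> Arr C \<and>
    (\<forall>X \<in> Obj C. \<forall>f \<in> Hom C (Tgt C e) X. \<forall>g \<in> Hom C (Tgt C e) X.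
      f \<odot>\<^bsub>C\<^esub> e = g \<odot>\<^bsub>C\<^esub> e \<longrightarrow> f = g)"

definition zero_object :: "('o, 'm, 'z) cat_scheme \<Rightarrow> 'o \<Rightarrow> bool" where
  "zero_object C Z \<longleftrightarrow> Z \<in> Obj C \<and>
    (\<forall>X \<in> Obj C. (\<exists>!f. f \<in> Hom C X Z) \<and> (\<exists>!f. f \<in> Hom C Z X))"

text \<open>Families of objects \<open>A\<close> and of arrows are functions on an index type, of which only
  the values on the index set \<open>K\<close> matter.\<close>

definition is_product ::
  "('o, 'm, 'z) cat_scheme \<Rightarrow> 'k set \<Rightarrow> ('k \<Rightarrow> 'o) \<Rightarrow> 'o \<Rightarrow> ('k \<Rightarrow> 'm) \<Rightarrow> bool" where
  "is_product C K A P \<pi> \<longleftrightarrow> P \<in> Obj C \<and> (\<forall>k \<in> K. \<pi> k \<in> Hom C P (A k)) \<and>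
    (\<forall>X \<in> Obj C. \<forall>f. (\<forall>k \<in> K. f k \<in> Hom C X (A k)) \<longrightarrow>
      (\<exists>!u. u \<in> Hom C X P \<and> (\<forall>k \<in> K. \<pi> k \<odot>\<^bsub>C\<^esub> u = f k)))"

definition is_coproduct ::
  "('o, 'm, 'z) cat_scheme \<Rightarrow> 'k set \<Rightarrow> ('k \<Rightarrow> 'o) \<Rightarrow> 'o \<Rightarrow> ('k \<Rightarrow> 'm) \<Rightarrow> bool" where
  "is_coproduct C K A Q \<iota> \<longleftrightarrow> Q \<in> Obj C \<and> (\<forall>k \<in> K. \<iota> k \<in> Hom C (A k) Q) \<and>
    (\<forall>X \<in> Obj C. \<forall>f. (\<forall>k \<in> K. f k \<in> Hom C (A k) X) \<longrightarrow>
      (\<exists>!u. u \<in> Hom C Q X \<and> (\<forall>k \<in> K. u \<odot>\<^bsub>C\<^esub> \<iota> k = f k)))"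

section \<open>Functors, filtered categories and colimits\<close>

definition is_functor ::
  "('i, 'a, 'y) cat_scheme \<Rightarrow> ('o, 'm, 'z) cat_scheme \<Rightarrow> ('i \<Rightarrow> 'o) \<Rightarrow> ('a \<Rightarrow> 'm) \<Rightarrow> bool" where
  "is_functor D C F\<^sub>o F\<^sub>a \<longleftrightarrow>
    (\<forall>i \<in> Obj D. F\<^sub>o i \<in> Obj C \<and> F\<^sub>a (Idn D i) = Idn C (F\<^sub>o i)) \<and>
    (\<forall>i \<in> Obj D. \<forall>j \<in> Obj D. \<forall>u \<in> Hom D i j. F\<^sub>a u \<in> Hom C (F\<^sub>o i) (F\<^sub>o j)) \<and>
    (\<forall>i \<in> Obj D. \<forall>j \<in> Obj D. \<forall>k \<in> Obj D. \<forall>u \<in> Hom D i j. \<forall>v \<in> Hom D j k.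
      F\<^sub>a (v \<odot>\<^bsub>D\<^esub> u) = F\<^sub>a v \<odot>\<^bsub>C\<^esub> F\<^sub>a u)"

definition is_natural_transformation ::
  "('i, 'a, 'y) cat_scheme \<Rightarrow> ('o, 'm, 'z) cat_scheme \<Rightarrow> ('i \<Rightarrow> 'o) \<Rightarrow> ('a \<Rightarrow> 'm) \<Rightarrow>
    ('i \<Rightarrow> 'o) \<Rightarrow> ('a \<Rightarrow> 'm) \<Rightarrow> ('i \<Rightarrow> 'm) \<Rightarrow> bool" where
  "is_natural_transformation D C F\<^sub>o F\<^sub>a G\<^sub>o G\<^sub>a \<tau> \<longleftrightarrow>
    (\<forall>i \<in> Obj D. \<tau> i \<in> Hom C (F\<^sub>o i) (G\<^sub>o i)) \<and>
    (\<forall>i \<in> Obj D. \<forall>j \<in> Obj D. \<forall>u \<in> Hom D i j. \<tau> j \<odot>\<^bsub>C\<^esub> F\<^sub>a u = G\<^sub>a u \<odot>\<^bsub>C\<^esub> \<tau> i)"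

definition is_cocone ::
  "('i, 'a, 'y) cat_scheme \<Rightarrow> ('o, 'm, 'z) cat_scheme \<Rightarrow> ('i \<Rightarrow> 'o) \<Rightarrow> ('a \<Rightarrow> 'm) \<Rightarrow>
    'o \<Rightarrow> ('i \<Rightarrow> 'm) \<Rightarrow> bool" where
  "is_cocone D C F\<^sub>o F\<^sub>a L \<iota> \<longleftrightarrow> L \<in> Obj C \<and> (\<forall>i \<in> Obj D. \<iota> i \<in> Hom C (F\<^sub>o i) L) \<and>
    (\<forall>i \<in> Obj D. \<forall>j \<in> Obj D. \<forall>u \<in> Hom D i j. \<iota> j \<odot>\<^bsub>C\<^esub> F\<^sub>a u = \<iota> i)"

definition is_colimit ::
  "('i, 'a, 'y) cat_scheme \<Rightarrow> ('o, 'm, 'z) cat_scheme \<Rightarrow> ('i \<Rightarrow> 'o) \<Rightarrow> ('a \<Rightarrow> 'm) \<Rightarrow>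
    'o \<Rightarrow> ('i \<Rightarrow> 'm) \<Rightarrow> bool" where
  "is_colimit D C F\<^sub>o F\<^sub>a L \<iota> \<longleftrightarrow> is_cocone D C F\<^sub>o F\<^sub>a L \<iota> \<and>
    (\<forall>X f. is_cocone D C F\<^sub>o F\<^sub>a X f \<longrightarrow>
      (\<exists>!u. u \<in> Hom C L X \<and> (\<forall>i \<in> Obj D. u \<odot>\<^bsub>C\<^esub> \<iota> i = f i)))"

locale filtered_category = category D for D :: "('i, 'a, 'y) cat_scheme" (structure) +
  assumes nonempty: "Obj D \<noteq> {}"
    and upper_bound: "\<lbrakk>i \<in> Obj D; j \<in> Obj D\<rbrakk>
      \<Longrightarrow> \<exists>k \<in> Obj D. Hom D i k \<noteq> {} \<and> Hom D j k \<noteq> {}"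
    and coequalized: "\<lbrakk>u \<in> Hom D i j; v \<in> Hom D i j\<rbrakk>
      \<Longrightarrow> \<exists>k \<in> Obj D. \<exists>w \<in> Hom D j k. w \<odot> u = w \<odot> v"

section \<open>Abelian categories\<close>

record ('o, 'm) addcat = "('o, 'm) cat" +
  Add :: "'m \<Rightarrow> 'm \<Rightarrow> 'm"
  Zero :: "'o \<Rightarrow> 'o \<Rightarrow> 'm"

definition Hom_group :: "('o, 'm, 'z) addcat_scheme \<Rightarrow> 'o \<Rightarrow> 'o \<Rightarrow> 'm monoid" where
  "Hom_group C X Y = \<lparr>carrier = Hom C X Y, mult = Add C, one = Zero C X Y\<rparr>"

locale preadditive_category = category C for C :: "('o, 'm, 'z) addcat_scheme" (structure) +
  assumes Hom_comm_group: "\<lbrakk>X \<in> Obj C; Y \<in> Obj C\<rbrakk> \<Longrightarrow> comm_group (Hom_group C X Y)"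
    and Comp_Add: "\<lbrakk>f \<in> Hom C X Y; g \<in> Hom C X Y; h \<in> Hom C Y Z\<rbrakk>
      \<Longrightarrow> h \<odot> Add C f g = Add C (h \<odot> f) (h \<odot> g)"
    and Add_Comp: "\<lbrakk>f \<in> Hom C X Y; g \<in> Hom C Y Z; h \<in> Hom C Y Z\<rbrakk>
      \<Longrightarrow> Add C g h \<odot> f = Add C (g \<odot> f) (h \<odot> f)"

definition is_biproduct ::
  "('o, 'm, 'z) addcat_scheme \<Rightarrow> 'o \<Rightarrow> 'o \<Rightarrow> 'o \<Rightarrow> 'm \<Rightarrow> 'm \<Rightarrow> 'm \<Rightarrow> 'm \<Rightarrow> bool" where
  "is_biproduct C A B X i\<^sub>1 i\<^sub>2 p\<^sub>1 p\<^sub>2 \<longleftrightarrow>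
    A \<in> Obj C \<and> B \<in> Obj C \<and> X \<in> Obj C \<and>
    i\<^sub>1 \<in> Hom C A X \<and> i\<^sub>2 \<in> Hom C B X \<and> p\<^sub>1 \<in> Hom C X A \<and> p\<^sub>2 \<in> Hom C X B \<and>
    p\<^sub>1 \<odot>\<^bsub>C\<^esub> i\<^sub>1 = Idn C A \<and> p\<^sub>2 \<odot>\<^bsub>C\<^esub> i\<^sub>2 = Idn C B \<and>
    p\<^sub>1 \<odot>\<^bsub>C\<^esub> i\<^sub>2 = Zero C B A \<and> p\<^sub>2 \<odot>\<^bsub>C\<^esub> i\<^sub>1 = Zero C A B \<and>
    Add C (i\<^sub>1 \<odot>\<^bsub>C\<^esub> p\<^sub>1) (i\<^sub>2 \<odot>\<^bsub>C\<^esub> p\<^sub>2) = Idn C X"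

definition is_kernel :: "('o, 'm, 'z) addcat_scheme \<Rightarrow> 'm \<Rightarrow> 'o \<Rightarrow> 'm \<Rightarrow> bool" where
  "is_kernel C f K k \<longleftrightarrow> f \<in> Arr C \<and> K \<in> Obj C \<and> k \<in> Hom C K (Src C f) \<and>
    f \<odot>\<^bsub>C\<^esub> k = Zero C K (Tgt C f) \<and>
    (\<forall>X \<in> Obj C. \<forall>h \<in> Hom C X (Src C f). f \<odot>\<^bsub>C\<^esub> h = Zero C X (Tgt C f) \<longrightarrow>
      (\<exists>!u. u \<in> Hom C X K \<and> k \<odot>\<^bsub>C\<^esub> u = h))"

definition is_cokernel :: "('o, 'm, 'z) addcat_scheme \<Rightarrow> 'm \<Rightarrow> 'o \<Rightarrow> 'm \<Rightarrow> bool" where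
  "is_cokernel C f Q q \<longleftrightarrow> f \<in> Arr C \<and> Q \<in> Obj C \<and> q \<in> Hom C (Tgt C f) Q \<and>
    q \<odot>\<^bsub>C\<^esub> f = Zero C (Src C f) Q \<and>
    (\<forall>X \<in> Obj C. \<forall>h \<in> Hom C (Tgt C f) X. h \<odot>\<^bsub>C\<^esub> f = Zero C (Src C f) X \<longrightarrow>
      (\<exists>!u. u \<in> Hom C Q X \<and> u \<odot>\<^bsub>C\<^esub> q = h))"

locale abelian_category = preadditive_category C
  for C :: "('o, 'm, 'z) addcat_scheme" (structure) +
  assumes has_zero_object: "\<exists>Z. zero_object C Z"
    and has_biproducts: "\<lbrakk>A \<in> Obj C; B \<in> Obj C\<rbrakk>
      \<Longrightarrow> \<exists>X i\<^sub>1 i\<^sub>2 p\<^sub>1 p\<^sub>2. is_biproduct C A B X i\<^sub>1 i\<^sub>2 p\<^sub>1 p\<^sub>2"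
    and has_kernels: "f \<in> Arr C \<Longrightarrow> \<exists>K k. is_kernel C f K k"
    and has_cokernels: "f \<in> Arr C \<Longrightarrow> \<exists>Q q. is_cokernel C f Q q"
    and mono_is_kernel: "mono_arr C m \<Longrightarrow> \<exists>f. is_kernel C f (Src C m) m"
    and epi_is_cokernel: "epi_arr C e \<Longrightarrow> \<exists>f. is_cokernel C f (Tgt C e) e"

definition short_exact :: "('o, 'm, 'z) addcat_scheme \<Rightarrow> 'm \<Rightarrow> 'm \<Rightarrow> bool" where
  "short_exact C f g \<longleftrightarrow> is_kernel C g (Src C f) f \<and> is_cokernel C f (Tgt C g) g"

section \<open>Grothendieck categories\<close>

text \<open>
  Smallness is relative to a universe, given up to bijection by a set \<open>U\<close> whose cardinality is
  infinite, regular and a strong limit: a Grothendieck universe \<open>\<V>\<close> has these properties, and a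
  set is equinumerous to an element of \<open>\<V>\<close> iff its cardinality is less than that of \<open>\<V>\<close>.
  Uncountability of \<open>U\<close> is not demanded, so the universe of (hereditarily) finite sets is allowed.
\<close>

definition universe :: "'u set \<Rightarrow> bool" where
  "universe U \<longleftrightarrow> infinite U \<and> regularCard |U| \<and>
    (\<forall>X. X \<subseteq> U \<and> |X| <o |U| \<longrightarrow> |Pow X| <o |U| )"

definition small :: "'u set \<Rightarrow> 'a set \<Rightarrow> bool" where
  "small U X \<longleftrightarrow> |X| <o |U|"

definition has_small_coproducts :: "'u set \<Rightarrow> ('o, 'm, 'z) cat_scheme \<Rightarrow> bool" where
  "has_small_coproducts U C \<longleftrightarrow>
    (\<forall>K A. K \<subseteq> U \<and> small U K \<and> (\<forall>k \<in> K. A k \<in> Obj C) \<longrightarrow> (\<exists>Q \<iota>. is_coproduct C K A Q \<iota>))"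

text \<open>Exactness of small filtered colimits. Index categories have objects and arrows taken from
  \<open>U\<close>, which is no restriction up to isomorphism; \<open>a\<close> and \<open>b\<close> are the arrows induced on the
  colimits by \<open>\<alpha>\<close> and \<open>\<beta>\<close>.\<close>

definition filtered_colimits_exact :: "'u set \<Rightarrow> ('o, 'm, 'z) addcat_scheme \<Rightarrow> bool" where
  "filtered_colimits_exact U C \<longleftrightarrow>
    (\<forall>(D :: ('u, 'u) cat) F\<^sub>o F\<^sub>a G\<^sub>o G\<^sub>a H\<^sub>o H\<^sub>a \<alpha> \<beta> L \<iota>\<^sub>L M \<iota>\<^sub>M N \<iota>\<^sub>N a b.
      filtered_category D \<and> Obj D \<subseteq> U \<and> Arr D \<subseteq> U \<and> small U (Obj D) \<and> small U (Arr D) \<and>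
      is_functor D C F\<^sub>o F\<^sub>a \<and> is_functor D C G\<^sub>o G\<^sub>a \<and> is_functor D C H\<^sub>o H\<^sub>a \<and>
      is_natural_transformation D C F\<^sub>o F\<^sub>a G\<^sub>o G\<^sub>a \<alpha> \<and>
      is_natural_transformation D C G\<^sub>o G\<^sub>a H\<^sub>o H\<^sub>a \<beta> \<and>
      (\<forall>i \<in> Obj D. short_exact C (\<alpha> i) (\<beta> i)) \<and>
      is_colimit D C F\<^sub>o F\<^sub>a L \<iota>\<^sub>L \<and> is_colimit D C G\<^sub>o G\<^sub>a M \<iota>\<^sub>M \<and> is_colimit D C H\<^sub>o H\<^sub>a N \<iota>\<^sub>N \<and>
      a \<in> Hom C L M \<and> (\<forall>i \<in> Obj D. a \<odot>\<^bsub>C\<^esub> \<iota>\<^sub>L i = \<iota>\<^sub>M i \<odot>\<^bsub>C\<^esub> \<alpha> i) \<and>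
      b \<in> Hom C M N \<and> (\<forall>i \<in> Obj D. b \<odot>\<^bsub>C\<^esub> \<iota>\<^sub>M i = \<iota>\<^sub>N i \<odot>\<^bsub>C\<^esub> \<beta> i)
      \<longrightarrow> short_exact C a b)"

definition is_generator :: "('o, 'm, 'z) cat_scheme \<Rightarrow> 'o \<Rightarrow> bool" where
  "is_generator C G \<longleftrightarrow> G \<in> Obj C \<and>
    (\<forall>X \<in> Obj C. \<forall>Y \<in> Obj C. \<forall>f \<in> Hom C X Y. \<forall>g \<in> Hom C X Y.
      f \<noteq> g \<longrightarrow> (\<exists>h \<in> Hom C G X. f \<odot>\<^bsub>C\<^esub> h \<noteq> g \<odot>\<^bsub>C\<^esub> h))"

locale grothendieck_category = abelian_category C
  for U :: "'u set" and C :: "('o, 'm, 'z) addcat_scheme" (structure) +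
  assumes universe: "universe U"
    and locally_small: "\<lbrakk>X \<in> Obj C; Y \<in> Obj C\<rbrakk> \<Longrightarrow> small U (Hom C X Y)"
    and small_coproducts: "has_small_coproducts U C"
    and filtered_colimits_exact: "filtered_colimits_exact U C"
    and has_generator: "\<exists>G. is_generator C G"

section \<open>Indecomposable injectives and simple objects\<close>

definition injective :: "('o, 'm, 'z) cat_scheme \<Rightarrow> 'o \<Rightarrow> bool" where
  "injective C I \<longleftrightarrow> I \<in> Obj C \<and>
    (\<forall>m f. mono_arr C m \<and> f \<in> Hom C (Src C m) I \<longrightarrow>
      (\<exists>g \<in> Hom C (Tgt C m) I. g \<odot>\<^bsub>C\<^esub> m = f))"

definition indecomposable :: "('o, 'm, 'z) addcat_scheme \<Rightarrow> 'o \<Rightarrow> bool" where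
  "indecomposable C X \<longleftrightarrow> X \<in> Obj C \<and> \<not> zero_object C X \<and>
    (\<forall>A B i\<^sub>1 i\<^sub>2 p\<^sub>1 p\<^sub>2. is_biproduct C A B X i\<^sub>1 i\<^sub>2 p\<^sub>1 p\<^sub>2 \<longrightarrow>
      zero_object C A \<or> zero_object C B)"

definition simple :: "('o, 'm, 'z) cat_scheme \<Rightarrow> 'o \<Rightarrow> bool" where
  "simple C X \<longleftrightarrow> X \<in> Obj C \<and> \<not> zero_object C X \<and>
    (\<forall>m. mono_arr C m \<and> Tgt C m = X \<longrightarrow> zero_object C (Src C m) \<or> iso_arr C m)"

definition essential_mono :: "('o, 'm, 'z) cat_scheme \<Rightarrow> 'm \<Rightarrow> bool" where
  "essential_mono C m \<longleftrightarrow> mono_arr C m \<and>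
    (\<forall>X \<in> Obj C. \<forall>h \<in> Hom C (Tgt C m) X. mono_arr C (h \<odot>\<^bsub>C\<^esub> m) \<longrightarrow> mono_arr C h)"

definition injective_envelope :: "('o, 'm, 'z) cat_scheme \<Rightarrow> 'o \<Rightarrow> 'o \<Rightarrow> 'm \<Rightarrow> bool" where
  "injective_envelope C X I e \<longleftrightarrow> injective C I \<and> e \<in> Hom C X I \<and> essential_mono C e"

text \<open>\<open>Sp\<close> consists of one chosen representative of each isomorphism class of indecomposable
  injective objects.\<close>

definition is_spectrum :: "('o, 'm, 'z) addcat_scheme \<Rightarrow> 'o set \<Rightarrow> bool" where
  "is_spectrum C Sp \<longleftrightarrow> (\<forall>I \<in> Sp. injective C I \<and> indecomposable C I) \<and>
    (\<forall>X. injective C X \<and> indecomposable C X \<longrightarrow> (\<exists>!I. I \<in> Sp \<and> isomorphic C X I))"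

definition cogenerating :: "'u set \<Rightarrow> ('o, 'm, 'z) cat_scheme \<Rightarrow> 'o set \<Rightarrow> bool" where
  "cogenerating U C E \<longleftrightarrow>
    (\<forall>X \<in> Obj C. \<exists>K A P \<pi> m. K \<subseteq> U \<and> small U K \<and> (\<forall>k \<in> K. A k \<in> E) \<and>
      is_product C K A P \<pi> \<and> m \<in> Hom C X P \<and> mono_arr C m)"

definition Rad :: "('o, 'm, 'z) addcat_scheme \<Rightarrow> 'o \<Rightarrow> 'o \<Rightarrow> 'm set" where
  "Rad C I J = {f \<in> Hom C I J. \<forall>g \<in> Hom C J I.
    iso_arr C (Idn C I \<otimes>\<^bsub>Hom_group C I I\<^esub> inv\<^bsub>Hom_group C I I\<^esub> (g \<odot>\<^bsub>C\<^esub> f))}"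

text \<open>\<open>P\<close> with projections \<open>\<pi>\<close> is a product of the copies of the objects \<open>J \<in> Sp\<close> indexed by
  the pairs \<open>(J, f)\<close> with \<open>f \<in> Rad C I J\<close>, and \<open>\<phi>\<close> is the canonical arrow from \<open>I\<close> to it.\<close>

definition canonical_arrow ::
  "('o, 'm, 'z) addcat_scheme \<Rightarrow> 'o set \<Rightarrow> 'o \<Rightarrow> 'o \<Rightarrow> ('o \<times> 'm \<Rightarrow> 'm) \<Rightarrow> 'm \<Rightarrow> bool" where
  "canonical_arrow C Sp I P \<pi> \<phi> \<longleftrightarrow>
    is_product C (SIGMA J:Sp. Rad C I J) fst P \<pi> \<and> \<phi> \<in> Hom C I P \<and>
    (\<forall>J \<in> Sp. \<forall>f \<in> Rad C I J. \<pi> (J, f) \<odot>\<^bsub>C\<^esub> \<phi> = f)"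

text \<open>Products and kernels are determined only up to isomorphism; \<open>S\<close> with its embedding \<open>k\<close> into
  \<open>I\<close> is a kernel of \<open>\<phi>\<close> for some choice of the product.\<close>

definition canonical_kernel ::
  "('o, 'm, 'z) addcat_scheme \<Rightarrow> 'o set \<Rightarrow> 'o \<Rightarrow> 'o \<Rightarrow> 'm \<Rightarrow> bool" where
  "canonical_kernel C Sp I S k \<longleftrightarrow>
    (\<exists>P \<pi> \<phi>. canonical_arrow C Sp I P \<pi> \<phi> \<and> is_kernel C \<phi> S k)"

end

theory Submission
  imports Defs
begin

text \<open>
  An arrow \<open>f \<in> Rad C I J\<close> kills every simple subobject \<open>X\<close> of \<open>I\<close>: otherwise \<open>f\<close> is monic on \<open>X\<close>, so
  injectivity gives \<open>g\<close> with \<open>g f\<close> the identity on \<open>X\<close>, and \<open>1 - g f\<close> is not monic. Conversely, every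
  nonzero subobject of an indecomposable injective \<open>I\<close> is essential (this needs exactness of filtered
  colimits), so an arrow \<open>f\<close> with nonzero kernel lies in \<open>Rad C I J\<close>, since \<open>1 - g f\<close> is the identity on
  that kernel. If \<open>T\<close> is a nonzero subobject of \<open>S\<^sub>I\<close>, all arrows from \<open>I\<close> to objects of \<open>Sp\<close> that kill \<open>T\<close>
  hence kill \<open>S\<^sub>I\<close>, and as \<open>Sp\<close> cogenerates, \<open>T = S\<^sub>I\<close>. The product defining \<open>\<phi>\<^sub>I\<close> exists because \<open>Sp\<close> is
  small: \<open>I\<close> is determined by the kernel of a nonzero arrow from a generator to \<open>I\<close>.
\<close>

section \<open>Arrows in preadditive and abelian categories\<close>

text \<open>No injective envelope is ever constructed, so essentiality of a subobject of
  \<open>I\<close> cannot come from its envelope splitting off. Instead a maximal complement is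
  found by Zorn's lemma and shown to be a direct summand. Subobjects of \<open>I\<close> are encoded
  by sets of arrows from a generator into \<open>I\<close>, since these sets form a small set; they
  enter only through the quotients they define. No pullbacks are taken: where an arrow would have to
  be lifted along an epimorphism, its cokernel is compared with that epimorphism instead. Products
  are not among the axioms either and are built from coproducts and a generator. Two members of
  \<open>Sp\<close> that share a nonzero subobject are isomorphic. This fact gives both the
  smallness of \<open>Sp\<close> and the pairwise non-isomorphism of the simple kernels. For
  completeness, a simple object has a nonzero arrow to some \<open>I\<close> by cogeneration; this
  arrow is monic and lands in the kernel, and a monomorphism from a nonzero object into a simple one
  is invertible.\<close>

definition Diff :: "('o, 'm, 'z) addcat_scheme \<Rightarrow> 'm \<Rightarrow> 'm \<Rightarrow> 'm" where
  "Diff C f g = f \<otimes>\<^bsub>Hom_group C (Src C f) (Tgt C f)\<^esub> inv\<^bsub>Hom_group C (Src C f) (Tgt C f)\<^esub> g"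

context category
begin

text \<open>As a simp rule this dissolves hom-sets into facts on \<open>Arr\<close>,
  \<open>Src\<close> and \<open>Tgt\<close>, so that composability conditions are discharged by
  rewriting. Where a definition has to be applied in terms of \<open>Hom\<close>, the rule is
  switched off or unfolded last.\<close>

lemma Hom_iff [simp]: "f \<in> Hom C X Y \<longleftrightarrow> f \<in> Arr C \<and> Src C f = X \<and> Tgt C f = Y"
  by (auto simp: Hom_def)

lemma Src_Obj [simp]: "f \<in> Arr C \<Longrightarrow> Src C f \<in> Obj C"
  and Tgt_Obj [simp]: "f \<in> Arr C \<Longrightarrow> Tgt C f \<in> Obj C"
  by (simp_all add: Src_closed Tgt_closed)

lemma Idn_Arr [simp]:
  assumes "X \<in> Obj C"
  shows "Idn C X \<in> Arr C" "Src C (Idn C X) = X" "Tgt C (Idn C X) = X"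
  using Idn_in_Hom[OF assms] by simp_all

lemma Comp_Arr [simp]:
  assumes "f \<in> Arr C" "g \<in> Arr C" "Src C g = Tgt C f"
  shows "g \<odot> f \<in> Arr C" "Src C (g \<odot> f) = Src C f" "Tgt C (g \<odot> f) = Tgt C g"
  using Comp_in_Hom[of f "Src C f" "Tgt C f" g "Tgt C g"] assms by simp_all

lemma Comp_Idn' [simp]: "f \<in> Arr C \<Longrightarrow> Src C f = X \<Longrightarrow> f \<odot> Idn C X = f"
  using Comp_Idn[of f X "Tgt C f"] by simp

lemma Idn_Comp' [simp]: "f \<in> Arr C \<Longrightarrow> Tgt C f = Y \<Longrightarrow> Idn C Y \<odot> f = f"
  using Idn_Comp[of f "Src C f" Y] by simp

lemma assoc [simp]:
  assumes "f \<in> Arr C" "g \<in> Arr C" "h \<in> Arr C" "Src C g = Tgt C f" "Src C h = Tgt C g"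
  shows "(h \<odot> g) \<odot> f = h \<odot> (g \<odot> f)"
  using Comp_assoc[of f "Src C f" "Tgt C f" g "Tgt C g" h "Tgt C h"] assms by simp

text \<open>The simp rule \<open>assoc\<close> nests composites to the right, where an equation for
  \<open>g \<odot> f\<close> no longer matches; this form applies such an equation there.\<close>

lemma Comp_eq_Comp:
  assumes "g \<odot> f = h" "x \<in> Arr C" "f \<in> Arr C" "g \<in> Arr C" "Src C f = Tgt C x" "Src C g = Tgt C f"
  shows "g \<odot> (f \<odot> x) = h \<odot> x"
  using assms by auto

lemma mono_arrD:
  "mono_arr C m \<Longrightarrow> f \<in> Arr C \<Longrightarrow> g \<in> Arr C \<Longrightarrow> Tgt C f = Src C m \<Longrightarrow> Tgt C g = Src C m
    \<Longrightarrow> Src C f = Src C g \<Longrightarrow> m \<odot> f = m \<odot> g \<Longrightarrow> f = g"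
  unfolding mono_arr_def by (metis Hom_iff Src_Obj)

lemma epi_arrD:
  "epi_arr C e \<Longrightarrow> f \<in> Arr C \<Longrightarrow> g \<in> Arr C \<Longrightarrow> Src C f = Tgt C e \<Longrightarrow> Src C g = Tgt C e
    \<Longrightarrow> Tgt C f = Tgt C g \<Longrightarrow> f \<odot> e = g \<odot> e \<Longrightarrow> f = g"
  unfolding epi_arr_def by (metis Hom_iff Tgt_Obj)

lemma mono_Arr: "mono_arr C m \<Longrightarrow> m \<in> Arr C"
  and epi_Arr: "epi_arr C m \<Longrightarrow> m \<in> Arr C"
  unfolding mono_arr_def epi_arr_def by auto

lemma mono_arr_Comp:
  assumes "mono_arr C f" "mono_arr C g" "Src C g = Tgt C f"
  shows "mono_arr C (g \<odot> f)"
  unfolding mono_arr_def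
proof (intro conjI ballI impI)
  note [simp] = mono_Arr[OF assms(1)] mono_Arr[OF assms(2)] assms(3)
  show "g \<odot> f \<in> Arr C" by simp
  fix X x y assume "X \<in> Obj C" "x \<in> Hom C X (Src C (g \<odot> f))" "y \<in> Hom C X (Src C (g \<odot> f))"
    and eq: "(g \<odot> f) \<odot> x = (g \<odot> f) \<odot> y"
  then have [simp]: "x \<in> Arr C" "y \<in> Arr C" "Src C x = X" "Src C y = X"
    "Tgt C x = Src C f" "Tgt C y = Src C f" by auto
  have "f \<odot> x = f \<odot> y" by (rule mono_arrD[OF assms(2)]) (use eq in auto)
  then show "x = y" by - (rule mono_arrD[OF assms(1)], auto)
qed

lemma epi_arr_Comp:
  assumes "epi_arr C f" "epi_arr C g" "Src C g = Tgt C f"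
  shows "epi_arr C (g \<odot> f)"
  unfolding epi_arr_def
proof (intro conjI ballI impI)
  note [simp] = epi_Arr[OF assms(1)] epi_Arr[OF assms(2)] assms(3)
  show "g \<odot> f \<in> Arr C" by simp
  fix X x y assume "X \<in> Obj C" "x \<in> Hom C (Tgt C (g \<odot> f)) X" "y \<in> Hom C (Tgt C (g \<odot> f)) X"
    and eq: "x \<odot> (g \<odot> f) = y \<odot> (g \<odot> f)"
  then have [simp]: "x \<in> Arr C" "y \<in> Arr C" "Tgt C x = X" "Tgt C y = X"
    "Src C x = Tgt C g" "Src C y = Tgt C g" by auto
  have "x \<odot> g = y \<odot> g" by (rule epi_arrD[OF assms(1)]) (use eq in auto)
  then show "x = y" by - (rule epi_arrD[OF assms(2)], auto)
qed

lemma mono_arr_cancel: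
  assumes "mono_arr C (g \<odot> f)" "f \<in> Arr C" "g \<in> Arr C" "Src C g = Tgt C f"
  shows "mono_arr C f"
  unfolding mono_arr_def
proof (intro conjI ballI impI)
  fix X x y assume "X \<in> Obj C" "x \<in> Hom C X (Src C f)" "y \<in> Hom C X (Src C f)"
    and eq: "f \<odot> x = f \<odot> y"
  moreover from this have "(g \<odot> f) \<odot> x = (g \<odot> f) \<odot> y" using assms by simp
  ultimately show "x = y" using assms by - (rule mono_arrD[OF assms(1)], auto)
qed (fact assms)

lemma Idn_mono [simp]: "X \<in> Obj C \<Longrightarrow> mono_arr C (Idn C X)"
  by (auto simp: mono_arr_def)

lemma Idn_epi [simp]: "X \<in> Obj C \<Longrightarrow> epi_arr C (Idn C X)"
  by (auto simp: epi_arr_def)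

lemma iso_arrI:
  assumes "f \<in> Arr C" "g \<in> Arr C" "Src C g = Tgt C f" "Tgt C g = Src C f"
    "g \<odot> f = Idn C (Src C f)" "f \<odot> g = Idn C (Tgt C f)"
  shows "iso_arr C f"
  unfolding iso_arr_def using assms by auto

lemma iso_arrE:
  assumes "iso_arr C f"
  obtains g where "f \<in> Arr C" "g \<in> Arr C" "Src C g = Tgt C f" "Tgt C g = Src C f"
    "g \<odot> f = Idn C (Src C f)" "f \<odot> g = Idn C (Tgt C f)"
  using assms unfolding iso_arr_def by auto

lemma iso_mono: assumes "iso_arr C f" shows "mono_arr C f"
proof -
  obtain g where g: "f \<in> Arr C" "g \<in> Arr C" "Src C g = Tgt C f" "Tgt C g = Src C f"
    "g \<odot> f = Idn C (Src C f)" "f \<odot> g = Idn C (Tgt C f)"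
    using assms by (rule iso_arrE)
  then have "mono_arr C (g \<odot> f)" by simp
  then show ?thesis by (rule mono_arr_cancel) (use g in auto)
qed

lemma isomorphic_refl: "X \<in> Obj C \<Longrightarrow> isomorphic C X X"
  unfolding isomorphic_def by (rule bexI[of _ "Idn C X"]) (auto intro!: iso_arrI[where g = "Idn C X"])

text \<open>From \<open>m \<odot> u = 1\<close> follows
  \<open>m \<odot> (u \<odot> m) = m \<odot> 1\<close>, and the monomorphism \<open>m\<close>
  cancels.\<close>

lemma mono_split_iso:
  assumes "mono_arr C m" "u \<in> Arr C" "Src C u = Tgt C m" "Tgt C u = Src C m"
    "m \<odot> u = Idn C (Tgt C m)"
  shows "iso_arr C m"
proof -
  note [simp] = mono_Arr[OF assms(1)] assms(2-)
  have "u \<odot> m = Idn C (Src C m)"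
  proof (rule mono_arrD[OF assms(1)])
    have "m \<odot> (u \<odot> m) = Idn C (Tgt C m) \<odot> m" by (rule Comp_eq_Comp) simp_all
    then show "m \<odot> (u \<odot> m) = m \<odot> Idn C (Src C m)" by simp
  qed auto
  then show ?thesis by (intro iso_arrI[where g = u]) auto
qed

end

section \<open>Zero arrows, differences, kernels and cokernels\<close>

context preadditive_category
begin

lemma Zero_Arr [simp]:
  assumes "X \<in> Obj C" "Y \<in> Obj C"
  shows "Zero C X Y \<in> Arr C" "Src C (Zero C X Y) = X" "Tgt C (Zero C X Y) = Y"
proof -
  interpret H: comm_group "Hom_group C X Y" by (rule Hom_comm_group[OF assms])
  have "Zero C X Y \<in> Hom C X Y" using H.one_closed by (simp add: Hom_group_def del: Hom_iff)
  then show "Zero C X Y \<in> Arr C" "Src C (Zero C X Y) = X" "Tgt C (Zero C X Y) = Y" by auto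
qed

lemma Add_Arr [simp]:
  assumes "f \<in> Arr C" "g \<in> Arr C" "Src C f = Src C g" "Tgt C f = Tgt C g"
  shows "Add C f g \<in> Arr C" "Src C (Add C f g) = Src C g" "Tgt C (Add C f g) = Tgt C g"
proof -
  interpret H: comm_group "Hom_group C (Src C g) (Tgt C g)" by (rule Hom_comm_group) (use assms in auto)
  have "Add C f g \<in> Hom C (Src C g) (Tgt C g)"
    using H.m_closed[of f g] assms by (simp add: Hom_group_def del: Hom_iff) simp
  then show "Add C f g \<in> Arr C" "Src C (Add C f g) = Src C g" "Tgt C (Add C f g) = Tgt C g" by auto
qed

text \<open>In a group only the neutral element equals its own double. Bilinearity yields just this
  equation for composites with a zero arrow.\<close>

lemma Zero_unique:
  assumes "f \<in> Arr C" "Add C f f = f"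
  shows "f = Zero C (Src C f) (Tgt C f)"
proof -
  interpret H: comm_group "Hom_group C (Src C f) (Tgt C f)" by (rule Hom_comm_group) (use assms in auto)
  show ?thesis using H.l_cancel_one[of f f] assms by (simp add: Hom_group_def)
qed

lemma Add_Zero [simp]: "f \<in> Arr C \<Longrightarrow> Src C f = X \<Longrightarrow> Tgt C f = Y \<Longrightarrow> Add C (Zero C X Y) f = f"
proof -
  assume f: "f \<in> Arr C" "Src C f = X" "Tgt C f = Y"
  then interpret H: comm_group "Hom_group C X Y" by (intro Hom_comm_group) auto
  show ?thesis using H.l_one[of f] f by (simp add: Hom_group_def)
qed

lemma Comp_Zero [simp]:
  assumes "g \<in> Arr C" "X \<in> Obj C" "Src C g = Y"
  shows "g \<odot> Zero C X Y = Zero C X (Tgt C g)"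
proof -
  let ?z = "Zero C X Y"
  have Y: "Y \<in> Obj C" using assms by auto
  have "g \<odot> Add C ?z ?z = Add C (g \<odot> ?z) (g \<odot> ?z)"
    by (rule Comp_Add[where X = X and Y = Y and Z = "Tgt C g"]) (use assms Y in auto)
  moreover have "Add C ?z ?z = ?z" using assms Y by simp
  ultimately have "Add C (g \<odot> ?z) (g \<odot> ?z) = g \<odot> ?z" by simp
  from Zero_unique[OF _ this] show ?thesis using assms Y by simp
qed

lemma Zero_Comp [simp]:
  assumes "f \<in> Arr C" "Z \<in> Obj C" "Tgt C f = Y"
  shows "Zero C Y Z \<odot> f = Zero C (Src C f) Z"
proof -
  let ?z = "Zero C Y Z"
  have Y: "Y \<in> Obj C" using assms by auto
  have "Add C ?z ?z \<odot> f = Add C (?z \<odot> f) (?z \<odot> f)"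
    by (rule Add_Comp[where X = "Src C f" and Y = Y and Z = Z]) (use assms Y in auto)
  moreover have "Add C ?z ?z = ?z" using assms Y by simp
  ultimately have "Add C (?z \<odot> f) (?z \<odot> f) = ?z \<odot> f" by simp
  from Zero_unique[OF _ this] show ?thesis using assms Y by simp
qed

lemma Diff_Arr [simp]:
  assumes "f \<in> Arr C" "g \<in> Arr C" "Src C f = Src C g" "Tgt C f = Tgt C g"
  shows "Diff C f g \<in> Arr C" "Src C (Diff C f g) = Src C g" "Tgt C (Diff C f g) = Tgt C g"
proof -
  interpret H: comm_group "Hom_group C (Src C g) (Tgt C g)" by (rule Hom_comm_group) (use assms in auto)
  have "Diff C f g \<in> carrier (Hom_group C (Src C g) (Tgt C g))"
    unfolding Diff_def assms(3,4)
    by (intro H.m_closed H.inv_closed) (use assms in \<open>auto simp: Hom_group_def\<close>)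
  then show "Diff C f g \<in> Arr C" "Src C (Diff C f g) = Src C g" "Tgt C (Diff C f g) = Tgt C g"
    by (auto simp: Hom_group_def)
qed

text \<open>The axioms \<open>Comp_Add\<close> and \<open>Add_Comp\<close> concern sums only, so the
  laws for differences are proved by turning them into equations between sums.\<close>

lemma Diff_eq_iff:
  assumes "f \<in> Arr C" "g \<in> Arr C" "d \<in> Arr C" "Src C f = Src C g" "Tgt C f = Tgt C g"
    "Src C d = Src C g" "Tgt C d = Tgt C g"
  shows "Diff C f g = d \<longleftrightarrow> Add C d g = f"
proof -
  let ?H = "Hom_group C (Src C g) (Tgt C g)"
  interpret H: comm_group ?H by (rule Hom_comm_group) (use assms in auto)
  have c: "f \<in> carrier ?H" "g \<in> carrier ?H" "d \<in> carrier ?H"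
    using assms by (auto simp: Hom_group_def)
  have "Diff C f g = f \<otimes>\<^bsub>?H\<^esub> inv\<^bsub>?H\<^esub> g" by (simp add: Diff_def assms)
  moreover have "Add C d g = d \<otimes>\<^bsub>?H\<^esub> g" by (simp add: Hom_group_def)
  ultimately show ?thesis using c by (metis H.inv_closed H.inv_solve_right' H.m_closed)
qed

lemma Add_Diff [simp]:
  assumes "f \<in> Arr C" "g \<in> Arr C" "Src C f = Src C g" "Tgt C f = Tgt C g"
  shows "Add C (Diff C f g) g = f"
  using Diff_eq_iff[of f g "Diff C f g"] assms by simp

lemma Comp_Diff:
  assumes "f \<in> Arr C" "g \<in> Arr C" "Src C f = Src C g" "Tgt C f = Tgt C g" "h \<in> Arr C" "Src C h = Tgt C g"
  shows "h \<odot> Diff C f g = Diff C (h \<odot> f) (h \<odot> g)"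
proof -
  have "Add C (h \<odot> Diff C f g) (h \<odot> g) = h \<odot> Add C (Diff C f g) g"
    by (rule Comp_Add[symmetric, where X = "Src C g" and Y = "Tgt C g" and Z = "Tgt C h"])
      (use assms in auto)
  also have "\<dots> = h \<odot> f" using assms by simp
  finally show ?thesis using assms by (subst eq_commute, subst Diff_eq_iff) auto
qed

lemma Diff_Comp:
  assumes "f \<in> Arr C" "g \<in> Arr C" "Src C f = Src C g" "Tgt C f = Tgt C g" "h \<in> Arr C" "Tgt C h = Src C g"
  shows "Diff C f g \<odot> h = Diff C (f \<odot> h) (g \<odot> h)"
proof -
  have "Add C (Diff C f g \<odot> h) (g \<odot> h) = Add C (Diff C f g) g \<odot> h"
    by (rule Add_Comp[symmetric, where X = "Src C h" and Y = "Src C g" and Z = "Tgt C g"])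
      (use assms in auto)
  also have "\<dots> = f \<odot> h" using assms by simp
  finally show ?thesis using assms by (subst eq_commute, subst Diff_eq_iff) auto
qed

lemma Diff_eq_Zero:
  assumes "f \<in> Arr C" "g \<in> Arr C" "Src C f = Src C g" "Tgt C f = Tgt C g"
  shows "Diff C f g = Zero C (Src C g) (Tgt C g) \<longleftrightarrow> f = g"
  using assms by (subst Diff_eq_iff) auto

lemma Diff_Zero:
  assumes "f \<in> Arr C" "Src C f = X" "Tgt C f = Y"
  shows "Diff C f (Zero C X Y) = f"
proof -
  interpret H: comm_group "Hom_group C X Y" by (rule Hom_comm_group) (use assms in auto)
  have "Add C f (Zero C X Y) = f"
    using H.r_one[of f] assms by (simp add: Hom_group_def)
  then show ?thesis using assms by (subst Diff_eq_iff) auto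
qed

text \<open>If \<open>m \<odot> f = m \<odot> g\<close>, then \<open>m\<close> kills
  \<open>Diff C f g\<close>; hence it suffices to look at the arrows that \<open>m\<close>
  kills.\<close>

lemma mono_arrI:
  assumes "m \<in> Arr C"
    "\<And>X x. x \<in> Arr C \<Longrightarrow> Src C x = X \<Longrightarrow> Tgt C x = Src C m \<Longrightarrow> m \<odot> x = Zero C X (Tgt C m)
      \<Longrightarrow> x = Zero C X (Src C m)"
  shows "mono_arr C m"
  unfolding mono_arr_def
proof (intro conjI ballI impI)
  fix X f g assume X: "X \<in> Obj C" and fg: "f \<in> Hom C X (Src C m)" "g \<in> Hom C X (Src C m)"
    and eq: "m \<odot> f = m \<odot> g"
  have "m \<odot> Diff C f g = Diff C (m \<odot> f) (m \<odot> g)" using fg assms by (intro Comp_Diff) auto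
  also have "\<dots> = Zero C X (Tgt C m)"
    using fg assms(1) eq Diff_eq_Zero[of "m \<odot> f" "m \<odot> g"] by simp
  finally have "Diff C f g = Zero C X (Src C m)" using assms(2)[of "Diff C f g" X] fg by simp
  then show "f = g" using fg Diff_eq_Zero[of f g] by simp
qed (fact assms(1))

lemma epi_arrI:
  assumes "m \<in> Arr C"
    "\<And>X x. x \<in> Arr C \<Longrightarrow> Tgt C x = X \<Longrightarrow> Src C x = Tgt C m \<Longrightarrow> x \<odot> m = Zero C (Src C m) X
      \<Longrightarrow> x = Zero C (Tgt C m) X"
  shows "epi_arr C m"
  unfolding epi_arr_def
proof (intro conjI ballI impI)
  fix X f g assume X: "X \<in> Obj C" and fg: "f \<in> Hom C (Tgt C m) X" "g \<in> Hom C (Tgt C m) X"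
    and eq: "f \<odot> m = g \<odot> m"
  have "Diff C f g \<odot> m = Diff C (f \<odot> m) (g \<odot> m)" using fg assms by (intro Diff_Comp) auto
  also have "\<dots> = Zero C (Src C m) X"
    using fg assms(1) eq Diff_eq_Zero[of "f \<odot> m" "g \<odot> m"] by simp
  finally have "Diff C f g = Zero C (Tgt C m) X" using assms(2)[of "Diff C f g" X] fg by simp
  then show "f = g" using fg Diff_eq_Zero[of f g] by simp
qed (fact assms(1))

lemma mono_arr_ZeroD:
  assumes "mono_arr C m" "x \<in> Arr C" "Src C x = X" "Tgt C x = Src C m" "m \<odot> x = Zero C X (Tgt C m)"
  shows "x = Zero C X (Src C m)"
  by (rule mono_arrD[OF assms(1)]) (use assms mono_Arr[OF assms(1)] in auto)

lemma is_kernelD: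
  assumes "is_kernel C f K k"
  shows "f \<in> Arr C" "K \<in> Obj C" "k \<in> Arr C" "Src C k = K" "Tgt C k = Src C f"
    "f \<odot> k = Zero C K (Tgt C f)"
  using assms unfolding is_kernel_def Hom_iff by blast+

lemma is_kernel_ex1:
  assumes "is_kernel C f K k" "h \<in> Arr C" "Src C h = X" "Tgt C h = Src C f" "f \<odot> h = Zero C X (Tgt C f)"
  shows "\<exists>!u. u \<in> Hom C X K \<and> k \<odot> u = h"
proof -
  have "X \<in> Obj C" "h \<in> Hom C X (Src C f)" using assms(2-4) by auto
  then show ?thesis using assms(1,5) unfolding is_kernel_def by blast
qed

lemma is_kernelE:
  assumes "is_kernel C f K k" "h \<in> Arr C" "Src C h = X" "Tgt C h = Src C f" "f \<odot> h = Zero C X (Tgt C f)"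
  obtains u where "u \<in> Arr C" "Src C u = X" "Tgt C u = K" "k \<odot> u = h"
proof -
  obtain u where "u \<in> Hom C X K \<and> k \<odot> u = h" using is_kernel_ex1[OF assms] by blast
  then show thesis using that unfolding Hom_iff by blast
qed

lemma is_kernel_mono:
  assumes "is_kernel C f K k" shows "mono_arr C k"
proof (rule mono_arrI)
  note k = is_kernelD[OF assms]
  show "k \<in> Arr C" by fact
  fix X x assume x: "x \<in> Arr C" "Src C x = X" "Tgt C x = Src C k" "k \<odot> x = Zero C X (Tgt C k)"
  have X: "X \<in> Obj C" using x by auto
  have "\<exists>!u. u \<in> Hom C X K \<and> k \<odot> u = Zero C X (Tgt C k)"
    by (rule is_kernel_ex1[OF assms]) (use k X in auto)
  moreover have "x \<in> Hom C X K \<and> k \<odot> x = Zero C X (Tgt C k)" using x k by simp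
  moreover have "Zero C X K \<in> Hom C X K \<and> k \<odot> Zero C X K = Zero C X (Tgt C k)" using k X by simp
  ultimately have "x = Zero C X K" by blast
  then show "x = Zero C X (Src C k)" using k by simp
qed

lemma is_kernelI:
  assumes "f \<in> Arr C" "mono_arr C k" "Tgt C k = Src C f" "Src C k = K" "f \<odot> k = Zero C K (Tgt C f)"
    "\<And>h X. h \<in> Arr C \<Longrightarrow> Src C h = X \<Longrightarrow> Tgt C h = Src C f \<Longrightarrow> f \<odot> h = Zero C X (Tgt C f)
      \<Longrightarrow> \<exists>u. u \<in> Arr C \<and> Src C u = X \<and> Tgt C u = K \<and> k \<odot> u = h"
  shows "is_kernel C f K k"
  unfolding is_kernel_def
proof (intro conjI ballI impI)
  fix X h assume h: "X \<in> Obj C" "h \<in> Hom C X (Src C f)" "f \<odot> h = Zero C X (Tgt C f)"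
  from assms(6)[of h X] h obtain u where u: "u \<in> Arr C" "Src C u = X" "Tgt C u = K" "k \<odot> u = h"
    by auto
  have "v = u" if "v \<in> Hom C X K" "k \<odot> v = h" for v
    by (rule mono_arrD[OF assms(2)]) (use that u assms(4) in auto)
  moreover have "u \<in> Hom C X K \<and> k \<odot> u = h" using u by simp
  ultimately show "\<exists>!u. u \<in> Hom C X K \<and> k \<odot> u = h" by blast
qed (use assms(1-5) mono_Arr[OF assms(2)] in auto)

lemma is_cokernelD:
  assumes "is_cokernel C f Q q"
  shows "f \<in> Arr C" "Q \<in> Obj C" "q \<in> Arr C" "Src C q = Tgt C f" "Tgt C q = Q"
    "q \<odot> f = Zero C (Src C f) Q"
  using assms unfolding is_cokernel_def Hom_iff by blast+

lemma is_cokernel_ex1: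
  assumes "is_cokernel C f Q q" "h \<in> Arr C" "Tgt C h = X" "Src C h = Tgt C f" "h \<odot> f = Zero C (Src C f) X"
  shows "\<exists>!u. u \<in> Hom C Q X \<and> u \<odot> q = h"
proof -
  have "X \<in> Obj C" "h \<in> Hom C (Tgt C f) X" using assms(2-4) by auto
  then show ?thesis using assms(1,5) unfolding is_cokernel_def by blast
qed

lemma is_cokernelE:
  assumes "is_cokernel C f Q q" "h \<in> Arr C" "Tgt C h = X" "Src C h = Tgt C f" "h \<odot> f = Zero C (Src C f) X"
  obtains u where "u \<in> Arr C" "Src C u = Q" "Tgt C u = X" "u \<odot> q = h"
proof -
  obtain u where "u \<in> Hom C Q X \<and> u \<odot> q = h" using is_cokernel_ex1[OF assms] by blast
  then show thesis using that unfolding Hom_iff by blast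
qed

lemma is_cokernel_epi:
  assumes "is_cokernel C f Q q" shows "epi_arr C q"
proof (rule epi_arrI)
  note q = is_cokernelD[OF assms]
  show "q \<in> Arr C" by fact
  fix X x assume x: "x \<in> Arr C" "Tgt C x = X" "Src C x = Tgt C q" "x \<odot> q = Zero C (Src C q) X"
  have X: "X \<in> Obj C" using x by auto
  have "\<exists>!u. u \<in> Hom C Q X \<and> u \<odot> q = Zero C (Src C q) X"
    by (rule is_cokernel_ex1[OF assms]) (use q X in auto)
  moreover have "x \<in> Hom C Q X \<and> x \<odot> q = Zero C (Src C q) X" using x q by simp
  moreover have "Zero C Q X \<in> Hom C Q X \<and> Zero C Q X \<odot> q = Zero C (Src C q) X" using q X by simp
  ultimately have "x = Zero C Q X" by blast
  then show "x = Zero C (Tgt C q) X" using q by simp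
qed

lemma is_cokernelI:
  assumes "f \<in> Arr C" "epi_arr C q" "Src C q = Tgt C f" "Tgt C q = Q" "q \<odot> f = Zero C (Src C f) Q"
    "\<And>h X. h \<in> Arr C \<Longrightarrow> Tgt C h = X \<Longrightarrow> Src C h = Tgt C f \<Longrightarrow> h \<odot> f = Zero C (Src C f) X
      \<Longrightarrow> \<exists>u. u \<in> Arr C \<and> Src C u = Q \<and> Tgt C u = X \<and> u \<odot> q = h"
  shows "is_cokernel C f Q q"
  unfolding is_cokernel_def
proof (intro conjI ballI impI)
  fix X h assume h: "X \<in> Obj C" "h \<in> Hom C (Tgt C f) X" "h \<odot> f = Zero C (Src C f) X"
  from assms(6)[of h X] h obtain u where u: "u \<in> Arr C" "Src C u = Q" "Tgt C u = X" "u \<odot> q = h"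
    by auto
  have "v = u" if "v \<in> Hom C Q X" "v \<odot> q = h" for v
    by (rule epi_arrD[OF assms(2)]) (use that u assms(4) in auto)
  moreover have "u \<in> Hom C Q X \<and> u \<odot> q = h" using u by simp
  ultimately show "\<exists>!u. u \<in> Hom C Q X \<and> u \<odot> q = h" by blast
qed (use assms(1-5) epi_Arr[OF assms(2)] in auto)

lemma zero_objectD:
  assumes "zero_object C X"
  shows "X \<in> Obj C" "f \<in> Arr C \<Longrightarrow> Src C f = X \<Longrightarrow> Tgt C f = Y \<Longrightarrow> f = Zero C X Y"
    "f \<in> Arr C \<Longrightarrow> Src C f = Y \<Longrightarrow> Tgt C f = X \<Longrightarrow> f = Zero C Y X"
proof -
  show X: "X \<in> Obj C" using assms by (simp add: zero_object_def)
  have *: "(\<exists>!g. g \<in> Hom C X Y) \<and> (\<exists>!g. g \<in> Hom C Y X)" if "Y \<in> Obj C"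
    using assms that unfolding zero_object_def by blast
  show "f = Zero C X Y" if f: "f \<in> Arr C" "Src C f = X" "Tgt C f = Y"
  proof -
    have "Y \<in> Obj C" using f by auto
    moreover from this have "f \<in> Hom C X Y" "Zero C X Y \<in> Hom C X Y" using f X by auto
    ultimately show ?thesis using * by blast
  qed
  show "f = Zero C Y X" if f: "f \<in> Arr C" "Src C f = Y" "Tgt C f = X"
  proof -
    have "Y \<in> Obj C" using f by auto
    moreover from this have "f \<in> Hom C Y X" "Zero C Y X \<in> Hom C Y X" using f X by auto
    ultimately show ?thesis using * by blast
  qed
qed

lemma zero_object_iff: "zero_object C X \<longleftrightarrow> X \<in> Obj C \<and> Idn C X = Zero C X X"
proof
  assume "zero_object C X"
  then show "X \<in> Obj C \<and> Idn C X = Zero C X X"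
    using zero_objectD(1)[of X] by (intro conjI zero_objectD(2)) auto
next
  assume X: "X \<in> Obj C \<and> Idn C X = Zero C X X"
  have "f = Zero C Y X" if "f \<in> Hom C Y X" for f Y
    using that X Idn_Comp'[of f X] Zero_Comp[of f X X] by simp
  moreover have "f = Zero C X Y" if "f \<in> Hom C X Y" for f Y
    using that X Comp_Idn'[of f X] Comp_Zero[of f X X] by simp
  moreover have "Zero C X Y \<in> Hom C X Y" "Zero C Y X \<in> Hom C Y X" if "Y \<in> Obj C" for Y
    using that X by auto
  ultimately show "zero_object C X" using X unfolding zero_object_def by metis
qed

lemma mono_Zero_zero_object:
  assumes "mono_arr C m" "m = Zero C X Y" "Src C m = X" "Tgt C m = Y"
  shows "zero_object C X"
proof -
  have m: "m \<in> Arr C" "X \<in> Obj C" "Y \<in> Obj C"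
    using mono_Arr[OF assms(1)] assms(3,4) by auto
  have "Idn C X = Zero C X (Src C m)"
    by (rule mono_arr_ZeroD[OF assms(1)]) (use m assms(2-) in auto)
  then show ?thesis using m assms(3) by (simp add: zero_object_iff)
qed

lemma mono_to_zero_object:
  assumes "mono_arr C m" "zero_object C (Tgt C m)"
  shows "zero_object C (Src C m)"
  by (rule mono_Zero_zero_object[OF assms(1) zero_objectD(3)[OF assms(2)]])
    (use mono_Arr[OF assms(1)] in auto)

end

section \<open>Images, splittings and products in abelian categories\<close>

context abelian_category
begin

text \<open>The axiom makes \<open>m\<close> a kernel of some \<open>f\<close>. That
  \<open>f\<close> kills \<open>m\<close> and so factors through \<open>q\<close>; whatever
  \<open>q\<close> kills is then killed by \<open>f\<close> and factors through
  \<open>m\<close>.\<close>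

lemma mono_kernel_of_cokernel:
  assumes "mono_arr C m" "is_cokernel C m Q q"
  shows "is_kernel C q (Src C m) m"
proof (rule is_kernelI)
  note q = is_cokernelD[OF assms(2)]
  show "q \<in> Arr C" "mono_arr C m" "Tgt C m = Src C q" "Src C m = Src C m"
    "q \<odot> m = Zero C (Src C m) (Tgt C q)" using q assms by auto
  obtain f where f: "is_kernel C f (Src C m) m" using mono_is_kernel assms(1) by blast
  note f' = is_kernelD[OF f]
  obtain u where u: "u \<in> Arr C" "Src C u = Q" "Tgt C u = Tgt C f" "u \<odot> q = f"
    by (rule is_cokernelE[OF assms(2) f'(1) refl]) (use f' in auto)
  fix h X assume h: "h \<in> Arr C" "Src C h = X" "Tgt C h = Src C q" "q \<odot> h = Zero C X (Tgt C q)"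
  have X: "X \<in> Obj C" using h by auto
  have "u \<odot> (q \<odot> h) = f \<odot> h" by (rule Comp_eq_Comp[OF u(4)]) (use u h q f' in auto)
  then have "f \<odot> h = Zero C X (Tgt C f)" using u h q X by simp
  then obtain v where "v \<in> Arr C" "Src C v = X" "Tgt C v = Src C m" "m \<odot> v = h"
    using h q f' by - (rule is_kernelE[OF f h(1,2)], auto)
  then show "\<exists>u. u \<in> Arr C \<and> Src C u = X \<and> Tgt C u = Src C m \<and> m \<odot> u = h" by blast
qed

text \<open>Dually, the \<open>f\<close> whose cokernel is \<open>e\<close> factors through the
  kernel \<open>k\<close>, so an arrow that kills \<open>k\<close> kills \<open>f\<close> and
  factors through \<open>e\<close>.\<close>

lemma epi_cokernel_of_kernel:
  assumes "epi_arr C e" "is_kernel C e K k"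
  shows "is_cokernel C k (Tgt C e) e"
proof (rule is_cokernelI)
  note k = is_kernelD[OF assms(2)]
  show "k \<in> Arr C" "epi_arr C e" "Src C e = Tgt C k" "Tgt C e = Tgt C e"
    "e \<odot> k = Zero C (Src C k) (Tgt C e)" using k assms by auto
  obtain f where f: "is_cokernel C f (Tgt C e) e" using epi_is_cokernel assms(1) by blast
  note f' = is_cokernelD[OF f]
  obtain u where u: "u \<in> Arr C" "Src C u = Src C f" "Tgt C u = K" "k \<odot> u = f"
    by (rule is_kernelE[OF assms(2) f'(1) refl]) (use f' in auto)
  fix h X assume h: "h \<in> Arr C" "Tgt C h = X" "Src C h = Tgt C k" "h \<odot> k = Zero C (Src C k) X"
  have X: "X \<in> Obj C" using h by auto
  have "h \<odot> (k \<odot> u) = Zero C (Src C k) X \<odot> u"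
    by (rule Comp_eq_Comp[OF h(4)]) (use u h k f' in auto)
  then have "h \<odot> f = Zero C (Src C f) X" using u k X by simp
  then obtain v where "v \<in> Arr C" "Src C v = Tgt C e" "Tgt C v = X" "v \<odot> e = h"
    using h k f' by - (rule is_cokernelE[OF f h(1,2)], auto)
  then show "\<exists>u. u \<in> Arr C \<and> Src C u = Tgt C e \<and> Tgt C u = X \<and> u \<odot> e = h" by blast
qed

lemma mono_factors:
  assumes "mono_arr C m" "is_cokernel C m Q q" "h \<in> Arr C" "Src C h = X" "Tgt C h = Tgt C m"
    "q \<odot> h = Zero C X Q"
  obtains u where "u \<in> Arr C" "Src C u = X" "Tgt C u = Src C m" "m \<odot> u = h"
proof -
  note q = is_cokernelD[OF assms(2)]
  show thesis
    by (rule is_kernelE[OF mono_kernel_of_cokernel[OF assms(1,2)] assms(3,4) _ _ that])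
      (simp_all add: q assms(5,6))
qed

lemma epi_factors:
  assumes "epi_arr C e" "is_kernel C e K k" "h \<in> Arr C" "Tgt C h = Y" "Src C h = Src C e"
    "h \<odot> k = Zero C K Y"
  obtains u where "u \<in> Arr C" "Src C u = Tgt C e" "Tgt C u = Y" "u \<odot> e = h"
proof -
  note k = is_kernelD[OF assms(2)]
  show thesis
    by (rule is_cokernelE[OF epi_cokernel_of_kernel[OF assms(1,2)] assms(3,4) _ _ that])
      (simp_all add: k assms(5,6))
qed

text \<open>If the cokernel \<open>c\<close> of \<open>y\<close> kills no more of \<open>X\<close> than the epimorphism \<open>q\<close> on \<open>X\<close>, then
  \<open>q\<close> factors through \<open>c \<odot> q\<close>, so \<open>c\<close> is a split monomorphism.\<close>

lemma Zero_if_cokernel_kills_no_more: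
  assumes "epi_arr C q" "y \<in> Arr C" "Src C y = Y" "Tgt C y = Tgt C q" "is_cokernel C y D c"
    "\<And>x X. x \<in> Arr C \<Longrightarrow> Src C x = X \<Longrightarrow> Tgt C x = Src C q \<Longrightarrow> c \<odot> (q \<odot> x) = Zero C X D
      \<Longrightarrow> q \<odot> x = Zero C X (Tgt C q)"
  shows "y = Zero C Y (Tgt C q)"
proof -
  note c = is_cokernelD[OF assms(5)]
  note q = epi_Arr[OF assms(1)]
  have e: "epi_arr C (c \<odot> q)"
    using assms(4) c by (intro epi_arr_Comp assms(1) is_cokernel_epi[OF assms(5)]) auto
  obtain L l where l: "is_kernel C (c \<odot> q) L l" using has_kernels e epi_Arr by blast
  note l' = is_kernelD[OF l]
  have "q \<odot> l = Zero C L (Tgt C q)"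
    by (rule assms(5-)) (use l' c assms(2-4) q in auto)
  then obtain t where t: "t \<in> Arr C" "Src C t = Tgt C (c \<odot> q)" "Tgt C t = Tgt C q" "t \<odot> (c \<odot> q) = q"
    using c q assms(4) by - (rule epi_factors[OF e l q refl], auto)
  have tc: "t \<odot> c = Idn C (Tgt C q)"
    by (rule epi_arrD[OF assms(1)]) (use t c q assms(4) in auto)
  have "mono_arr C (t \<odot> c)" unfolding tc using q by simp
  then have "mono_arr C c" by (rule mono_arr_cancel) (use t c q assms(4) in auto)
  \<comment> \<open>The cokernel \<open>c\<close> kills \<open>y\<close>, and it is now
    monic.\<close>
  then have "y = Zero C Y (Src C c)"
    by (rule mono_arr_ZeroD) (use c assms(2-4) in auto)
  then show ?thesis using c assms(4) by simp
qed

text \<open>The arrow \<open>e\<close>, a cokernel of the kernel, is the coimage. If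
  \<open>s\<close> kills \<open>y\<close>, it factors through the cokernel \<open>c\<close> of
  \<open>y\<close>; an arrow killed by \<open>c \<odot> e\<close> is then killed by
  \<open>f\<close>, factors through \<open>k\<close> and is killed by \<open>e\<close>. So
  \<open>c \<odot> e\<close> kills no more than \<open>e\<close>, which forces \<open>y\<close> to
  be zero.\<close>

lemma image_factorization:
  assumes "f \<in> Arr C" "is_kernel C f K k" "is_cokernel C k E e"
  obtains s where "s \<in> Arr C" "Src C s = E" "Tgt C s = Tgt C f" "s \<odot> e = f" "mono_arr C s"
proof -
  note k = is_kernelD[OF assms(2)] and e = is_cokernelD[OF assms(3)]
  obtain s where s: "s \<in> Arr C" "Src C s = E" "Tgt C s = Tgt C f" "s \<odot> e = f"
    by (rule is_cokernelE[OF assms(3,1) refl]) (use k in auto)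
  have "mono_arr C s"
  proof (rule mono_arrI)
    fix Y y assume y: "y \<in> Arr C" "Src C y = Y" "Tgt C y = Src C s" "s \<odot> y = Zero C Y (Tgt C s)"
    obtain D c where c: "is_cokernel C y D c" using has_cokernels y by blast
    note c' = is_cokernelD[OF c]
    obtain s' where s': "s' \<in> Arr C" "Src C s' = D" "Tgt C s' = Tgt C s" "s' \<odot> c = s"
      by (rule is_cokernelE[OF c s(1) refl]) (use y s in auto)
    have "y = Zero C Y (Tgt C e)"
    proof (rule Zero_if_cokernel_kills_no_more[OF is_cokernel_epi[OF assms(3)] y(1,2) _ c])
      fix x X assume x: "x \<in> Arr C" "Src C x = X" "Tgt C x = Src C e" "c \<odot> (e \<odot> x) = Zero C X D"
      have X: "X \<in> Obj C" using x by auto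
      have "f \<odot> x = s \<odot> (e \<odot> x)"
        by (rule Comp_eq_Comp[OF s(4), symmetric]) (use s e x in auto)
      also have "\<dots> = s' \<odot> (c \<odot> (e \<odot> x))"
        by (rule Comp_eq_Comp[OF s'(4), symmetric]) (use s s' c' e x y in auto)
      also have "\<dots> = Zero C X (Tgt C f)" using x s s' X by simp
      finally obtain u where u: "u \<in> Arr C" "Src C u = X" "Tgt C u = K" "k \<odot> u = x"
        using x e k by - (rule is_kernelE[OF assms(2) x(1,2)], auto)
      have "e \<odot> (k \<odot> u) = Zero C (Src C k) E \<odot> u"
        by (rule Comp_eq_Comp[OF e(6)]) (use u e k in auto)
      then show "e \<odot> x = Zero C X (Tgt C e)" using u e k by simp
    qed (use y s e in auto)
    then show "y = Zero C Y (Src C s)" using e s by simp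
  qed (fact s)
  with s that show thesis by blast
qed

text \<open>The second projection is the idempotent \<open>1 - b \<odot> r\<close>, which
  \<open>r\<close> kills, factored through the kernel of \<open>r\<close>. The identities for it are
  checked after composing with the monomorphism \<open>k\<close>.\<close>

lemma split_mono_biproduct:
  assumes "b \<in> Arr C" "r \<in> Arr C" "Src C r = Tgt C b" "Tgt C r = Src C b"
    "r \<odot> b = Idn C (Src C b)" "is_kernel C r K k"
  shows "\<exists>p. is_biproduct C (Src C b) K (Tgt C b) b k r p"
proof -
  note k = is_kernelD[OF assms(6)]
  define B where "B = Src C b"
  define I where "I = Tgt C b"
  have b: "b \<in> Arr C" "Src C b = B" "Tgt C b = I" "B \<in> Obj C" "I \<in> Obj C"
    and r: "r \<in> Arr C" "Src C r = I" "Tgt C r = B" "r \<odot> b = Idn C B"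
    using assms by (auto simp: B_def I_def)
  have k: "K \<in> Obj C" "k \<in> Arr C" "Src C k = K" "Tgt C k = I" "r \<odot> k = Zero C K B"
    using k r by auto
  let ?d = "Diff C (Idn C I) (b \<odot> r)"
  note km = is_kernel_mono[OF assms(6)]
  have d: "?d \<in> Arr C" "Src C ?d = I" "Tgt C ?d = I" using b r by auto
  have rbr: "r \<odot> (b \<odot> r) = r" using Comp_eq_Comp[OF r(4), of r] b r by simp
  have "r \<odot> ?d = Zero C I B"
    using b r rbr Diff_eq_Zero[of r r] by (subst Comp_Diff) auto
  then obtain p where p: "p \<in> Arr C" "Src C p = I" "Tgt C p = K" "k \<odot> p = ?d"
    using d b r by - (rule is_kernelE[OF assms(6) d(1,2)], auto)
  have brb: "(b \<odot> r) \<odot> b = b" using b r by simp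
  have brk: "(b \<odot> r) \<odot> k = Zero C K I" using b r k by simp
  have pk: "p \<odot> k = Idn C K"
  proof (rule mono_arrD[OF km])
    have "k \<odot> (p \<odot> k) = ?d \<odot> k" using p k b r by (intro Comp_eq_Comp) auto
    also have "\<dots> = k" using b r k brk by (subst Diff_Comp) (auto simp: Diff_Zero)
    finally show "k \<odot> (p \<odot> k) = k \<odot> Idn C K" using k by simp
  qed (use p k b r in auto)
  have pb: "p \<odot> b = Zero C B K"
  proof (rule mono_arrD[OF km])
    have "k \<odot> (p \<odot> b) = ?d \<odot> b" using p k b r by (intro Comp_eq_Comp) auto
    also have "\<dots> = Zero C B I"
      using b r k brb Diff_eq_Zero[of b b] by (subst Diff_Comp) auto
    finally show "k \<odot> (p \<odot> b) = k \<odot> Zero C B K" using k b by simp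
  qed (use p k b r in auto)
  interpret H: comm_group "Hom_group C I I" by (rule Hom_comm_group) (use b in auto)
  have "Add C (b \<odot> r) ?d = Add C ?d (b \<odot> r)"
    using H.m_comm[of "b \<odot> r" ?d] d b r by (simp add: Hom_group_def)
  also have "\<dots> = Idn C I" using b r by simp
  finally have "Add C (b \<odot> r) (k \<odot> p) = Idn C I" using p by simp
  then show ?thesis unfolding is_biproduct_def B_def[symmetric] I_def[symmetric]
    using b r k p(1-3) pk pb by auto
qed

text \<open>The source of \<open>b\<close> and the kernel of \<open>r\<close> are complementary
  summands, so one of them is zero. If it is the kernel, \<open>r\<close> is monic and cancels from
  \<open>r \<odot> (b \<odot> r) = r\<close>.\<close>

lemma indecomposable_split_mono:
  assumes "indecomposable C (Tgt C b)" "b \<in> Arr C" "r \<in> Arr C" "Src C r = Tgt C b" "Tgt C r = Src C b"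
    "r \<odot> b = Idn C (Src C b)"
  shows "zero_object C (Src C b) \<or> iso_arr C b"
proof -
  obtain K k where k: "is_kernel C r K k" using has_kernels assms(3) by blast
  note k' = is_kernelD[OF k]
  obtain p where p: "is_biproduct C (Src C b) K (Tgt C b) b k r p"
    using split_mono_biproduct[OF assms(2-6) k] by blast
  have "iso_arr C b" if "zero_object C K"
  proof -
    have k0: "k = Zero C K (Tgt C b)" using k' assms(4) by (intro zero_objectD(2)[OF that]) auto
    have rm: "mono_arr C r"
    proof (rule mono_arrI)
      fix X x assume x: "x \<in> Arr C" "Src C x = X" "Tgt C x = Src C r" "r \<odot> x = Zero C X (Tgt C r)"
      obtain u where u: "u \<in> Arr C" "Src C u = X" "Tgt C u = K" "k \<odot> u = x"
        by (rule is_kernelE[OF k x(1,2)]) (use x in auto)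
      have "k \<odot> u = Zero C X (Tgt C b)" unfolding k0 using u assms(2) k' by simp
      then show "x = Zero C X (Src C r)" using u(4) assms(4) by simp
    qed (fact assms)
    have "b \<odot> r = Idn C (Tgt C b)"
      by (rule mono_arrD[OF rm]) (use assms(2-5) Comp_eq_Comp[OF assms(6), of r] in auto)
    then show ?thesis using assms(2-6) by (intro iso_arrI[where g = r]) auto
  qed
  then show ?thesis using assms(1) p unfolding indecomposable_def by blast
qed

lemma injectiveE:
  assumes "injective C I" "mono_arr C m" "f \<in> Arr C" "Src C f = Src C m" "Tgt C f = I"
  obtains g where "g \<in> Arr C" "Src C g = Tgt C m" "Tgt C g = I" "g \<odot> m = f"
proof -
  have "f \<in> Hom C (Src C m) I" using assms by simp
  then obtain g where "g \<in> Hom C (Tgt C m) I" "g \<odot> m = f"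
    using assms(1,2) unfolding injective_def by blast
  then show thesis using that unfolding Hom_iff by blast
qed

text \<open>Injectivity of the source splits \<open>f\<close>, and indecomposability of the target
  leaves no room for a complement.\<close>

lemma mono_injective_indecomposable_iso:
  assumes "injective C (Src C f)" "indecomposable C (Tgt C f)" "\<not> zero_object C (Src C f)" "mono_arr C f"
  shows "iso_arr C f"
proof -
  note f = mono_Arr[OF assms(4)]
  obtain r where "r \<in> Arr C" "Src C r = Tgt C f" "Tgt C r = Src C f" "r \<odot> f = Idn C (Src C f)"
    by (rule injectiveE[OF assms(1,4), of "Idn C (Src C f)"]) (use f in auto)
  then show ?thesis using indecomposable_split_mono[OF assms(2) f] assms(3) by blast
qed

lemma is_productD:
  assumes "is_product C K A P \<pi>"
  shows "P \<in> Obj C" "k \<in> K \<Longrightarrow> \<pi> k \<in> Arr C" "k \<in> K \<Longrightarrow> Src C (\<pi> k) = P" "k \<in> K \<Longrightarrow> Tgt C (\<pi> k) = A k"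
    "k \<in> K \<Longrightarrow> A k \<in> Obj C"
  using assms unfolding is_product_def Hom_iff by (blast, blast, blast, blast, metis Tgt_Obj)

lemma is_productE:
  assumes "is_product C K A P \<pi>" "X \<in> Obj C" "\<And>k. k \<in> K \<Longrightarrow> f k \<in> Arr C \<and> Src C (f k) = X \<and> Tgt C (f k) = A k"
  obtains u where "u \<in> Arr C" "Src C u = X" "Tgt C u = P" "\<And>k. k \<in> K \<Longrightarrow> \<pi> k \<odot> u = f k"
proof -
  have "\<exists>!u. u \<in> Hom C X P \<and> (\<forall>k \<in> K. \<pi> k \<odot> u = f k)"
    using assms unfolding is_product_def by simp
  then obtain u where "u \<in> Hom C X P \<and> (\<forall>k \<in> K. \<pi> k \<odot> u = f k)" by blast
  then show thesis using that unfolding Hom_iff by blast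
qed

lemma is_product_Zero:
  assumes "is_product C K A P \<pi>" "x \<in> Arr C" "Src C x = X" "Tgt C x = P"
    "\<And>k. k \<in> K \<Longrightarrow> \<pi> k \<odot> x = Zero C X (A k)"
  shows "x = Zero C X P"
proof -
  note P = is_productD[OF assms(1)]
  have X: "X \<in> Obj C" using assms by auto
  have "\<exists>!u. u \<in> Hom C X P \<and> (\<forall>k \<in> K. \<pi> k \<odot> u = Zero C X (A k))"
    using assms(1) X P unfolding is_product_def by (simp del: Hom_iff) (simp add: X)
  moreover have "x \<in> Hom C X P \<and> (\<forall>k \<in> K. \<pi> k \<odot> x = Zero C X (A k))"
    using assms by simp
  moreover have "Zero C X P \<in> Hom C X P \<and> (\<forall>k \<in> K. \<pi> k \<odot> Zero C X P = Zero C X (A k))"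
    using P X by simp
  ultimately show ?thesis by blast
qed

end

section \<open>Smallness, quotients and products\<close>

text \<open>Stability is the form of regularity that bounds dependent sums: a small sum of small
  sets is small.\<close>

lemma universe_stable: "universe U \<Longrightarrow> stable |U|"
  unfolding universe_def using regularCard_stable card_of_Card_order Field_card_of by metis

lemma small_inj_on: "inj_on f A \<Longrightarrow> f ` A \<subseteq> B \<Longrightarrow> small U B \<Longrightarrow> small U A"
proof -
  assume *: "inj_on f A" "f ` A \<subseteq> B" "small U B"
  then have "|A| \<le>o |B|" using card_of_ordLeq[of A B] by blast
  then show "small U A" using *(3) unfolding small_def by (rule ordLeq_ordLess_trans)
qed

lemma small_subset: "A \<subseteq> B \<Longrightarrow> small U B \<Longrightarrow> small U A"
  by (rule small_inj_on[of id]) auto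

lemma small_Sigma:
  assumes "universe U" "small U A" "\<And>a. a \<in> A \<Longrightarrow> small U (B a)"
  shows "small U (Sigma A B)"
  unfolding small_def
  by (rule stable_elim[OF universe_stable[OF assms(1)]]) (use assms(2,3) in \<open>simp_all add: small_def\<close>)

text \<open>The axioms on coproducts and filtered colimits speak of index sets inside
  \<open>U\<close>; a small set of any other type is transported there along such an
  injection.\<close>

lemma small_code:
  assumes "small U X"
  obtains e where "inj_on e X" "e ` X \<subseteq> U"
proof -
  have "|X| \<le>o |U|" using assms unfolding small_def by (rule ordLess_imp_ordLeq)
  then show thesis using that card_of_ordLeq[of X U] by blast
qed

lemma small_image: "small U X \<Longrightarrow> small U (f ` X)"
  unfolding small_def by (rule ordLeq_ordLess_trans[OF card_of_image])

text \<open>The strong limit property is stated for subsets of \<open>U\<close>, so it is applied to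
  a coded copy of \<open>X\<close>.\<close>

lemma small_Pow:
  assumes "universe U" "small U X"
  shows "small U (Pow X)"
proof -
  obtain e where e: "inj_on e X" "e ` X \<subseteq> U" using small_code[OF assms(2)] .
  have "small U (Pow (e ` X))"
    using assms(1) e(2) small_image[OF assms(2), of e] unfolding universe_def small_def by blast
  then show ?thesis by (rule small_inj_on[OF inj_on_image_Pow[OF e(1)], rotated]) auto
qed

text \<open>An extensional function is determined by its graph, a subset of
  \<open>Sigma K F\<close>, so the bound for power sets applies.\<close>

lemma small_PiE:
  assumes "universe U" "small U K" "\<And>k. k \<in> K \<Longrightarrow> small U (F k)"
  shows "small U (Pi\<^sub>E K F)"
proof (rule small_inj_on)
  show "small U (Pow (Sigma K F))" by (intro small_Pow small_Sigma assms)
  show "inj_on (\<lambda>f. (\<lambda>k. (k, f k)) ` K) (Pi\<^sub>E K F)"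
  proof (rule inj_onI)
    fix f g assume fg: "f \<in> Pi\<^sub>E K F" "g \<in> Pi\<^sub>E K F" "(\<lambda>k. (k, f k)) ` K = (\<lambda>k. (k, g k)) ` K"
    have "f k = g k" if "k \<in> K" for k
    proof -
      have "(k, f k) \<in> (\<lambda>k. (k, g k)) ` K" using that fg(3) by blast
      then show ?thesis by auto
    qed
    then show "f = g" using fg(1,2) by (rule PiE_ext[rotated 2])
  qed
  show "(\<lambda>f. (\<lambda>k. (k, f k)) ` K) ` Pi\<^sub>E K F \<subseteq> Pow (Sigma K F)" by auto
qed

section \<open>Coproducts and generators\<close>

context preadditive_category
begin

lemma is_coproductD:
  assumes "is_coproduct C K A Q \<iota>"
  shows "Q \<in> Obj C" "k \<in> K \<Longrightarrow> \<iota> k \<in> Arr C" "k \<in> K \<Longrightarrow> Src C (\<iota> k) = A k" "k \<in> K \<Longrightarrow> Tgt C (\<iota> k) = Q"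
    "k \<in> K \<Longrightarrow> A k \<in> Obj C"
  using assms unfolding is_coproduct_def Hom_iff by (blast, blast, blast, blast, metis Src_Obj)

lemma is_coproduct_ex1:
  assumes "is_coproduct C K A Q \<iota>" "X \<in> Obj C" "\<And>k. k \<in> K \<Longrightarrow> f k \<in> Hom C (A k) X"
  shows "\<exists>!u. u \<in> Hom C Q X \<and> (\<forall>k \<in> K. u \<odot> \<iota> k = f k)"
  using assms(1)[unfolded is_coproduct_def, THEN conjunct2, THEN conjunct2, rule_format, of X f]
    assms(2,3) by blast

lemma is_coproductE:
  assumes "is_coproduct C K A Q \<iota>" "X \<in> Obj C"
    "\<And>k. k \<in> K \<Longrightarrow> f k \<in> Arr C \<and> Src C (f k) = A k \<and> Tgt C (f k) = X"
  obtains u where "u \<in> Arr C" "Src C u = Q" "Tgt C u = X" "\<And>k. k \<in> K \<Longrightarrow> u \<odot> \<iota> k = f k"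
proof -
  have "\<exists>!u. u \<in> Hom C Q X \<and> (\<forall>k \<in> K. u \<odot> \<iota> k = f k)"
    by (rule is_coproduct_ex1[OF assms(1,2)]) (simp add: assms(3))
  then obtain u where "u \<in> Hom C Q X \<and> (\<forall>k \<in> K. u \<odot> \<iota> k = f k)" by blast
  then show thesis using that unfolding Hom_iff by blast
qed

lemma is_coproduct_eqI:
  assumes "is_coproduct C K A Q \<iota>" "u \<in> Arr C" "v \<in> Arr C" "Src C u = Q" "Src C v = Q" "Tgt C u = Tgt C v"
    "\<And>k. k \<in> K \<Longrightarrow> u \<odot> \<iota> k = v \<odot> \<iota> k"
  shows "u = v"
proof -
  note Q = is_coproductD[OF assms(1)]
  define X where "X = Tgt C v"
  have X: "X \<in> Obj C" using assms by (simp add: X_def)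
  have "\<exists>!w. w \<in> Hom C Q X \<and> (\<forall>k \<in> K. w \<odot> \<iota> k = v \<odot> \<iota> k)"
    by (rule is_coproduct_ex1[OF assms(1) X]) (use Q assms in \<open>simp add: X_def\<close>)
  moreover have "u \<in> Hom C Q X \<and> (\<forall>k \<in> K. u \<odot> \<iota> k = v \<odot> \<iota> k)"
    "v \<in> Hom C Q X \<and> (\<forall>k \<in> K. v \<odot> \<iota> k = v \<odot> \<iota> k)"
    using assms by (auto simp: X_def)
  ultimately show ?thesis by blast
qed

text \<open>Comparing \<open>x\<close> with the zero arrow in the definition of a generator lets the
  arrows from \<open>G\<close> play the role of the elements of \<open>X\<close>.\<close>

lemma generator_Zero:
  assumes "is_generator C G" "x \<in> Arr C" "Src C x = X" "Tgt C x = Y"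
    "\<And>h. h \<in> Arr C \<Longrightarrow> Src C h = G \<Longrightarrow> Tgt C h = X \<Longrightarrow> x \<odot> h = Zero C G Y"
  shows "x = Zero C X Y"
proof (rule ccontr)
  assume "x \<noteq> Zero C X Y"
  moreover have XY: "X \<in> Obj C" "Y \<in> Obj C" using assms(2-4) by auto
  moreover have "x \<in> Hom C X Y" "Zero C X Y \<in> Hom C X Y" using assms(2-4) XY by auto
  ultimately obtain h where h: "h \<in> Hom C G X" "x \<odot> h \<noteq> Zero C X Y \<odot> h"
    using assms(1) unfolding is_generator_def by blast
  have "x \<odot> h = Zero C G Y" using h by (intro assms(5)) auto
  moreover have "Zero C X Y \<odot> h = Zero C G Y" using h XY by simp
  ultimately show False using h by simp
qed

end

section \<open>Quotients by sets of arrows, and the existence of products\<close>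

context grothendieck_category
begin

lemma ex_coproduct:
  assumes "small U K" "\<And>k. k \<in> K \<Longrightarrow> A k \<in> Obj C"
  obtains Q \<iota> where "is_coproduct C K A Q \<iota>"
proof -
  obtain e where e: "inj_on e K" "e ` K \<subseteq> U" using small_code[OF assms(1)] .
  let ?i = "inv_into K e"
  have i: "?i (e k) = k" if "k \<in> K" for k using e(1) that by simp
  have "\<forall>k \<in> e ` K. A (?i k) \<in> Obj C" using assms(2) i by auto
  then have "\<exists>Q \<iota>. is_coproduct C (e ` K) (\<lambda>u. A (?i u)) Q \<iota>"
    by (intro small_coproducts[unfolded has_small_coproducts_def, rule_format])
      (use e(2) small_image[OF assms(1), of e] in blast)
  then obtain Q \<iota> where Q: "is_coproduct C (e ` K) (\<lambda>u. A (?i u)) Q \<iota>" by blast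
  have "is_coproduct C K A Q (\<lambda>k. \<iota> (e k))"
    unfolding is_coproduct_def
  proof (intro conjI ballI allI impI)
    show "Q \<in> Obj C" by (rule is_coproductD(1)[OF Q])
    show "\<iota> (e k) \<in> Hom C (A k) Q" if "k \<in> K" for k
      using is_coproductD(2-4)[OF Q, of "e k"] that i by simp
    fix X f assume X: "X \<in> Obj C" and f: "\<forall>k\<in>K. f k \<in> Hom C (A k) X"
    have "\<exists>!u. u \<in> Hom C Q X \<and> (\<forall>k \<in> e ` K. u \<odot> \<iota> k = f (?i k))"
      by (rule is_coproduct_ex1[OF Q X]) (use f i in auto)
    moreover have "(\<forall>k \<in> e ` K. u \<odot> \<iota> k = f (?i k)) \<longleftrightarrow> (\<forall>k \<in> K. u \<odot> \<iota> (e k) = f k)" for u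
      using i by simp
    ultimately show "\<exists>!u. u \<in> Hom C Q X \<and> (\<forall>k \<in> K. u \<odot> \<iota> (e k) = f k)" by simp
  qed
  then show thesis by (rule that)
qed

text \<open>The quotient by the subobject that the arrows in \<open>H\<close> generate, given by its
  universal property so that the subobject itself never appears. Uniqueness of the factorization is
  contained in \<open>q\<close> being epic.\<close>

definition quotient_by :: "'m set \<Rightarrow> 'm \<Rightarrow> bool" where
  "quotient_by H q \<longleftrightarrow> epi_arr C q \<and> (\<forall>h\<in>H. q \<odot> h = Zero C (Src C h) (Tgt C q)) \<and>
    (\<forall>c \<in> Arr C. Src C c = Src C q \<and> (\<forall>h\<in>H. c \<odot> h = Zero C (Src C h) (Tgt C c)) \<longrightarrow>
      (\<exists>u. u \<in> Arr C \<and> Src C u = Tgt C q \<and> Tgt C u = Tgt C c \<and> u \<odot> q = c))"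

text \<open>As part of a hom-set, \<open>H\<close> is small, so a coproduct of copies of
  \<open>G\<close> indexed by \<open>H\<close> exists; the quotient is the cokernel of the arrow
  \<open>d\<close> on it whose components are the members of \<open>H\<close>.\<close>

lemma ex_quotient_by:
  assumes "G \<in> Obj C" "X \<in> Obj C" "H \<subseteq> Hom C G X"
  obtains q where "quotient_by H q" "Src C q = X"
proof -
  have H: "h \<in> Arr C" "Src C h = G" "Tgt C h = X" if "h \<in> H" for h using that assms(3) by auto
  have "small U H" using small_subset[OF assms(3)] locally_small assms by blast
  then obtain Q \<iota> where Q: "is_coproduct C H (\<lambda>_. G) Q \<iota>"
    using ex_coproduct[of H "\<lambda>_. G"] assms(1) by blast
  note Q' = is_coproductD[OF Q]
  obtain d where d: "d \<in> Arr C" "Src C d = Q" "Tgt C d = X" "\<And>h. h \<in> H \<Longrightarrow> d \<odot> \<iota> h = h"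
    using is_coproductE[OF Q, of X "\<lambda>h. h"] H assms(2) by blast
  obtain P q where q: "is_cokernel C d P q" using has_cokernels d by blast
  note q' = is_cokernelD[OF q]
  have "quotient_by H q" unfolding quotient_by_def
  proof (intro conjI ballI impI)
    show "epi_arr C q" by (rule is_cokernel_epi[OF q])
    show "q \<odot> h = Zero C (Src C h) (Tgt C q)" if "h \<in> H" for h
    proof -
      have "q \<odot> (d \<odot> \<iota> h) = Zero C Q P \<odot> \<iota> h"
        by (rule Comp_eq_Comp) (use q' d Q' that in auto)
      then show ?thesis using d(4)[OF that] Q' that q' H by simp
    qed
    fix c assume c: "c \<in> Arr C" "Src C c = Src C q \<and> (\<forall>h\<in>H. c \<odot> h = Zero C (Src C h) (Tgt C c))"
    have "c \<odot> d = Zero C Q (Tgt C c)"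
    proof (rule is_coproduct_eqI[OF Q])
      fix h assume h: "h \<in> H"
      have "(c \<odot> d) \<odot> \<iota> h = c \<odot> (d \<odot> \<iota> h)" using c d Q' q' h by (intro assoc) auto
      also have "\<dots> = Zero C G (Tgt C c)" using d(4)[OF h] c h H by simp
      finally show "(c \<odot> d) \<odot> \<iota> h = Zero C Q (Tgt C c) \<odot> \<iota> h" using c Q' h by simp
    qed (use c d(1-3) q' Q'(1) in auto)
    then have "Src C c = Tgt C d" "c \<odot> d = Zero C (Src C d) (Tgt C c)" using c(2) d(2) q' by auto
    then obtain u where "u \<in> Arr C" "Src C u = P" "Tgt C u = Tgt C c" "u \<odot> q = c"
      by (rule is_cokernelE[OF q c(1) refl])
    then show "\<exists>u. u \<in> Arr C \<and> Src C u = Tgt C q \<and> Tgt C u = Tgt C c \<and> u \<odot> q = c"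
      unfolding q'(5) by blast
  qed
  then show thesis by (rule that) (simp add: q'(4) d(3))
qed

lemma quotient_byD:
  assumes "quotient_by H q"
  shows "epi_arr C q" "q \<in> Arr C" "h \<in> H \<Longrightarrow> Src C h = X \<Longrightarrow> q \<odot> h = Zero C X (Tgt C q)"
  using assms epi_Arr unfolding quotient_by_def by blast+

lemma quotient_byE:
  assumes "quotient_by H q" "c \<in> Arr C" "Src C c = Src C q"
    "\<And>h. h \<in> H \<Longrightarrow> c \<odot> h = Zero C (Src C h) (Tgt C c)"
  obtains u where "u \<in> Arr C" "Src C u = Tgt C q" "Tgt C u = Tgt C c" "u \<odot> q = c"
  using assms unfolding quotient_by_def by blast

text \<open>An arrow \<open>x\<close> that kills the arrow with components all \<open>h\<close> from
  \<open>G\<close> to \<open>X\<close> kills every such \<open>h\<close>, and is zero because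
  \<open>G\<close> is a generator.\<close>

lemma generator_epi:
  assumes "is_generator C G" "X \<in> Obj C"
  obtains Q \<iota> e where "is_coproduct C (Hom C G X) (\<lambda>_. G) Q \<iota>" "epi_arr C e" "Src C e = Q" "Tgt C e = X"
    "\<forall>h \<in> Hom C G X. e \<odot> \<iota> h = h"
proof -
  have G: "G \<in> Obj C" using assms(1) unfolding is_generator_def by blast
  have "small U (Hom C G X)" using G assms(2) by (rule locally_small)
  then obtain Q \<iota> where Q: "is_coproduct C (Hom C G X) (\<lambda>_. G) Q \<iota>"
    using ex_coproduct[of "Hom C G X" "\<lambda>_. G"] G by blast
  note Q' = is_coproductD[OF Q]
  have "\<And>h. h \<in> Hom C G X \<Longrightarrow> h \<in> Arr C \<and> Src C h = G \<and> Tgt C h = X" by simp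
  then obtain e where e: "e \<in> Arr C" "Src C e = Q" "Tgt C e = X" "\<And>h. h \<in> Hom C G X \<Longrightarrow> e \<odot> \<iota> h = h"
    using is_coproductE[OF Q, of X "\<lambda>h. h"] assms(2) by blast
  have "epi_arr C e"
  proof (rule epi_arrI)
    fix Y x assume x: "x \<in> Arr C" "Tgt C x = Y" "Src C x = Tgt C e" "x \<odot> e = Zero C (Src C e) Y"
    have Y: "Y \<in> Obj C" using x by auto
    have "x = Zero C X Y"
    proof (rule generator_Zero[OF assms(1) x(1) _ x(2)])
      fix h assume h: "h \<in> Arr C" "Src C h = G" "Tgt C h = X"
      then have h': "h \<in> Hom C G X" by simp
      note i = Q'(2-4)[OF h']
      have "x \<odot> (e \<odot> \<iota> h) = Zero C (Src C e) Y \<odot> \<iota> h"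
        by (rule Comp_eq_Comp[OF x(4)]) (use x e i in auto)
      then show "x \<odot> h = Zero C G Y" using e(4)[OF h'] e i Y by simp
    qed (use x e in auto)
    then show "x = Zero C (Tgt C e) Y" using e by simp
  qed (fact e)
  with Q e that show thesis by blast
qed

text \<open>A product is obtained from the coproduct of copies of a generator \<open>G\<close> indexed by all
  families of arrows from \<open>G\<close> to the factors, on dividing out what is killed by all projections.\<close>

lemma ex_product:
  assumes "small U K" "\<And>k. k \<in> K \<Longrightarrow> A k \<in> Obj C"
  obtains P \<pi> where "is_product C K A P \<pi>"
proof -
  obtain G where gen: "is_generator C G" using has_generator by blast
  then have G: "G \<in> Obj C" unfolding is_generator_def by blast
  \<comment> \<open>For the product \<open>P\<close> to be found, \<open>T\<close> is what the
    arrows from \<open>G\<close> to \<open>P\<close> have to be: families of arrows from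
    \<open>G\<close> to the factors.\<close>
  define T where "T = Pi\<^sub>E K (\<lambda>k. Hom C G (A k))"
  have T: "t k \<in> Arr C" "Src C (t k) = G" "Tgt C (t k) = A k" if "t \<in> T" "k \<in> K" for t k
    using that unfolding T_def by (auto dest!: PiE_mem)
  have "small U T" unfolding T_def
    by (intro small_PiE universe assms(1) locally_small G assms(2))
  then obtain Q \<iota> where Q: "is_coproduct C T (\<lambda>_. G) Q \<iota>"
    using ex_coproduct[of T "\<lambda>_. G"] G by blast
  note Q' = is_coproductD[OF Q]
  have "\<exists>p. p \<in> Arr C \<and> Src C p = Q \<and> Tgt C p = A k \<and> (\<forall>t\<in>T. p \<odot> \<iota> t = t k)" if k: "k \<in> K" for k
  proof -
    obtain p where "p \<in> Arr C" "Src C p = Q" "Tgt C p = A k" "\<And>t. t \<in> T \<Longrightarrow> p \<odot> \<iota> t = t k"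
      by (rule is_coproductE[OF Q assms(2)[OF k], of "\<lambda>t. t k"]) (use T k in auto)
    then show ?thesis by blast
  qed
  then obtain p where p: "p k \<in> Arr C" "Src C (p k) = Q" "Tgt C (p k) = A k"
    "\<forall>t \<in> T. p k \<odot> \<iota> t = t k" if "k \<in> K" for k
    by metis
  define H where "H = {h \<in> Hom C G Q. \<forall>k\<in>K. p k \<odot> h = Zero C G (A k)}"
  have "H \<subseteq> Hom C G Q" unfolding H_def by blast
  then obtain q where q: "quotient_by H q" "Src C q = Q" by (rule ex_quotient_by[OF G Q'(1)])
  note q' = quotient_byD[OF q(1)]
  define P where "P = Tgt C q"
  have P: "P \<in> Obj C" using q' by (simp add: P_def)
  have "\<exists>u. u \<in> Arr C \<and> Src C u = P \<and> Tgt C u = A k \<and> u \<odot> q = p k" if k: "k \<in> K" for k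
  proof -
    obtain u where "u \<in> Arr C" "Src C u = Tgt C q" "Tgt C u = Tgt C (p k)" "u \<odot> q = p k"
      by (rule quotient_byE[OF q(1) p(1)[OF k]]) (use p[OF k] q k in \<open>auto simp: H_def\<close>)
    then show ?thesis using p k by (auto simp: P_def)
  qed
  then obtain \<pi> where \<pi>: "\<pi> k \<in> Arr C" "Src C (\<pi> k) = P" "Tgt C (\<pi> k) = A k" "\<pi> k \<odot> q = p k"
    if "k \<in> K" for k
    by metis
  \<comment> \<open>Joint monicity of the projections, from which uniqueness follows. Every
    \<open>\<pi> k\<close> factors through the cokernel \<open>c\<close> of \<open>y\<close>, so an
    arrow \<open>x\<close> with \<open>c \<odot> (q \<odot> x) = 0\<close> is killed by all
    \<open>p k\<close>; composed with arrows from \<open>G\<close> it falls into \<open>H\<close>,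
    and \<open>q\<close> kills it.\<close>
  have joint: "y = Zero C Y P" if y: "y \<in> Arr C" "Src C y = Y" "Tgt C y = P"
    and 0: "\<And>k. k \<in> K \<Longrightarrow> \<pi> k \<odot> y = Zero C Y (A k)" for y Y
  proof -
    obtain D c where c: "is_cokernel C y D c" using has_cokernels y by blast
    note c' = is_cokernelD[OF c]
    have "y = Zero C Y (Tgt C q)"
    proof (rule Zero_if_cokernel_kills_no_more[OF q'(1) y(1,2) _ c])
      show "Tgt C y = Tgt C q" using y by (simp add: P_def)
      fix x X assume x: "x \<in> Arr C" "Src C x = X" "Tgt C x = Src C q" "c \<odot> (q \<odot> x) = Zero C X D"
      have X: "X \<in> Obj C" using x by auto
      show "q \<odot> x = Zero C X (Tgt C q)"
      proof (rule generator_Zero[OF gen])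
        fix h assume h: "h \<in> Arr C" "Src C h = G" "Tgt C h = X"
        have "p k \<odot> (x \<odot> h) = Zero C G (A k)" if k: "k \<in> K" for k
        proof -
          note pk = p[OF k] and \<pi>k = \<pi>[OF k]
          obtain s where s: "s \<in> Arr C" "Src C s = D" "Tgt C s = A k" "s \<odot> c = \<pi> k"
            by (rule is_cokernelE[OF c \<pi>k(1,3)]) (use \<pi>k y 0[OF k] in auto)
          have "p k \<odot> x = \<pi> k \<odot> (q \<odot> x)"
            by (rule Comp_eq_Comp[OF \<pi>k(4), symmetric]) (use x q' \<pi>k in \<open>auto simp: P_def\<close>)
          also have "\<dots> = s \<odot> (c \<odot> (q \<odot> x))"
            by (rule Comp_eq_Comp[OF s(4), symmetric]) (use x q' \<pi>k s c' y in \<open>auto simp: P_def\<close>)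
          also have "\<dots> = Zero C X (A k)" using x s X by simp
          finally have px: "p k \<odot> x = Zero C X (A k)" .
          have "p k \<odot> (x \<odot> h) = Zero C X (A k) \<odot> h"
            by (rule Comp_eq_Comp[OF px]) (use x h pk q in auto)
          then show ?thesis using h assms(2)[OF k] by simp
        qed
        then have "x \<odot> h \<in> H" unfolding H_def using x h q by simp
        then have "q \<odot> (x \<odot> h) = Zero C G (Tgt C q)"
          by (rule q'(3)) (use x h in auto)
        then show "(q \<odot> x) \<odot> h = Zero C G (Tgt C q)" using x h q' by simp
      qed (use x q' in auto)
    qed
    then show ?thesis by (simp add: P_def)
  qed
  have "is_product C K A P \<pi>" unfolding is_product_def
  proof (intro conjI ballI allI impI)
    show "P \<in> Obj C" by fact
    show "\<pi> k \<in> Hom C P (A k)" if "k \<in> K" for k using \<pi>[OF that] by simp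
    fix X f assume X: "X \<in> Obj C" and "\<forall>k\<in>K. f k \<in> Hom C X (A k)"
    then have f: "f k \<in> Arr C" "Src C (f k) = X" "Tgt C (f k) = A k" if "k \<in> K" for k
      using that by auto
    obtain R j e where R: "is_coproduct C (Hom C G X) (\<lambda>_. G) R j" and e: "epi_arr C e" "Src C e = R"
      "Tgt C e = X" "\<forall>h \<in> Hom C G X. e \<odot> j h = h"
      by (rule generator_epi[OF gen X])
    note R' = is_coproductD[OF R] and e' = epi_Arr[OF e(1)]
    define t where "t h = (\<lambda>k\<in>K. f k \<odot> h)" for h
    have t: "t h \<in> T" if "h \<in> Hom C G X" for h
      unfolding T_def t_def using f that by auto
    \<comment> \<open>\<open>X\<close> is covered by copies of \<open>G\<close>. The copy belonging
      to \<open>h\<close> is sent to the copy belonging to the family \<open>t h\<close> of all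
      \<open>f k \<odot> h\<close>, which gives
      \<open>p k \<odot> v = f k \<odot> e\<close>.\<close>
    obtain v where v: "v \<in> Arr C" "Src C v = R" "Tgt C v = Q"
      "\<And>h. h \<in> Hom C G X \<Longrightarrow> v \<odot> j h = \<iota> (t h)"
      by (rule is_coproductE[OF R Q'(1), of "\<lambda>h. \<iota> (t h)"]) (use Q' t in auto)
    have pv: "p k \<odot> v = f k \<odot> e" if k: "k \<in> K" for k
    proof (rule is_coproduct_eqI[OF R])
      note pk = p[OF k] and fk = f[OF k]
      show "p k \<odot> v \<in> Arr C" "Src C (p k \<odot> v) = R" using pk v by auto
      show "f k \<odot> e \<in> Arr C" "Src C (f k \<odot> e) = R" using fk e e' by auto
      show "Tgt C (p k \<odot> v) = Tgt C (f k \<odot> e)" using pk fk v e e' by auto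
      fix h assume h: "h \<in> Hom C G X"
      note jh = R'(2-4)[OF h]
      have "(p k \<odot> v) \<odot> j h = p k \<odot> (v \<odot> j h)" using pk v jh by (intro assoc) auto
      also have "\<dots> = f k \<odot> h" unfolding v(4)[OF h] pk(4)[rule_format, OF t[OF h]] using k by (simp add: t_def)
      also have "\<dots> = f k \<odot> (e \<odot> j h)" using e(4) h by simp
      also have "\<dots> = (f k \<odot> e) \<odot> j h" using fk e e' jh by (intro assoc[symmetric]) auto
      finally show "(p k \<odot> v) \<odot> j h = (f k \<odot> e) \<odot> j h" .
    qed
    obtain L l where l: "is_kernel C e L l" using has_kernels e' by blast
    note l' = is_kernelD[OF l]
    \<comment> \<open>The arrow \<open>v\<close> itself need not descend along \<open>e\<close>. On
      the kernel \<open>l\<close> of \<open>e\<close>, however, it is killed by all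
      \<open>p k\<close>, and \<open>q\<close> divides out what they kill.\<close>
    have "(q \<odot> v) \<odot> l = Zero C L P"
    proof (rule generator_Zero[OF gen])
      fix h assume h: "h \<in> Arr C" "Src C h = G" "Tgt C h = L"
      have "p k \<odot> (v \<odot> (l \<odot> h)) = Zero C G (A k)" if k: "k \<in> K" for k
      proof -
        note pk = p[OF k] and fk = f[OF k]
        have "p k \<odot> (v \<odot> (l \<odot> h)) = (f k \<odot> e) \<odot> (l \<odot> h)"
          by (rule Comp_eq_Comp[OF pv[OF k]]) (use v l' h e pk in auto)
        also have "\<dots> = f k \<odot> (e \<odot> (l \<odot> h))" using fk l' h e by (intro assoc) auto
        also have "e \<odot> (l \<odot> h) = Zero C L X \<odot> h"
          by (rule Comp_eq_Comp) (use l' h e in auto)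
        finally show ?thesis using h fk X l' G by simp
      qed
      then have "v \<odot> (l \<odot> h) \<in> H" unfolding H_def using v l' h e by simp
      then have "q \<odot> (v \<odot> (l \<odot> h)) = Zero C G P"
        unfolding P_def by (rule q'(3)) (use v l' h e in auto)
      then show "((q \<odot> v) \<odot> l) \<odot> h = Zero C G P" using v l' h e q q' by simp
    qed (use v l' e q q' P_def in auto)
    then obtain u where u: "u \<in> Arr C" "Src C u = X" "Tgt C u = P" "u \<odot> e = q \<odot> v"
      using v q q' e P_def by - (rule epi_factors[OF e(1) l, of "q \<odot> v" P], auto)
    have \<pi>u: "\<pi> k \<odot> u = f k" if k: "k \<in> K" for k
    proof (rule epi_arrD[OF e(1)])
      note pk = p[OF k] and fk = f[OF k] and \<pi>k = \<pi>[OF k]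
      have "(\<pi> k \<odot> u) \<odot> e = \<pi> k \<odot> (q \<odot> v)" using u \<pi>k e e' by simp
      also have "\<dots> = p k \<odot> v" by (rule Comp_eq_Comp[OF \<pi>k(4)]) (use v q q' \<pi>k P_def in auto)
      finally show "(\<pi> k \<odot> u) \<odot> e = f k \<odot> e" using pv[OF k] by simp
    qed (use u \<pi>[OF k] f[OF k] e e' in auto)
    have "u' = u" if u': "u' \<in> Hom C X P" "\<forall>k\<in>K. \<pi> k \<odot> u' = f k" for u'
    proof -
      have "Diff C u' u = Zero C X P"
      proof (rule joint)
        fix k assume k: "k \<in> K"
        have "\<pi> k \<odot> Diff C u' u = Diff C (\<pi> k \<odot> u') (\<pi> k \<odot> u)"
          using u u' \<pi>[OF k] by (intro Comp_Diff) auto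
        also have "\<dots> = Zero C X (A k)"
          using \<pi>u[OF k] u'(2) k f[OF k] Diff_eq_Zero[of "f k" "f k"] by simp
        finally show "\<pi> k \<odot> Diff C u' u = Zero C X (A k)" .
      qed (use u u' in auto)
      then show ?thesis using u u' Diff_eq_Zero[of u' u] by simp
    qed
    then show "\<exists>!u. u \<in> Hom C X P \<and> (\<forall>k\<in>K. \<pi> k \<odot> u = f k)"
      using u \<pi>u unfolding Hom_iff by blast
  qed
  then show thesis by (rule that)
qed

end

section \<open>Directed families of epimorphisms\<close>

text \<open>Index categories have their arrows in the universe, so the pair \<open>(i, j)\<close> is coded by \<open>p (i, j)\<close>.\<close>

definition order_cat :: "'u set \<Rightarrow> ('u \<Rightarrow> 'u \<Rightarrow> bool) \<Rightarrow> ('u \<times> 'u \<Rightarrow> 'u) \<Rightarrow> ('u, 'u) cat" where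
  "order_cat J R p = \<lparr>Obj = J, Arr = p ` {(i, j). i \<in> J \<and> j \<in> J \<and> R i j},
    Src = (\<lambda>u. fst (inv_into (J \<times> J) p u)), Tgt = (\<lambda>u. snd (inv_into (J \<times> J) p u)),
    Idn = (\<lambda>i. p (i, i)),
    Comp = (\<lambda>v u. p (fst (inv_into (J \<times> J) p u), snd (inv_into (J \<times> J) p v)))\<rparr>"

lemma order_cat_simps [simp]:
  "Obj (order_cat J R p) = J"
  "Arr (order_cat J R p) = p ` {(i, j). i \<in> J \<and> j \<in> J \<and> R i j}"
  "Idn (order_cat J R p) i = p (i, i)"
  by (simp_all add: order_cat_def)

lemma order_cat_Src_Tgt [simp]:
  assumes "inj_on p (J \<times> J)" "i \<in> J" "j \<in> J"
  shows "Src (order_cat J R p) (p (i, j)) = i" "Tgt (order_cat J R p) (p (i, j)) = j"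
  using assms by (simp_all add: order_cat_def)

lemma order_cat_Comp [simp]:
  assumes "inj_on p (J \<times> J)" "i \<in> J" "j \<in> J" "k \<in> J" "l \<in> J"
  shows "p (k, l) \<odot>\<^bsub>order_cat J R p\<^esub> p (i, j) = p (i, l)"
  using assms by (simp add: order_cat_def)

lemma order_cat_Hom:
  assumes "inj_on p (J \<times> J)"
  shows "u \<in> Hom (order_cat J R p) i j \<longleftrightarrow> i \<in> J \<and> j \<in> J \<and> R i j \<and> u = p (i, j)"
  using assms by (auto simp: Hom_def)

lemma order_cat_filtered:
  assumes p: "inj_on p (J \<times> J)" and "J \<noteq> {}"
    and refl: "\<And>i. i \<in> J \<Longrightarrow> R i i"
    and trans: "\<And>i j k. i \<in> J \<Longrightarrow> j \<in> J \<Longrightarrow> k \<in> J \<Longrightarrow> R i j \<Longrightarrow> R j k \<Longrightarrow> R i k"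
    and directed: "\<And>i j. i \<in> J \<Longrightarrow> j \<in> J \<Longrightarrow> \<exists>k\<in>J. R i k \<and> R j k"
  shows "filtered_category (order_cat J R p)"
proof
  note [simp] = order_cat_Hom[OF p]
  let ?D = "order_cat J R p"
  show "Src ?D f \<in> Obj ?D" if "f \<in> Arr ?D" for f using that p by auto
  show "Tgt ?D f \<in> Obj ?D" if "f \<in> Arr ?D" for f using that p by auto
  show "Idn ?D X \<in> Hom ?D X X" if "X \<in> Obj ?D" for X using that refl by simp
  show "g \<odot>\<^bsub>?D\<^esub> f \<in> Hom ?D X Z" if "f \<in> Hom ?D X Y" "g \<in> Hom ?D Y Z" for f g X Y Z
    using that p by (auto intro: trans)
  show "f \<odot>\<^bsub>?D\<^esub> Idn ?D X = f" if "f \<in> Hom ?D X Y" for f X Y using that p by auto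
  show "Idn ?D Y \<odot>\<^bsub>?D\<^esub> f = f" if "f \<in> Hom ?D X Y" for f X Y using that p by auto
  show "(h \<odot>\<^bsub>?D\<^esub> g) \<odot>\<^bsub>?D\<^esub> f = h \<odot>\<^bsub>?D\<^esub> (g \<odot>\<^bsub>?D\<^esub> f)"
    if "f \<in> Hom ?D W X" "g \<in> Hom ?D X Y" "h \<in> Hom ?D Y Z" for f g h W X Y Z
    using that p by auto
  show "Obj ?D \<noteq> {}" using \<open>J \<noteq> {}\<close> by simp
  show "\<exists>k\<in>Obj ?D. Hom ?D i k \<noteq> {} \<and> Hom ?D j k \<noteq> {}" if "i \<in> Obj ?D" "j \<in> Obj ?D" for i j
  proof -
    obtain k where "k \<in> J" "R i k" "R j k" using directed \<open>i \<in> _\<close> \<open>j \<in> _\<close> by auto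
    then have "p (i, k) \<in> Hom ?D i k" "p (j, k) \<in> Hom ?D j k" using that by auto
    then show ?thesis using \<open>k \<in> J\<close> by (intro bexI[of _ k]) auto
  qed
  show "\<exists>k\<in>Obj ?D. \<exists>w\<in>Hom ?D j k. w \<odot>\<^bsub>?D\<^esub> u = w \<odot>\<^bsub>?D\<^esub> v"
    if "u \<in> Hom ?D i j" "v \<in> Hom ?D i j" for u v i j
    using that refl p by (intro bexI[of _ j] bexI[of _ "p (j, j)"]) auto
qed

section \<open>The order on quotients of a fixed object, and colimits of directed systems\<close>

context category
begin

text \<open>Among epimorphisms with common source this is the order of quotients; the second
  argument is the coarser one, with the larger kernel.\<close>

definition coarser :: "'m \<Rightarrow> 'm \<Rightarrow> bool" where
  "coarser e f \<longleftrightarrow> (\<exists>t \<in> Arr C. Src C t = Tgt C e \<and> Tgt C t = Tgt C f \<and> t \<odot> e = f)"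

definition fac :: "'m \<Rightarrow> 'm \<Rightarrow> 'm" where
  "fac e f = (SOME t. t \<in> Arr C \<and> Src C t = Tgt C e \<and> Tgt C t = Tgt C f \<and> t \<odot> e = f)"

lemma coarserI:
  "t \<in> Arr C \<Longrightarrow> Src C t = Tgt C e \<Longrightarrow> Tgt C t = Tgt C f \<Longrightarrow> t \<odot> e = f \<Longrightarrow> coarser e f"
  unfolding coarser_def by blast

lemma coarserE:
  assumes "coarser e f"
  obtains t where "t \<in> Arr C" "Src C t = Tgt C e" "Tgt C t = Tgt C f" "t \<odot> e = f"
  using assms unfolding coarser_def by blast

lemma fac:
  assumes "coarser e f"
  shows "fac e f \<in> Arr C" "Src C (fac e f) = Tgt C e" "Tgt C (fac e f) = Tgt C f" "fac e f \<odot> e = f"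
proof -
  have "\<exists>t. t \<in> Arr C \<and> Src C t = Tgt C e \<and> Tgt C t = Tgt C f \<and> t \<odot> e = f"
    using assms unfolding coarser_def by blast
  from someI_ex[OF this]
  show "fac e f \<in> Arr C" "Src C (fac e f) = Tgt C e" "Tgt C (fac e f) = Tgt C f" "fac e f \<odot> e = f"
    unfolding fac_def by blast+
qed

text \<open>A chosen factorization is unique once \<open>e\<close> is epic; functoriality and the
  cocone identities below rest on this.\<close>

lemma fac_eqI:
  assumes "epi_arr C e" "t \<in> Arr C" "Src C t = Tgt C e" "Tgt C t = Tgt C f" "t \<odot> e = f"
  shows "fac e f = t"
proof -
  note f = fac[OF coarserI[OF assms(2-5)]]
  show ?thesis by (rule epi_arrD[OF assms(1)]) (use f assms in auto)
qed

lemma coarser_refl: "epi_arr C e \<Longrightarrow> coarser e e"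
  using epi_Arr[of e] by (intro coarserI[of "Idn C (Tgt C e)"]) auto

text \<open>A diagram of quotients of \<open>I\<close>, recorded by the projections from
  \<open>I\<close> alone; the transition arrows are recovered by \<open>fac\<close>.\<close>

definition epi_system :: "'i set \<Rightarrow> ('i \<Rightarrow> 'i \<Rightarrow> bool) \<Rightarrow> 'o \<Rightarrow> ('i \<Rightarrow> 'm) \<Rightarrow> bool" where
  "epi_system J R I q \<longleftrightarrow> (\<forall>i\<in>J. epi_arr C (q i) \<and> Src C (q i) = I) \<and>
    (\<forall>i\<in>J. \<forall>j\<in>J. R i j \<longrightarrow> coarser (q i) (q j))"

text \<open>The universal arrow on \<open>I\<close> among those that factor through every
  \<open>q i\<close>. For a directed system its target is the colimit of the quotients, but the
  transition arrows do not occur in the description.\<close>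

definition epi_join :: "'i set \<Rightarrow> 'o \<Rightarrow> ('i \<Rightarrow> 'm) \<Rightarrow> 'm \<Rightarrow> bool" where
  "epi_join J I q r \<longleftrightarrow> epi_arr C r \<and> Src C r = I \<and> (\<forall>i\<in>J. coarser (q i) r) \<and>
    (\<forall>c \<in> Arr C. Src C c = I \<and> (\<forall>i\<in>J. coarser (q i) c) \<longrightarrow> coarser r c)"

lemma epi_systemD:
  assumes "epi_system J R I q" "i \<in> J"
  shows "epi_arr C (q i)" "q i \<in> Arr C" "Src C (q i) = I" "j \<in> J \<Longrightarrow> R i j \<Longrightarrow> coarser (q i) (q j)"
  using assms epi_Arr unfolding epi_system_def by blast+

lemma epi_system_functor:
  fixes p :: "'u \<times> 'u \<Rightarrow> 'u"
  assumes p: "inj_on p (J \<times> J)" and q: "epi_system J R I q"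
    and refl: "\<And>i. i \<in> J \<Longrightarrow> R i i"
    and trans: "\<And>i j k. i \<in> J \<Longrightarrow> j \<in> J \<Longrightarrow> k \<in> J \<Longrightarrow> R i j \<Longrightarrow> R j k \<Longrightarrow> R i k"
  defines "D \<equiv> order_cat J R p"
  shows "is_functor D C (\<lambda>i. Tgt C (q i)) (\<lambda>u. fac (q (Src D u)) (q (Tgt D u)))"
  unfolding is_functor_def
proof (intro conjI ballI)
  have D: "u \<in> Hom D i j \<longleftrightarrow> i \<in> J \<and> j \<in> J \<and> R i j \<and> u = p (i, j)" for u i j
    unfolding D_def by (rule order_cat_Hom[OF p])
  note q' = epi_systemD[OF q]
  fix i assume i: "i \<in> Obj D"
  then have i': "i \<in> J" by (simp add: D_def)
  show "Tgt C (q i) \<in> Obj C" using q'[OF i'] by simp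
  have "fac (q i) (q i) = Idn C (Tgt C (q i))" by (rule fac_eqI) (use q'[OF i'] in auto)
  then show "fac (q (Src D (Idn D i))) (q (Tgt D (Idn D i))) = Idn C (Tgt C (q i))"
    using i' p by (simp add: D_def)
  fix j assume "j \<in> Obj D"
  then have j': "j \<in> J" by (simp add: D_def)
  fix u assume "u \<in> Hom D i j"
  then have u: "R i j" "u = p (i, j)" unfolding D by blast+
  have uST: "Src D u = i" "Tgt D u = j" using u i' j' p by (simp_all add: D_def)
  note fu = fac[OF q'(4)[OF i' j' u(1)]]
  show "fac (q (Src D u)) (q (Tgt D u)) \<in> Hom C (Tgt C (q i)) (Tgt C (q j))"
    unfolding uST using fu by simp
  fix k assume "k \<in> Obj D"
  then have k': "k \<in> J" by (simp add: D_def)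
  fix v assume "v \<in> Hom D j k"
  then have v: "R j k" "v = p (j, k)" unfolding D by blast+
  have vST: "Src D v = j" "Tgt D v = k" using v j' k' p by (simp_all add: D_def)
  note fv = fac[OF q'(4)[OF j' k' v(1)]]
  have vuST: "Src D (v \<odot>\<^bsub>D\<^esub> u) = i" "Tgt D (v \<odot>\<^bsub>D\<^esub> u) = k"
    using u v i' j' k' p by (simp_all add: D_def)
  have "fac (q i) (q k) = fac (q j) (q k) \<odot> fac (q i) (q j)"
    by (rule fac_eqI) (use q'[OF i'] fu fv in auto)
  then show "fac (q (Src D (v \<odot>\<^bsub>D\<^esub> u))) (q (Tgt D (v \<odot>\<^bsub>D\<^esub> u))) =
      fac (q (Src D v)) (q (Tgt D v)) \<odot> fac (q (Src D u)) (q (Tgt D u))"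
    unfolding uST vST vuST .
qed

text \<open>A cocone \<open>f\<close> gives arrows \<open>f i \<odot> q i\<close> out of
  \<open>I\<close>. They agree by directedness, and their common value factors through every
  \<open>q i\<close>, hence through \<open>r\<close>.\<close>

lemma epi_system_colimit:
  fixes p :: "'u \<times> 'u \<Rightarrow> 'u"
  assumes p: "inj_on p (J \<times> J)" and q: "epi_system J R I q" and r: "epi_join J I q r"
    and "J \<noteq> {}" and directed: "\<And>i j. i \<in> J \<Longrightarrow> j \<in> J \<Longrightarrow> \<exists>k\<in>J. R i k \<and> R j k"
  defines "D \<equiv> order_cat J R p"
  shows "is_colimit D C (\<lambda>i. Tgt C (q i)) (\<lambda>u. fac (q (Src D u)) (q (Tgt D u)))
    (Tgt C r) (\<lambda>i. fac (q i) r)"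
  unfolding is_colimit_def
proof (intro conjI allI impI)
  have D: "u \<in> Hom D i j \<longleftrightarrow> i \<in> J \<and> j \<in> J \<and> R i j \<and> u = p (i, j)" for u i j
    unfolding D_def by (rule order_cat_Hom[OF p])
  have D_Obj: "Obj D = J" by (simp add: D_def)
  have D_ST: "Src D (p (i, j)) = i" "Tgt D (p (i, j)) = j" if "i \<in> J" "j \<in> J" for i j
    using that p by (simp_all add: D_def)
  note q' = epi_systemD[OF q]
  have r': "epi_arr C r" "r \<in> Arr C" "Src C r = I" "\<And>i. i \<in> J \<Longrightarrow> coarser (q i) r"
    "\<And>c. c \<in> Arr C \<Longrightarrow> Src C c = I \<Longrightarrow> (\<And>i. i \<in> J \<Longrightarrow> coarser (q i) c) \<Longrightarrow> coarser r c"
    using r epi_Arr unfolding epi_join_def by blast+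
  note fr = fac[OF r'(4)]
  show "is_cocone D C (\<lambda>i. Tgt C (q i)) (\<lambda>u. fac (q (Src D u)) (q (Tgt D u)))
      (Tgt C r) (\<lambda>i. fac (q i) r)"
    unfolding is_cocone_def D_Obj
  proof (intro conjI ballI)
    show "Tgt C r \<in> Obj C" using r' by simp
    show "fac (q i) r \<in> Hom C (Tgt C (q i)) (Tgt C r)" if "i \<in> J" for i using fr[OF that] by simp
    fix i j u assume ij: "i \<in> J" "j \<in> J" and "u \<in> Hom D i j"
    then have u: "R i j" "u = p (i, j)" unfolding D by blast+
    note fu = fac[OF q'(4)[OF ij u(1)]]
    have "fac (q i) r = fac (q j) r \<odot> fac (q i) (q j)"
      by (rule fac_eqI) (use q'[OF ij(1)] fu fr[OF ij(2)] in auto)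
    then show "fac (q j) r \<odot> fac (q (Src D u)) (q (Tgt D u)) = fac (q i) r"
      unfolding u D_ST[OF ij] ..
  qed
  fix X f assume "is_cocone D C (\<lambda>i. Tgt C (q i)) (\<lambda>u. fac (q (Src D u)) (q (Tgt D u))) X f"
  then have X: "X \<in> Obj C" and f0: "\<forall>i\<in>J. f i \<in> Hom C (Tgt C (q i)) X"
    and f1: "\<forall>i\<in>J. \<forall>j\<in>J. \<forall>u\<in>Hom D i j. f j \<odot> fac (q (Src D u)) (q (Tgt D u)) = f i"
    unfolding is_cocone_def D_Obj by blast+
  have f: "f i \<in> Arr C" "Src C (f i) = Tgt C (q i)" "Tgt C (f i) = X" if "i \<in> J" for i
    using f0 that by auto
  have step: "f j \<odot> q j = f i \<odot> q i" if ij: "i \<in> J" "j \<in> J" "R i j" for i j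
  proof -
    note fu = fac[OF q'(4)[OF ij]]
    have "p (i, j) \<in> Hom D i j" unfolding D using ij by blast
    then have "f j \<odot> fac (q i) (q j) = f i" using f1 ij D_ST[OF ij(1,2)] by metis
    then have "f j \<odot> (fac (q i) (q j) \<odot> q i) = f i \<odot> q i"
      by (rule Comp_eq_Comp) (use fu f[OF ij(1)] f[OF ij(2)] q'[OF ij(1)] in auto)
    then show ?thesis unfolding fu(4) .
  qed
  obtain i0 where i0: "i0 \<in> J" using \<open>J \<noteq> {}\<close> by blast
  define c where "c = f i0 \<odot> q i0"
  have c: "c \<in> Arr C" "Src C c = I" "Tgt C c = X"
    unfolding c_def using f[OF i0] q'[OF i0] by auto
  have fq: "f i \<odot> q i = c" if i: "i \<in> J" for i
  proof -
    obtain k where "k \<in> J" "R i k" "R i0 k" using directed[OF i i0] by blast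
    then show ?thesis using step[OF i, of k] step[OF i0, of k] unfolding c_def by simp
  qed
  have "coarser (q i) c" if i: "i \<in> J" for i
    by (rule coarserI[of "f i"]) (use f[OF i] fq[OF i] c in auto)
  note u = fac[OF r'(5)[OF c(1,2) this]]
  have "fac r c \<odot> fac (q i) r = f i" if i: "i \<in> J" for i
    by (rule epi_arrD[OF q'(1)[OF i]]) (use u fr[OF i] q'[OF i] f[OF i] fq[OF i] c in auto)
  moreover have "v = fac r c" if v: "v \<in> Hom C (Tgt C r) X" "\<forall>i\<in>J. v \<odot> fac (q i) r = f i" for v
  proof (rule fac_eqI[OF r'(1), symmetric])
    have "v \<odot> (fac (q i0) r \<odot> q i0) = f i0 \<odot> q i0"
      by (rule Comp_eq_Comp[OF v(2)[rule_format, OF i0]]) (use v fr[OF i0] q'[OF i0] in auto)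
    then show "v \<odot> r = c" unfolding fr(4)[OF i0] c_def .
  qed (use v c in auto)
  moreover have "fac r c \<in> Hom C (Tgt C r) X" using u c by simp
  ultimately show "\<exists>!u. u \<in> Hom C (Tgt C r) X \<and> (\<forall>i\<in>Obj D. u \<odot> fac (q i) r = f i)"
    unfolding D_Obj by blast
qed

end

lemma (in abelian_category) mono_cokernel_short_exact:
  assumes "mono_arr C m" "is_cokernel C m Q q"
  shows "short_exact C m q"
  using mono_kernel_of_cokernel[OF assms] assms is_cokernelD(5)[OF assms(2)]
  unfolding short_exact_def by simp

section \<open>Consequences of the exactness of filtered colimits\<close>

context grothendieck_category
begin

text \<open>Each \<open>q i \<odot> a\<close> with its cokernel \<open>b i\<close> is a short exact
  sequence. The three terms are functors on \<open>J\<close>, with colimits \<open>A\<close>, the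
  target of \<open>r\<close> and the cokernel \<open>N\<close> of \<open>r \<odot> a\<close>.
  Exactness of filtered colimits makes \<open>r \<odot> a\<close> a kernel of \<open>s\<close>, in
  particular monic.\<close>

lemma mono_into_epi_join:
  assumes J: "J \<subseteq> U" "small U J" "J \<noteq> {}"
    and refl: "\<And>i. i \<in> J \<Longrightarrow> R i i"
    and trans: "\<And>i j k. i \<in> J \<Longrightarrow> j \<in> J \<Longrightarrow> k \<in> J \<Longrightarrow> R i j \<Longrightarrow> R j k \<Longrightarrow> R i k"
    and directed: "\<And>i j. i \<in> J \<Longrightarrow> j \<in> J \<Longrightarrow> \<exists>k\<in>J. R i k \<and> R j k"
    and q: "epi_system J R I q" and r: "epi_join J I q r"
    and a: "a \<in> Arr C" "Tgt C a = I" and qa: "\<And>i. i \<in> J \<Longrightarrow> mono_arr C (q i \<odot> a)"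
  shows "mono_arr C (r \<odot> a)"
proof -
  have "|U \<times> U| =o |U|" using universe unfolding universe_def by (intro card_of_Times_same_infinite) blast
  then obtain p where p0: "bij_betw p (U \<times> U) U" using card_of_ordIso by blast
  have p: "inj_on p (J \<times> J)"
    by (rule inj_on_subset[OF bij_betw_imp_inj_on[OF p0] Sigma_mono]) (use J(1) in auto)
  have pU: "p ` (J \<times> J) \<subseteq> U"
    using image_mono[OF Sigma_mono[OF J(1) J(1)], of p] unfolding bij_betw_imp_surj_on[OF p0] .
  define D where "D = order_cat J R p"
  have D_Obj: "Obj D = J" by (simp add: D_def)
  have D_Arr: "Arr D \<subseteq> p ` (J \<times> J)" by (auto simp: D_def)
  have D_Hom: "u \<in> Hom D i j \<longleftrightarrow> i \<in> J \<and> j \<in> J \<and> R i j \<and> u = p (i, j)" for u i j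
    unfolding D_def by (rule order_cat_Hom[OF p])
  have D_ST: "Src D (p (i, j)) = i" "Tgt D (p (i, j)) = j" if "i \<in> J" "j \<in> J" for i j
    using that p by (simp_all add: D_def)
  have filt: "filtered_category D" unfolding D_def
    by (rule order_cat_filtered[OF p J(3) refl trans directed])
  have small_Arr: "small U (Arr D)"
    by (rule small_subset[OF D_Arr]) (intro small_image small_Sigma universe J(2))
  note q' = epi_systemD[OF q]
  have r': "epi_arr C r" "r \<in> Arr C" "Src C r = I" "\<And>i. i \<in> J \<Longrightarrow> coarser (q i) r"
    "\<And>c. c \<in> Arr C \<Longrightarrow> Src C c = I \<Longrightarrow> (\<And>i. i \<in> J \<Longrightarrow> coarser (q i) c) \<Longrightarrow> coarser r c"
    using r epi_Arr unfolding epi_join_def by blast+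
  note fr = fac[OF r'(4)]
  define A where "A = Src C a"
  have A: "A \<in> Obj C" using a by (simp add: A_def)
  \<comment> \<open>The constant diagram at \<open>A\<close> is treated as a system of identities,
    so that the lemmas on systems of epimorphisms provide its functor and its colimit. The colimit
    is \<open>A\<close> because \<open>J\<close> is not empty.\<close>
  let ?e = "\<lambda>i::'u. Idn C A"
  have e: "epi_system J R A ?e"
    unfolding epi_system_def using A coarser_refl[OF Idn_epi[OF A]] by simp
  have eI: "epi_join J A ?e (Idn C A)"
    unfolding epi_join_def using A coarser_refl[OF Idn_epi[OF A]] J(3) by (simp add: ex_in_conv)
  have "\<exists>B b. is_cokernel C (q i \<odot> a) B b" if "i \<in> J" for i
    by (rule has_cokernels) (use q'[OF that] a in auto)
  then obtain B b where b: "is_cokernel C (q i \<odot> a) (B i) (b i)" if "i \<in> J" for i by metis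
  have b': "b i \<in> Arr C" "Src C (b i) = Tgt C (q i)" "Tgt C (b i) = B i"
    "b i \<odot> (q i \<odot> a) = Zero C A (B i)" "epi_arr C (b i)" if "i \<in> J" for i
    using is_cokernelD[OF b[OF that]] is_cokernel_epi[OF b[OF that]] q'[OF that] a by (auto simp: A_def)
  obtain N s where s: "is_cokernel C (r \<odot> a) N s" using has_cokernels[of "r \<odot> a"] r' a by auto
  have s': "s \<in> Arr C" "Src C s = Tgt C r" "Tgt C s = N" "s \<odot> (r \<odot> a) = Zero C A N" "epi_arr C s" "N \<in> Obj C"
    using is_cokernelD[OF s] is_cokernel_epi[OF s] r' a by (auto simp: A_def)
  \<comment> \<open>The cokernels \<open>B i\<close> are presented as quotients of \<open>I\<close>,
    which makes them a system of epimorphisms of the same kind.\<close>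
  let ?w = "\<lambda>i. b i \<odot> q i"
  have w_arr: "?w i \<in> Arr C" "Src C (?w i) = I" "Tgt C (?w i) = B i" "epi_arr C (?w i)" if "i \<in> J" for i
    using b'[OF that] q'[OF that] by (auto intro!: epi_arr_Comp)
  have w_le: "coarser (?w i) c" if i: "i \<in> J" and c: "c \<in> Arr C" "Src C c = I" "c \<odot> a = Zero C A (Tgt C c)"
    and qc: "coarser (q i) c" for i c
  proof -
    obtain t where t: "t \<in> Arr C" "Src C t = Tgt C (q i)" "Tgt C t = Tgt C c" "t \<odot> q i = c"
      using qc by (rule coarserE)
    have "t \<odot> (q i \<odot> a) = c \<odot> a" by (rule Comp_eq_Comp[OF t(4)]) (use t q'[OF i] a in auto)
    then have "Src C t = Tgt C (q i \<odot> a)" "t \<odot> (q i \<odot> a) = Zero C (Src C (q i \<odot> a)) (Tgt C c)"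
      using c t q'[OF i] a by (auto simp: A_def)
    then obtain u where u: "u \<in> Arr C" "Src C u = B i" "Tgt C u = Tgt C c" "u \<odot> b i = t"
      by (rule is_cokernelE[OF b[OF i] t(1,3)])
    have "u \<odot> (b i \<odot> q i) = t \<odot> q i"
      by (rule Comp_eq_Comp[OF u(4)]) (use u b'[OF i] q'[OF i] in auto)
    then show ?thesis using u w_arr[OF i] t(4) by (intro coarserI[of u]) auto
  qed
  have wa: "?w i \<odot> a = Zero C A (B i)" if "i \<in> J" for i using b'[OF that] q'[OF that] a by simp
  have w: "epi_system J R I ?w"
    unfolding epi_system_def
  proof (intro conjI ballI impI)
    fix i j assume ij: "i \<in> J" "j \<in> J" "R i j"
    show "coarser (?w i) (?w j)"
    proof (rule w_le[OF ij(1)])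
      note fu = fac[OF q'(4)[OF ij]]
      show "coarser (q i) (?w j)"
        by (rule coarserI[of "b j \<odot> fac (q i) (q j)"])
          (use fu b'[OF ij(2)] q'(2,3)[OF ij(1)] q'(2,3)[OF ij(2)] in auto)
    qed (use w_arr[OF ij(2)] wa[OF ij(2)] in auto)
  qed (use w_arr in auto)
  have sr: "s \<odot> r \<in> Arr C" "Src C (s \<odot> r) = I" "Tgt C (s \<odot> r) = N" "epi_arr C (s \<odot> r)"
    using s' r' by (auto intro!: epi_arr_Comp)
  have sra: "(s \<odot> r) \<odot> a = Zero C A N" using s' r' a by simp
  \<comment> \<open>The colimit of the cokernels is the cokernel of \<open>r \<odot> a\<close>: an
    arrow that factors through all \<open>?w i\<close> factors through all \<open>q i\<close>, hence
    through \<open>r\<close>. It also kills \<open>a\<close>, so the factor on the target of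
    \<open>r\<close> factors through \<open>s\<close>.\<close>
  have wJ: "epi_join J I ?w (s \<odot> r)"
    unfolding epi_join_def
  proof (intro conjI ballI impI)
    show "epi_arr C (s \<odot> r)" "Src C (s \<odot> r) = I" by (fact sr)+
    show "coarser (?w i) (s \<odot> r)" if i: "i \<in> J" for i
    proof (rule w_le[OF i sr(1,2)])
      show "(s \<odot> r) \<odot> a = Zero C A (Tgt C (s \<odot> r))" using sra sr by simp
      show "coarser (q i) (s \<odot> r)"
        by (rule coarserI[of "s \<odot> fac (q i) r"]) (use fr[OF i] s' r'(2,3) q'[OF i] in auto)
    qed
    fix c assume c: "c \<in> Arr C" and "Src C c = I \<and> (\<forall>i\<in>J. coarser (?w i) c)"
    then have cI: "Src C c = I" and cw: "\<And>i. i \<in> J \<Longrightarrow> coarser (?w i) c" by blast+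
    have X: "Tgt C c \<in> Obj C" using c by simp
    have cq: "coarser (q i) c" if i: "i \<in> J" for i
    proof -
      obtain t where t: "t \<in> Arr C" "Src C t = Tgt C (?w i)" "Tgt C t = Tgt C c" "t \<odot> ?w i = c"
        using cw[OF i] by (rule coarserE)
      show ?thesis by (rule coarserI[of "t \<odot> b i"]) (use t b'[OF i] q'[OF i] w_arr[OF i] in auto)
    qed
    obtain i where i: "i \<in> J" using J(3) by blast
    have ca: "c \<odot> a = Zero C A (Tgt C c)"
    proof -
      obtain t where t: "t \<in> Arr C" "Src C t = Tgt C (?w i)" "Tgt C t = Tgt C c" "t \<odot> ?w i = c"
        using cw[OF i] by (rule coarserE)
      have "t \<odot> (?w i \<odot> a) = c \<odot> a" by (rule Comp_eq_Comp[OF t(4)]) (use t w_arr[OF i] a in auto)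
      then show ?thesis unfolding wa[OF i] using t w_arr[OF i] A by simp
    qed
    obtain u where u: "u \<in> Arr C" "Src C u = Tgt C r" "Tgt C u = Tgt C c" "u \<odot> r = c"
      using r'(5)[OF c cI cq] by (rule coarserE)
    have "u \<odot> (r \<odot> a) = c \<odot> a" by (rule Comp_eq_Comp[OF u(4)]) (use u r'(2,3) a in auto)
    then have "Src C u = Tgt C (r \<odot> a)" "u \<odot> (r \<odot> a) = Zero C (Src C (r \<odot> a)) (Tgt C c)"
      using ca u r'(2,3) a by (auto simp: A_def)
    then obtain v where v: "v \<in> Arr C" "Src C v = N" "Tgt C v = Tgt C c" "v \<odot> s = u"
      by (rule is_cokernelE[OF s u(1,3)])
    have "v \<odot> (s \<odot> r) = u \<odot> r" by (rule Comp_eq_Comp[OF v(4)]) (use v s' r'(2,3) in auto)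
    then show "coarser (s \<odot> r) c" using v u sr by (intro coarserI[of v]) auto
  qed
  let ?F = "\<lambda>q u. fac (q (Src D u)) (q (Tgt D u))"
  have fe: "fac (Idn C A) (Idn C A) = Idn C A" by (rule fac_eqI) (use A in auto)
  have nat1: "is_natural_transformation D C (\<lambda>i. Tgt C (?e i)) (?F ?e) (\<lambda>i. Tgt C (q i)) (?F q) (\<lambda>i. q i \<odot> a)"
    unfolding is_natural_transformation_def D_Obj
  proof (intro conjI ballI)
    show "q i \<odot> a \<in> Hom C (Tgt C (?e i)) (Tgt C (q i))" if "i \<in> J" for i
      using q'[OF that] a A by (simp add: A_def)
    fix i j u assume ij: "i \<in> J" "j \<in> J" and "u \<in> Hom D i j"
    then have u: "R i j" "u = p (i, j)" unfolding D_Hom by blast+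
    note fu = fac[OF q'(4)[OF ij u(1)]]
    have "fac (q i) (q j) \<odot> (q i \<odot> a) = q j \<odot> a"
      by (rule Comp_eq_Comp[OF fu(4)]) (use fu q'[OF ij(1)] a in auto)
    then show "(q j \<odot> a) \<odot> ?F ?e u = ?F q u \<odot> (q i \<odot> a)"
      unfolding u D_ST[OF ij] fe using q'[OF ij(2)] a by (simp add: A_def)
  qed
  have nat2: "is_natural_transformation D C (\<lambda>i. Tgt C (q i)) (?F q) (\<lambda>i. Tgt C (?w i)) (?F ?w) b"
    unfolding is_natural_transformation_def D_Obj
  proof (intro conjI ballI)
    show "b i \<in> Hom C (Tgt C (q i)) (Tgt C (?w i))" if "i \<in> J" for i
      using b'[OF that] q'[OF that] by simp
    fix i j u assume ij: "i \<in> J" "j \<in> J" and "u \<in> Hom D i j"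
    then have u: "R i j" "u = p (i, j)" unfolding D_Hom by blast+
    note fu = fac[OF q'(4)[OF ij u(1)]] and fw = fac[OF epi_systemD(4)[OF w ij u(1)]]
    note bi = b'[OF ij(1)] and bj = b'[OF ij(2)] and qi = q'(1-3)[OF ij(1)] and qj = q'(1-3)[OF ij(2)]
    note wi = w_arr[OF ij(1)] and wj = w_arr[OF ij(2)]
    have "b j \<odot> fac (q i) (q j) = fac (?w i) (?w j) \<odot> b i"
    proof (rule epi_arrD[OF qi(1)])
      have "(b j \<odot> fac (q i) (q j)) \<odot> q i = b j \<odot> (fac (q i) (q j) \<odot> q i)"
        using fu(1-3) bj qi by (intro assoc) auto
      also have "\<dots> = fac (?w i) (?w j) \<odot> (b i \<odot> q i)" unfolding fu(4) fw(4) ..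
      also have "\<dots> = (fac (?w i) (?w j) \<odot> b i) \<odot> q i"
        using fw(1-3) bi qi wi by (intro assoc[symmetric]) auto
      finally show "(b j \<odot> fac (q i) (q j)) \<odot> q i = (fac (?w i) (?w j) \<odot> b i) \<odot> q i" .
    qed (use fu(1-3) fw(1-3) bi bj wi wj in auto)
    then show "b j \<odot> ?F q u = ?F ?w u \<odot> b i" unfolding u D_ST[OF ij] .
  qed
  have funs: "is_functor D C (\<lambda>i. Tgt C (?e i)) (?F ?e)" "is_functor D C (\<lambda>i. Tgt C (q i)) (?F q)"
    "is_functor D C (\<lambda>i. Tgt C (?w i)) (?F ?w)"
    unfolding D_def
    by (rule epi_system_functor[OF p e refl trans] epi_system_functor[OF p q refl trans]
        epi_system_functor[OF p w refl trans]; assumption)+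
  have colims: "is_colimit D C (\<lambda>i. Tgt C (?e i)) (?F ?e) (Tgt C (Idn C A)) (\<lambda>i. fac (?e i) (Idn C A))"
    "is_colimit D C (\<lambda>i. Tgt C (q i)) (?F q) (Tgt C r) (\<lambda>i. fac (q i) r)"
    "is_colimit D C (\<lambda>i. Tgt C (?w i)) (?F ?w) (Tgt C (s \<odot> r)) (\<lambda>i. fac (?w i) (s \<odot> r))"
    unfolding D_def
    by (rule epi_system_colimit[OF p e eI J(3) directed] epi_system_colimit[OF p q r J(3) directed]
        epi_system_colimit[OF p w wJ J(3) directed]; assumption)+
  have ses: "\<forall>i\<in>Obj D. short_exact C (q i \<odot> a) (b i)"
    unfolding D_Obj using mono_cokernel_short_exact[OF qa b] by blast
  have ra: "r \<odot> a \<in> Hom C (Tgt C (Idn C A)) (Tgt C r)" using r' a A by (simp add: A_def)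
  have comm1: "\<forall>i\<in>Obj D. (r \<odot> a) \<odot> fac (?e i) (Idn C A) = fac (q i) r \<odot> (q i \<odot> a)"
    unfolding D_Obj fe
  proof
    fix i assume i: "i \<in> J"
    have "fac (q i) r \<odot> (q i \<odot> a) = r \<odot> a"
      by (rule Comp_eq_Comp[OF fr(4)[OF i]]) (use fr(1-3)[OF i] q'[OF i] a in auto)
    then show "(r \<odot> a) \<odot> Idn C A = fac (q i) r \<odot> (q i \<odot> a)" using r' a by (simp add: A_def)
  qed
  have s_Hom: "s \<in> Hom C (Tgt C r) (Tgt C (s \<odot> r))" using s' sr by simp
  have comm2: "\<forall>i\<in>Obj D. s \<odot> fac (q i) r = fac (?w i) (s \<odot> r) \<odot> b i"
    unfolding D_Obj
  proof
    fix i assume i: "i \<in> J"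
    have "coarser (?w i) (s \<odot> r)" using wJ i unfolding epi_join_def by blast
    note fw = fac[OF this] and fri = fr[OF i] and qi = q'(1-3)[OF i] and bi = b'[OF i] and wi = w_arr[OF i]
    show "s \<odot> fac (q i) r = fac (?w i) (s \<odot> r) \<odot> b i"
    proof (rule epi_arrD[OF qi(1)])
      have "(s \<odot> fac (q i) r) \<odot> q i = s \<odot> (fac (q i) r \<odot> q i)"
        using fri(1-3) s' qi by (intro assoc) auto
      also have "\<dots> = fac (?w i) (s \<odot> r) \<odot> (b i \<odot> q i)" unfolding fri(4) fw(4) ..
      also have "\<dots> = (fac (?w i) (s \<odot> r) \<odot> b i) \<odot> q i"
        using fw(1-3) bi qi wi by (intro assoc[symmetric]) auto
      finally show "(s \<odot> fac (q i) r) \<odot> q i = (fac (?w i) (s \<odot> r) \<odot> b i) \<odot> q i" .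
    qed (use fri(1-3) fw(1-3) bi wi s' sr in auto)
  qed
  have "short_exact C (r \<odot> a) s"
    by (rule filtered_colimits_exact[unfolded filtered_colimits_exact_def, rule_format,
        where D = D and F\<^sub>o = "\<lambda>i. Tgt C (?e i)" and F\<^sub>a = "?F ?e" and G\<^sub>o = "\<lambda>i. Tgt C (q i)" and G\<^sub>a = "?F q"
          and H\<^sub>o = "\<lambda>i. Tgt C (?w i)" and H\<^sub>a = "?F ?w" and \<alpha> = "\<lambda>i. q i \<odot> a" and \<beta> = b
          and L = "Tgt C (Idn C A)" and M = "Tgt C r" and N = "Tgt C (s \<odot> r)"
          and \<iota>\<^sub>L = "\<lambda>i. fac (?e i) (Idn C A)" and \<iota>\<^sub>M = "\<lambda>i. fac (q i) r"
          and \<iota>\<^sub>N = "\<lambda>i. fac (?w i) (s \<odot> r)"])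
      (intro conjI filt funs nat1 nat2 colims ses ra comm1 s_Hom comm2 small_Arr;
        use J pU D_Arr D_Obj in blast)
  then show ?thesis unfolding short_exact_def by (blast intro: is_kernel_mono)
qed

end

section \<open>Essential quotients\<close>

context grothendieck_category
begin

lemma coarser_quotient_by:
  assumes "quotient_by H q" "c \<in> Arr C" "Src C c = Src C q" "\<And>h. h \<in> H \<Longrightarrow> c \<odot> h = Zero C (Src C h) (Tgt C c)"
  shows "coarser q c"
  using quotient_byE[OF assms] coarserI by metis

lemma coarser_Zero:
  assumes "coarser e c" "e \<in> Arr C" "h \<in> Arr C" "Src C h = X" "Tgt C h = Src C e" "e \<odot> h = Zero C X (Tgt C e)"
  shows "c \<odot> h = Zero C X (Tgt C c)"
proof -
  obtain t where t: "t \<in> Arr C" "Src C t = Tgt C e" "Tgt C t = Tgt C c" "t \<odot> e = c"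
    using assms(1) by (rule coarserE)
  have "t \<odot> (e \<odot> h) = c \<odot> h" by (rule Comp_eq_Comp[OF t(4)]) (use t assms(2-5) in auto)
  moreover have "X \<in> Obj C" using assms(3,4) by auto
  ultimately show ?thesis unfolding assms(6) using t by simp
qed

lemma coarser_mono:
  assumes "coarser e c" "e \<in> Arr C" "a \<in> Arr C" "Tgt C a = Src C e" "mono_arr C (c \<odot> a)"
  shows "mono_arr C (e \<odot> a)"
proof -
  obtain t where t: "t \<in> Arr C" "Src C t = Tgt C e" "Tgt C t = Tgt C c" "t \<odot> e = c"
    using assms(1) by (rule coarserE)
  have "t \<odot> (e \<odot> a) = c \<odot> a" by (rule Comp_eq_Comp[OF t(4)]) (use t assms(2-4) in auto)
  then have "mono_arr C (t \<odot> (e \<odot> a))" using assms(5) by simp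
  then show ?thesis by (rule mono_arr_cancel) (use t assms(2-4) in auto)
qed

text \<open>Zorn's lemma on the sets of arrows from a generator into \<open>I\<close>; exactness of filtered colimits
  makes the relevant property closed under unions of chains.\<close>

lemma ex_essential_quotient:
  assumes "mono_arr C a" "Tgt C a = I"
  obtains q where "epi_arr C q" "Src C q = I" "mono_arr C (q \<odot> a)"
    "\<forall>r \<in> Arr C. Src C r = Tgt C q \<and> mono_arr C (r \<odot> (q \<odot> a)) \<longrightarrow> mono_arr C r"
proof -
  note a = mono_Arr[OF assms(1)]
  have I: "I \<in> Obj C" using a assms(2) by auto
  obtain G where gen: "is_generator C G" using has_generator by blast
  then have G: "G \<in> Obj C" unfolding is_generator_def by blast
  have "\<exists>q. quotient_by H q \<and> Src C q = I" if "H \<subseteq> Hom C G I" for H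
    by (rule ex_quotient_by[OF G I that]) blast
  then obtain qq where qq: "quotient_by H (qq H)" "Src C (qq H) = I" if "H \<subseteq> Hom C G I" for H
    by metis
  note qqD = quotient_byD[OF qq(1)]
  \<comment> \<open>That \<open>a\<close> stays monic modulo \<open>H\<close> means that the
    subobject generated by \<open>H\<close> meets \<open>a\<close> in zero. A maximal
    \<open>H\<close> therefore generates a complement.\<close>
  define \<A> where "\<A> = {H. H \<subseteq> Hom C G I \<and> mono_arr C (qq H \<odot> a)}"
  have empty: "{} \<in> \<A>"
  proof -
    have "coarser (qq {}) (Idn C I)" by (rule coarser_quotient_by[OF qq(1)]) (use qq I in auto)
    then have "mono_arr C (qq {} \<odot> a)"
      by (rule coarser_mono) (use qqD(2)[of "{}"] qq(2)[of "{}"] a assms in auto)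
    then show ?thesis unfolding \<A>_def by simp
  qed
  have union: "\<Union>\<C> \<in> \<A>" if \<C>: "\<C> \<noteq> {}" "subset.chain \<A> \<C>" for \<C>
  proof -
    have chain: "H \<subseteq> H' \<or> H' \<subseteq> H" if "H \<in> \<C>" "H' \<in> \<C>" for H H'
      using \<C>(2) that unfolding subset_chain_def by blast
    have sub: "H \<subseteq> Hom C G I" "mono_arr C (qq H \<odot> a)" if "H \<in> \<C>" for H
      using \<C>(2) that unfolding subset_chain_def \<A>_def by blast+
    have Un: "\<Union>\<C> \<subseteq> Hom C G I" using sub(1) by blast
    \<comment> \<open>To index a filtered colimit the chain has to be small; it is a set of subsets
      of one hom-set, so the strong limit property applies.\<close>
    have "small U (Pow (Hom C G I))" by (intro small_Pow universe locally_small G I)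
    then have "small U \<C>" by (rule small_subset[rotated]) (use sub(1) in blast)
    then obtain e where e: "inj_on e \<C>" "e ` \<C> \<subseteq> U" by (rule small_code)
    define F where "F = inv_into \<C> e"
    have F: "F i \<in> \<C>" if "i \<in> e ` \<C>" for i unfolding F_def by (rule inv_into_into[OF that])
    have Fe: "F (e H) = H" if "H \<in> \<C>" for H unfolding F_def by (rule inv_into_f_f[OF e(1) that])
    have mono: "coarser (qq H) (qq H')" if "H \<subseteq> H'" "H' \<subseteq> Hom C G I" for H H'
    proof (rule coarser_quotient_by[OF qq(1)])
      show H: "H \<subseteq> Hom C G I" using that by blast
      show "qq H' \<in> Arr C" "Src C (qq H') = Src C (qq H)" using qqD(2) qq(2) that(2) H by simp_all
      show "qq H' \<odot> h = Zero C (Src C h) (Tgt C (qq H'))" if "h \<in> H" for h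
        by (rule qqD(3)[OF \<open>H' \<subseteq> Hom C G I\<close>]) (use that \<open>H \<subseteq> H'\<close> in auto)
    qed
    have "mono_arr C (qq (\<Union>\<C>) \<odot> a)"
    proof (rule mono_into_epi_join[where J = "e ` \<C>" and R = "\<lambda>i j. F i \<subseteq> F j" and q = "\<lambda>i. qq (F i)" and I = I])
      show "e ` \<C> \<subseteq> U" "small U (e ` \<C>)" "e ` \<C> \<noteq> {}"
        using e(2) small_image[OF \<open>small U \<C>\<close>] \<C>(1) by blast+
      show "\<exists>k\<in>e ` \<C>. F i \<subseteq> F k \<and> F j \<subseteq> F k" if "i \<in> e ` \<C>" "j \<in> e ` \<C>" for i j
        using chain[OF F[OF that(1)] F[OF that(2)]] that by blast
      show "epi_system (e ` \<C>) (\<lambda>i j. F i \<subseteq> F j) I (\<lambda>i. qq (F i))"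
        unfolding epi_system_def using qqD(1)[OF sub(1)[OF F]] qq(2)[OF sub(1)[OF F]] mono[OF _ sub(1)[OF F]]
        by blast
      \<comment> \<open>An arrow that factors through the quotient by every member of the chain
        kills every arrow in the union, so it factors through the quotient by the union.\<close>
      show "epi_join (e ` \<C>) I (\<lambda>i. qq (F i)) (qq (\<Union>\<C>))"
        unfolding epi_join_def
      proof (intro conjI ballI impI)
        show "epi_arr C (qq (\<Union>\<C>))" "Src C (qq (\<Union>\<C>)) = I" using qqD(1)[OF Un] qq(2)[OF Un] by blast+
        show "coarser (qq (F i)) (qq (\<Union>\<C>))" if "i \<in> e ` \<C>" for i
          by (rule mono[OF _ Un]) (use F[OF that] in blast)
        fix c assume c: "c \<in> Arr C" "Src C c = I \<and> (\<forall>i\<in>e ` \<C>. coarser (qq (F i)) c)"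
        show "coarser (qq (\<Union>\<C>)) c"
        proof (rule coarser_quotient_by[OF qq(1)[OF Un] c(1)])
          show "Src C c = Src C (qq (\<Union>\<C>))" using c qq(2)[OF Un] by simp
          fix h assume "h \<in> \<Union>\<C>"
          then obtain H where H: "H \<in> \<C>" "h \<in> H" by blast
          have "coarser (qq (F (e H))) c" using c(2) H(1) by blast
          then have "coarser (qq H) c" unfolding Fe[OF H(1)] .
          moreover have "h \<in> Hom C G I" using H sub(1) by blast
          ultimately show "c \<odot> h = Zero C (Src C h) (Tgt C c)"
            by - (rule coarser_Zero[OF _ qqD(2)[OF sub(1)[OF H(1)]] _ refl _ qqD(3)[OF sub(1)[OF H(1)] H(2) refl]],
                use qq(2)[OF sub(1)[OF H(1)]] in auto)
        qed
      qed
    qed (use a assms(2) sub(2) F in auto)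
    then show ?thesis unfolding \<A>_def using Un by blast
  qed
  have "\<exists>M\<in>\<A>. \<forall>X\<in>\<A>. M \<subseteq> X \<longrightarrow> X = M"
    by (rule subset_Zorn_nonempty[OF _ union]) (use empty in blast)
  then obtain M where "M \<in> \<A>" and max0: "\<forall>X\<in>\<A>. M \<subseteq> X \<longrightarrow> X = M" by blast
  then have M: "M \<subseteq> Hom C G I" "mono_arr C (qq M \<odot> a)" unfolding \<A>_def by blast+
  have max: "H = M" if "H \<subseteq> Hom C G I" "mono_arr C (qq H \<odot> a)" "M \<subseteq> H" for H
    using max0 that unfolding \<A>_def by blast
  define q where "q = qq M"
  note q = qqD(1,2)[OF M(1), folded q_def] qq(2)[OF M(1), folded q_def]
  have ess: "mono_arr C r" if r: "r \<in> Arr C" "Src C r = Tgt C q" "mono_arr C (r \<odot> (q \<odot> a))" for r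
  proof (rule mono_arrI[OF r(1)])
    \<comment> \<open>The preimage under \<open>q\<close> of the kernel of \<open>r\<close>, seen on
      arrows from \<open>G\<close>. It contains \<open>M\<close>, and modulo it \<open>a\<close> is
      still monic, so maximality gives \<open>H = M\<close>: if \<open>r\<close> kills
      \<open>q \<odot> h\<close>, then \<open>q\<close> already kills \<open>h\<close>.\<close>
    define H where "H = {h \<in> Hom C G I. r \<odot> (q \<odot> h) = Zero C G (Tgt C r)}"
    have H: "H \<subseteq> Hom C G I" unfolding H_def by blast
    have "coarser (qq H) (r \<odot> q)"
    proof (rule coarser_quotient_by[OF qq(1)[OF H]])
      show "r \<odot> q \<in> Arr C" "Src C (r \<odot> q) = Src C (qq H)" using r(1,2) q qq(2)[OF H] by simp_all
      show "(r \<odot> q) \<odot> h = Zero C (Src C h) (Tgt C (r \<odot> q))" if "h \<in> H" for h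
        using that r(1,2) q unfolding H_def by simp
    qed
    moreover have "mono_arr C ((r \<odot> q) \<odot> a)" using r q a assms(2) by simp
    ultimately have "mono_arr C (qq H \<odot> a)"
      by - (rule coarser_mono, use qqD(2)[OF H] qq(2)[OF H] a assms(2) in auto)
    moreover have "M \<subseteq> H"
    proof
      fix h assume h: "h \<in> M"
      then have h': "h \<in> Hom C G I" using M(1) by blast
      have "q \<odot> h = Zero C G (Tgt C q)" unfolding q_def by (rule qqD(3)[OF M(1) h]) (use h' in simp)
      then show "h \<in> H" unfolding H_def using h' r(1,2) G by simp
    qed
    ultimately have HM: "H = M" using max[OF H] by blast
    fix Y y assume y: "y \<in> Arr C" "Src C y = Y" "Tgt C y = Src C r" "r \<odot> y = Zero C Y (Tgt C r)"
    obtain D c where c: "is_cokernel C y D c" using has_cokernels[OF y(1)] by blast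
    note c' = is_cokernelD[OF c]
    \<comment> \<open>An arrow \<open>y\<close> killed by \<open>r\<close> need not lift to
      \<open>I\<close>. Factoring \<open>r\<close> through the cokernel of \<open>y\<close> reduces
      the claim to arrows into \<open>I\<close>, to which \<open>H = M\<close> applies.\<close>
    obtain t where t: "t \<in> Arr C" "Src C t = D" "Tgt C t = Tgt C r" "t \<odot> c = r"
      by (rule is_cokernelE[OF c r(1) refl]) (use y in auto)
    have "y = Zero C Y (Tgt C q)"
    proof (rule Zero_if_cokernel_kills_no_more[OF q(1) y(1,2) _ c])
      show "Tgt C y = Tgt C q" using y r by simp
      fix x X assume x: "x \<in> Arr C" "Src C x = X" "Tgt C x = Src C q" "c \<odot> (q \<odot> x) = Zero C X D"
      have X: "X \<in> Obj C" using x by auto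
      have "r \<odot> (q \<odot> x) = t \<odot> (c \<odot> (q \<odot> x))"
        by (rule Comp_eq_Comp[OF t(4), symmetric]) (use t c' x q r(1,2) y in auto)
      then have rqx: "r \<odot> (q \<odot> x) = Zero C X (Tgt C r)" unfolding x(4) using t X by simp
      show "q \<odot> x = Zero C X (Tgt C q)"
      proof (rule generator_Zero[OF gen])
        fix h assume h: "h \<in> Arr C" "Src C h = G" "Tgt C h = X"
        have "r \<odot> ((q \<odot> x) \<odot> h) = Zero C X (Tgt C r) \<odot> h"
          by (rule Comp_eq_Comp[OF rqx]) (use h x q r(1,2) in auto)
        then have "x \<odot> h \<in> H" unfolding H_def using h x q r(1,2) by simp
        then have "x \<odot> h \<in> M" using HM by simp
        then have "q \<odot> (x \<odot> h) = Zero C G (Tgt C q)"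
          unfolding q_def by (rule qqD(3)[OF M(1)]) (use h x in auto)
        then show "(q \<odot> x) \<odot> h = Zero C G (Tgt C q)" using h x q by simp
      qed (use x q in auto)
    qed
    then show "y = Zero C Y (Src C r)" using r by simp
  qed
  show thesis by (rule that[OF q(1,3) M(2)[folded q_def]]) (use ess in blast)
qed

end

section \<open>Indecomposable injectives are uniform\<close>

context abelian_category
begin

text \<open>The property \<open>essential_mono\<close> with a quantifier over arrows only, in the
  shape in which \<open>ex_essential_quotient\<close> delivers it.\<close>

definition essential :: "'m \<Rightarrow> bool" where
  "essential a \<longleftrightarrow> mono_arr C a \<and>
    (\<forall>r \<in> Arr C. Src C r = Tgt C a \<and> mono_arr C (r \<odot> a) \<longrightarrow> mono_arr C r)"

lemma essential_mono_iff: "essential_mono C a \<longleftrightarrow> essential a"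
proof
  assume *: "essential_mono C a"
  show "essential a"
    unfolding essential_def
  proof (intro conjI ballI impI)
    fix r assume r: "r \<in> Arr C" "Src C r = Tgt C a \<and> mono_arr C (r \<odot> a)"
    then have "r \<in> Hom C (Tgt C a) (Tgt C r)" "Tgt C r \<in> Obj C" by simp_all
    then show "mono_arr C r" using * r(2) unfolding essential_mono_def by blast
  qed (rule *[unfolded essential_mono_def, THEN conjunct1])
next
  assume *: "essential a"
  show "essential_mono C a"
    unfolding essential_mono_def
  proof (intro conjI ballI impI)
    fix X h assume "h \<in> Hom C (Tgt C a) X" "mono_arr C (h \<odot> a)"
    then have "h \<in> Arr C" "Src C h = Tgt C a \<and> mono_arr C (h \<odot> a)" by simp_all
    then show "mono_arr C h" using * unfolding essential_def by blast
  qed (rule *[unfolded essential_def, THEN conjunct1])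
qed

lemma essentialD:
  assumes "essential a"
  shows "mono_arr C a" "a \<in> Arr C"
    "r \<in> Arr C \<Longrightarrow> Src C r = Tgt C a \<Longrightarrow> mono_arr C (r \<odot> a) \<Longrightarrow> mono_arr C r"
  using assms mono_Arr unfolding essential_def by blast+

lemma mono_of_Zero_kernel:
  assumes "is_kernel C f K k" "k = Zero C K (Src C f)"
  shows "mono_arr C f"
proof (rule mono_arrI)
  note k = is_kernelD[OF assms(1)]
  show "f \<in> Arr C" by (rule k)
  fix X x assume x: "x \<in> Arr C" "Src C x = X" "Tgt C x = Src C f" "f \<odot> x = Zero C X (Tgt C f)"
  obtain u where u: "u \<in> Arr C" "Src C u = X" "Tgt C u = K" "k \<odot> u = x"
    by (rule is_kernelE[OF assms(1) x])
  have "k \<odot> u = Zero C X (Src C f)" unfolding assms(2) using u k(1) by simp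
  then show "x = Zero C X (Src C f)" unfolding u(4) .
qed

end

context grothendieck_category
begin

text \<open>The kernel \<open>b\<close> of an essential quotient \<open>q\<close> for \<open>a\<close> is a complement of \<open>a\<close>. By injectivity
  \<open>b\<close> extends along its own essential quotient \<open>q'\<close> to a monomorphism \<open>g\<close>, whose image is an essential
  extension of \<open>b\<close>; by maximality of the complement \<open>b\<close> this image is \<open>b\<close>, so \<open>b\<close> splits.\<close>

lemma indecomposable_injective_uniform:
  assumes "injective C I" "indecomposable C I" "mono_arr C a" "Tgt C a = I" "\<not> zero_object C (Src C a)"
  shows "essential a"
proof -
  note a = mono_Arr[OF assms(3)]
  define A where "A = Src C a"
  have A: "A \<in> Obj C" using a by (simp add: A_def)
  have I: "I \<in> Obj C" using a assms(4) by auto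
  obtain q where q: "epi_arr C q" "Src C q = I" "mono_arr C (q \<odot> a)"
    and ess: "\<forall>r \<in> Arr C. Src C r = Tgt C q \<and> mono_arr C (r \<odot> (q \<odot> a)) \<longrightarrow> mono_arr C r"
    by (rule ex_essential_quotient[OF assms(3,4)])
  note qA = epi_Arr[OF q(1)]
  obtain B b where b: "is_kernel C q B b" using has_kernels[OF qA] by blast
  have b': "B \<in> Obj C" "b \<in> Arr C" "Src C b = B" "Tgt C b = I" "q \<odot> b = Zero C B (Tgt C q)"
    using is_kernelD[OF b] q(2) by auto
  note bm = is_kernel_mono[OF b]
  obtain q' where q': "epi_arr C q'" "Src C q' = I" "mono_arr C (q' \<odot> b)"
    and ess': "\<forall>r \<in> Arr C. Src C r = Tgt C q' \<and> mono_arr C (r \<odot> (q' \<odot> b)) \<longrightarrow> mono_arr C r"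
    by (rule ex_essential_quotient[OF bm b'(4)])
  note q'A = epi_Arr[OF q'(1)]
  obtain g where g: "g \<in> Arr C" "Src C g = Tgt C (q' \<odot> b)" "Tgt C g = I" "g \<odot> (q' \<odot> b) = b"
    by (rule injectiveE[OF assms(1) q'(3) b'(2) _ b'(4)]) (use q'A q' b' in auto)
  have g2: "Src C g = Tgt C q'" using g q'A q' b' by simp
  have gm: "mono_arr C g" by (rule ess'[rule_format, OF g(1)]) (use g2 g(4) bm in simp)
  obtain D c where c: "is_cokernel C g D c" using has_cokernels[OF g(1)] by blast
  have c': "D \<in> Obj C" "c \<in> Arr C" "Src C c = I" "Tgt C c = D" "c \<odot> g = Zero C (Tgt C q') D"
    using is_cokernelD[OF c] g(3) g2 by auto
  have cb: "c \<odot> b = Zero C B D"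
  proof -
    have "c \<odot> (g \<odot> (q' \<odot> b)) = Zero C (Tgt C q') D \<odot> (q' \<odot> b)"
      by (rule Comp_eq_Comp[OF c'(5)]) (use c' g(1,3) g2 q'A q'(2) b' in auto)
    then show ?thesis unfolding g(4) using q'A q'(2) b' c'(1) by simp
  qed
  obtain r where r: "r \<in> Arr C" "Src C r = Tgt C q" "Tgt C r = D" "r \<odot> q = c"
    by (rule epi_factors[OF q(1) b c'(2,4)]) (use c' q cb in auto)
  have rqa: "r \<odot> (q \<odot> a) = c \<odot> a"
    by (rule Comp_eq_Comp[OF r(4)]) (use r qA q a assms(4) in auto)
  \<comment> \<open>The image of \<open>g\<close> meets \<open>a\<close> in zero. The kernel
    \<open>x\<close> of \<open>c \<odot> a\<close> gives \<open>a \<odot> x = g \<odot> y\<close>.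
    What the cokernel \<open>d\<close> of \<open>y\<close> kills in \<open>q' \<odot> b\<close> lies
    both in \<open>b\<close> and in \<open>a\<close>, hence is zero, since \<open>q\<close> kills
    \<open>b\<close> and is monic on \<open>a\<close>. As \<open>q' \<odot> b\<close> is essential,
    \<open>d\<close> is monic, so \<open>y\<close> and then \<open>x\<close> vanish.\<close>
  have cam: "mono_arr C (c \<odot> a)"
  proof -
    have ca: "c \<odot> a \<in> Arr C" "Src C (c \<odot> a) = A" "Tgt C (c \<odot> a) = D"
      using c' a assms(4) by (simp_all add: A_def)
    obtain X x where x: "is_kernel C (c \<odot> a) X x" using has_kernels[OF ca(1)] by blast
    have x': "X \<in> Obj C" "x \<in> Arr C" "Src C x = X" "Tgt C x = A" "(c \<odot> a) \<odot> x = Zero C X D"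
      using is_kernelD[OF x] ca by simp_all
    have ax: "a \<odot> x \<in> Arr C" "Src C (a \<odot> x) = X" "Tgt C (a \<odot> x) = I" "mono_arr C (a \<odot> x)"
      using x' a assms(3,4) is_kernel_mono[OF x] by (auto simp: A_def intro!: mono_arr_Comp)
    have cax: "c \<odot> (a \<odot> x) = Zero C X D" using x' a assms(4) c' by (simp add: A_def)
    obtain y where y: "y \<in> Arr C" "Src C y = X" "Tgt C y = Src C g" "g \<odot> y = a \<odot> x"
      by (rule mono_factors[OF gm c ax(1,2)]) (use ax g cax in auto)
    have "mono_arr C (g \<odot> y)" using ax y by simp
    then have ym: "mono_arr C y" by (rule mono_arr_cancel) (use g y in auto)
    obtain E d where d: "is_cokernel C y E d" using has_cokernels[OF y(1)] by blast
    have d': "E \<in> Obj C" "d \<in> Arr C" "Src C d = Tgt C q'" "Tgt C d = E" "d \<odot> y = Zero C X E"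
      using is_cokernelD[OF d] y g2 by auto
    have q'b: "q' \<odot> b \<in> Arr C" "Src C (q' \<odot> b) = B" "Tgt C (q' \<odot> b) = Tgt C q'"
      using q'A q' b' by simp_all
    have "mono_arr C (d \<odot> (q' \<odot> b))"
    proof (rule mono_arrI)
      show "d \<odot> (q' \<odot> b) \<in> Arr C" using d' q'b by simp
      fix Z z assume z: "z \<in> Arr C" "Src C z = Z" and "Tgt C z = Src C (d \<odot> (q' \<odot> b))"
        and "(d \<odot> (q' \<odot> b)) \<odot> z = Zero C Z (Tgt C (d \<odot> (q' \<odot> b)))"
      then have zB: "Tgt C z = B" and z0: "d \<odot> ((q' \<odot> b) \<odot> z) = Zero C Z E"
        using d' q'b by (simp_all del: assoc, subst assoc[symmetric], auto)
      have Z: "Z \<in> Obj C" using z by auto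
      have q'bz: "(q' \<odot> b) \<odot> z \<in> Arr C" "Src C ((q' \<odot> b) \<odot> z) = Z" "Tgt C ((q' \<odot> b) \<odot> z) = Tgt C q'"
        using z zB q'b by (simp_all del: assoc)
      obtain w where w: "w \<in> Arr C" "Src C w = Z" "Tgt C w = X" "y \<odot> w = (q' \<odot> b) \<odot> z"
        by (rule mono_factors[OF ym d q'bz(1,2)]) (use q'bz(3) z0 y g2 in \<open>simp_all del: assoc\<close>)
      have "b \<odot> z = g \<odot> ((q' \<odot> b) \<odot> z)"
        by (rule Comp_eq_Comp[OF g(4), symmetric]) (use z zB q'b g in auto)
      also have "\<dots> = (a \<odot> x) \<odot> w"
        unfolding w(4)[symmetric] by (rule Comp_eq_Comp[OF y(4)]) (use w y g in auto)
      also have "\<dots> = a \<odot> (x \<odot> w)" using a x' w by (simp add: A_def)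
      finally have bz: "b \<odot> z = a \<odot> (x \<odot> w)" .
      have "q \<odot> (b \<odot> z) = Zero C B (Tgt C q) \<odot> z"
        by (rule Comp_eq_Comp[OF b'(5)]) (use z zB b' qA q in auto)
      then have "(q \<odot> a) \<odot> (x \<odot> w) = Zero C Z (Tgt C (q \<odot> a))"
        unfolding bz using z zB qA q a x' w assms(4) by (simp add: A_def)
      then have "x \<odot> w = Zero C Z (Src C (q \<odot> a))"
        by - (rule mono_arr_ZeroD[OF q(3)], use qA q a x' w assms(4) in \<open>auto simp: A_def\<close>)
      then have "b \<odot> z = Zero C Z I" unfolding bz using a assms(4) Z qA q by simp
      then have "z = Zero C Z (Src C b)"
        by - (rule mono_arr_ZeroD[OF bm], use z zB b' in auto)
      then show "z = Zero C Z (Src C (d \<odot> (q' \<odot> b)))" using d' q'b b' by simp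
    qed
    then have dm: "mono_arr C d" using ess' d'(2,3) by blast
    have "y = Zero C X (Src C d)"
      by (rule mono_arr_ZeroD[OF dm]) (use y d' g2 in auto)
    then have "g \<odot> y = Zero C X I" using g g2 d' x' by simp
    then have "a \<odot> x = Zero C X (Tgt C a)" unfolding y(4) assms(4) .
    then have "x = Zero C X (Src C (c \<odot> a))"
      using mono_arr_ZeroD[OF assms(3), of x X] x' ca by (simp add: A_def)
    then show ?thesis by (rule mono_of_Zero_kernel[OF x])
  qed
  \<comment> \<open>Here maximality of the complement enters: \<open>q \<odot> a\<close> is
    essential and \<open>r \<odot> (q \<odot> a) = c \<odot> a\<close> is monic, so \<open>r\<close>
    is monic. Since \<open>r \<odot> q = c\<close> kills \<open>g\<close>, so does \<open>q\<close>,
    and \<open>g\<close> factors through its kernel \<open>b\<close>.\<close>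
  have rm: "mono_arr C r" using ess r(1,2) rqa cam by simp
  have "r \<odot> (q \<odot> g) = c \<odot> g" by (rule Comp_eq_Comp[OF r(4)]) (use r q qA g in auto)
  then have "q \<odot> g = Zero C (Tgt C q') (Src C r)"
    by - (rule mono_arr_ZeroD[OF rm], use r q qA g g2 c' in auto)
  then have "q \<odot> g = Zero C (Tgt C q') (Tgt C q)" using r by simp
  then obtain u where u: "u \<in> Arr C" "Src C u = Tgt C q'" "Tgt C u = B" "b \<odot> u = g"
    using g g2 q by - (rule is_kernelE[OF b g(1) g2], auto)
  have "(u \<odot> q') \<odot> b = Idn C (Src C b)"
  proof (rule mono_arrD[OF bm])
    have "b \<odot> (u \<odot> (q' \<odot> b)) = g \<odot> (q' \<odot> b)"
      by (rule Comp_eq_Comp[OF u(4)]) (use u b' q'A q' in auto)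
    then show "b \<odot> ((u \<odot> q') \<odot> b) = b \<odot> Idn C (Src C b)"
      unfolding g(4) using u b' q'A q' by simp
  qed (use u b' q'A q' in auto)
  then have "zero_object C (Src C b) \<or> iso_arr C b"
    by - (rule indecomposable_split_mono[where r = "u \<odot> q'"], use assms(2) u b' q'A q' in auto)
  then show ?thesis
  proof
    \<comment> \<open>If the complement were all of \<open>I\<close>, then \<open>q\<close> would be
      zero, although it is monic on the nonzero \<open>A\<close>.\<close>
    assume "iso_arr C b"
    then obtain v where v: "v \<in> Arr C" "Src C v = I" "Tgt C v = B" "b \<odot> v = Idn C I"
      using b' by (elim iso_arrE) auto
    have "q \<odot> (b \<odot> v) = Zero C B (Tgt C q) \<odot> v"
      by (rule Comp_eq_Comp[OF b'(5)]) (use v b' qA q in auto)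
    then have "q = Zero C I (Tgt C q)" using v qA q by simp
    then have "q \<odot> a = Zero C A (Tgt C q)"
      using Zero_Comp[OF a, of "Tgt C q" I] qA assms(4) by (simp add: A_def)
    from mono_Zero_zero_object[OF q(3) this] have "zero_object C A" using qA q a assms(4) by (simp add: A_def)
    then show ?thesis using assms(5) by (simp add: A_def)
  next
    \<comment> \<open>If the complement is zero, \<open>q\<close> is monic and split by injectivity
      of \<open>I\<close>; essentiality of \<open>q \<odot> a\<close> is carried back to
      \<open>a\<close> along the retraction \<open>t\<close>.\<close>
    assume "zero_object C (Src C b)"
    then have "b = Zero C B (Src C q)" using zero_objectD(2)[of "Src C b" b I] b' q by simp
    then have qm: "mono_arr C q" by (rule mono_of_Zero_kernel[OF b])
    obtain t where t: "t \<in> Arr C" "Src C t = Tgt C q" "Tgt C t = I" "t \<odot> q = Idn C I"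
      by (rule injectiveE[OF assms(1) qm, of "Idn C I"]) (use I q in auto)
    show ?thesis unfolding essential_def
    proof (intro conjI ballI impI)
      fix s assume s: "s \<in> Arr C" and "Src C s = Tgt C a \<and> mono_arr C (s \<odot> a)"
      then have sI: "Src C s = I" and sa: "mono_arr C (s \<odot> a)" using assms(4) by auto
      have "t \<odot> (q \<odot> a) = Idn C I \<odot> a" by (rule Comp_eq_Comp[OF t(4)]) (use t qA q a assms(4) in auto)
      then have "(s \<odot> t) \<odot> (q \<odot> a) = s \<odot> a" using s sI t qA q a assms(4) by simp
      then have "mono_arr C (s \<odot> t)" using ess s sI t sa by simp
      then have "mono_arr C ((s \<odot> t) \<odot> q)" by (rule mono_arr_Comp[OF qm]) (use s sI t in auto)
      moreover have "(s \<odot> t) \<odot> q = s" using s sI t qA q by simp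
      ultimately show "mono_arr C s" by simp
    qed (fact assms)
  qed
qed

end

section \<open>The radical and simple subobjects\<close>

lemma (in category) mono_arr_if_retract_on_epi:
  assumes "epi_arr C e" "s \<in> Arr C" "t \<in> Arr C" "Src C s = Tgt C e" "Src C t = Tgt C s" "Tgt C t = Tgt C e"
    "t \<odot> (s \<odot> e) = e"
  shows "mono_arr C s"
proof -
  note e = epi_Arr[OF assms(1)]
  have "t \<odot> s = Idn C (Tgt C e)" by (rule epi_arrD[OF assms(1)]) (use assms(2-) e in auto)
  then have "mono_arr C (t \<odot> s)" using e by simp
  then show ?thesis by (rule mono_arr_cancel) (use assms in auto)
qed

context abelian_category
begin

lemma indecomposableD:
  assumes "indecomposable C X"
  shows "X \<in> Obj C" "\<not> zero_object C X"
  using assms unfolding indecomposable_def by blast+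

text \<open>Annihilators in the endomorphisms of \<open>G\<close> see kernels, because
  \<open>G\<close> is a generator: under \<open>sub\<close>, \<open>g\<close> kills the kernel
  \<open>k\<close> of \<open>f\<close>. So does its part \<open>e'\<close>, as \<open>m\<close> is
  monic, and \<open>e'\<close> factors through the coimage \<open>e\<close> of
  \<open>f\<close>.\<close>

lemma coarser_image_epi:
  assumes gen: "is_generator C G"
    and f: "f \<in> Arr C" "Src C f = G" and g: "g \<in> Arr C" "Src C g = G"
    and sub: "\<And>x. x \<in> Hom C G G \<Longrightarrow> f \<odot> x = Zero C G (Tgt C f) \<Longrightarrow> g \<odot> x = Zero C G (Tgt C g)"
    and k: "is_kernel C f K k" and e: "is_cokernel C k E e"
    and m: "mono_arr C m" "e' \<in> Arr C" "Src C e' = G" "Tgt C e' = Src C m" "m \<odot> e' = g"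
  shows "coarser e e'"
proof -
  have k': "K \<in> Obj C" "k \<in> Arr C" "Src C k = K" "Tgt C k = G" "f \<odot> k = Zero C K (Tgt C f)"
    using is_kernelD[OF k] f by auto
  have e0: "e \<in> Arr C" "Src C e = G" "Tgt C e = E" using is_cokernelD[OF e] k' by auto
  have m': "m \<in> Arr C" "Tgt C m = Tgt C g"
    using mono_Arr[OF m(1)] Comp_Arr(3)[OF m(2) mono_Arr[OF m(1)]] m by auto
  have G: "G \<in> Obj C" using f by auto
  have "g \<odot> k = Zero C K (Tgt C g)"
  proof (rule generator_Zero[OF gen])
    fix h assume h: "h \<in> Arr C" "Src C h = G" "Tgt C h = K"
    have "f \<odot> (k \<odot> h) = Zero C K (Tgt C f) \<odot> h"
      by (rule Comp_eq_Comp[OF k'(5)]) (use h k' f in auto)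
    then have "g \<odot> (k \<odot> h) = Zero C G (Tgt C g)"
      by - (rule sub, use h k' f in auto)
    then show "(g \<odot> k) \<odot> h = Zero C G (Tgt C g)" using h k' g by simp
  qed (use g k' in auto)
  moreover have "m \<odot> (e' \<odot> k) = g \<odot> k" by (rule Comp_eq_Comp[OF m(5)]) (use m m' k' in auto)
  ultimately have "m \<odot> (e' \<odot> k) = Zero C K (Tgt C m)" using m' by simp
  then have "e' \<odot> k = Zero C K (Src C m)"
    by - (rule mono_arr_ZeroD[OF m(1)], use m k' in auto)
  then obtain t where "t \<in> Arr C" "Src C t = E" "Tgt C t = Tgt C e'" "t \<odot> e = e'"
    using m k' by - (rule is_cokernelE[OF e m(2) refl], auto)
  then show ?thesis using e0 by (intro coarserI[of t]) auto
qed

lemma simple_arr_mono: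
  assumes "simple C X" "h \<in> Arr C" "Src C h = X" "Tgt C h = Y" "h \<noteq> Zero C X Y"
  shows "mono_arr C h"
proof -
  obtain K k where k: "is_kernel C h K k" using has_kernels[OF assms(2)] by blast
  have k': "K \<in> Obj C" "k \<in> Arr C" "Src C k = K" "Tgt C k = X" "h \<odot> k = Zero C K Y"
    using is_kernelD[OF k] assms(3,4) by auto
  have "zero_object C K \<or> iso_arr C k"
    using assms(1) is_kernel_mono[OF k] k' unfolding simple_def by blast
  then show ?thesis
  proof
    assume "zero_object C K"
    then have "k = Zero C K (Src C h)" using zero_objectD(2)[of K k X] k' assms(3) by simp
    then show ?thesis by (rule mono_of_Zero_kernel[OF k])
  next
    assume "iso_arr C k"
    then obtain v where v: "v \<in> Arr C" "Src C v = X" "Tgt C v = K" "k \<odot> v = Idn C X"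
      using k' by (elim iso_arrE) auto
    have "h \<odot> (k \<odot> v) = Zero C K Y \<odot> v"
      by (rule Comp_eq_Comp[OF k'(5)]) (use v k' assms in auto)
    moreover have "Y \<in> Obj C" using assms(2,4) by auto
    ultimately have "h = Zero C X Y" using v assms(2-4) by simp
    then show ?thesis using assms(5) by blast
  qed
qed

text \<open>\<open>Diff\<close> takes its group from the endpoints of its first argument, which for
  the identity of \<open>I\<close> is the group in the definition of \<open>Rad\<close>.\<close>

lemma Rad_iff:
  assumes "I \<in> Obj C" "J \<in> Obj C"
  shows "f \<in> Rad C I J \<longleftrightarrow> f \<in> Hom C I J \<and> (\<forall>g \<in> Hom C J I. iso_arr C (Diff C (Idn C I) (g \<odot> f)))"
  using assms unfolding Rad_def Diff_def by simp

lemma Rad_Hom: "f \<in> Rad C I J \<Longrightarrow> f \<in> Hom C I J"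
  unfolding Rad_def by blast

lemma Rad_kills_simple:
  assumes "f \<in> Rad C I J" "injective C I" "simple C X" "i \<in> Arr C" "Src C i = X" "Tgt C i = I" "i \<noteq> Zero C X I"
  shows "f \<odot> i = Zero C X J"
proof (rule ccontr)
  assume fi: "f \<odot> i \<noteq> Zero C X J"
  have f: "f \<in> Arr C" "Src C f = I" "Tgt C f = J" using Rad_Hom[OF assms(1)] by auto
  have obj: "I \<in> Obj C" "J \<in> Obj C" "X \<in> Obj C" using f assms(4,5) by auto
  have "mono_arr C (f \<odot> i)" by (rule simple_arr_mono[OF assms(3) _ _ _ fi]) (use f assms in auto)
  then obtain g where g: "g \<in> Arr C" "Src C g = Tgt C (f \<odot> i)" "Tgt C g = I" "g \<odot> (f \<odot> i) = i"
    by (rule injectiveE[OF assms(2) _ assms(4) _ assms(6)]) (use f assms in auto)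
  have g': "Src C g = J" using g f assms(4,6) by simp
  let ?d = "Diff C (Idn C I) (g \<odot> f)"
  have "iso_arr C ?d" using assms(1) g(1,3) g' unfolding Rad_iff[OF obj(1,2)] by simp
  then have dm: "mono_arr C ?d" by (rule iso_mono)
  have d: "?d \<in> Arr C" "Src C ?d = I" "Tgt C ?d = I" using f g g' obj by auto
  have "?d \<odot> i = Diff C i i"
    using f g g' obj assms(4-6) by (subst Diff_Comp) auto
  also have "\<dots> = Zero C X I" using Diff_eq_Zero[of i i] assms(4-6) by simp
  finally have "i = Zero C X (Src C ?d)"
    using d assms(4-6) by - (rule mono_arr_ZeroD[OF dm], auto)
  then show False using assms(7) d by simp
qed

text \<open>Being monic on the essential subobject \<open>a\<close>, the arrow
  \<open>1 - g \<odot> f\<close> is monic, and a monic endomorphism of an indecomposable injective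
  object is invertible.\<close>

lemma kills_essential_in_Rad:
  assumes "injective C I" "indecomposable C I" "essential a" "Tgt C a = I"
    "f \<in> Arr C" "Src C f = I" "Tgt C f = J" "f \<odot> a = Zero C (Src C a) J"
  shows "f \<in> Rad C I J"
proof -
  note a = essentialD(2)[OF assms(3)]
  have obj: "I \<in> Obj C" "J \<in> Obj C" using assms(5-7) by auto
  have "iso_arr C (Diff C (Idn C I) (g \<odot> f))" if g: "g \<in> Hom C J I" for g
  proof -
    let ?d = "Diff C (Idn C I) (g \<odot> f)"
    have g': "g \<in> Arr C" "Src C g = J" "Tgt C g = I" using g by auto
    have d: "?d \<in> Arr C" "Src C ?d = I" "Tgt C ?d = I" using assms(5-7) g' obj by auto
    have "?d \<odot> a = Diff C a (g \<odot> (f \<odot> a))"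
      using assms(4-7) g' obj a by (subst Diff_Comp) auto
    also have "\<dots> = a" unfolding assms(8) using g' a assms(4) by (simp add: Diff_Zero)
    finally have "mono_arr C (?d \<odot> a)" using essentialD(1)[OF assms(3)] by simp
    then have "mono_arr C ?d" by - (rule essentialD(3)[OF assms(3)], use d assms(4) in auto)
    then show ?thesis
      by - (rule mono_injective_indecomposable_iso, use d assms(1,2) indecomposableD[OF assms(2)] in auto)
  qed
  then show ?thesis unfolding Rad_iff[OF obj] using assms(5-7) by simp
qed

lemma canonical_kernelD:
  assumes "canonical_kernel C Sp I S k"
  shows "k \<in> Arr C" "Src C k = S" "Tgt C k = I" "mono_arr C k" "S \<in> Obj C"
    "J \<in> Sp \<Longrightarrow> f \<in> Rad C I J \<Longrightarrow> f \<odot> k = Zero C S J"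
proof -
  obtain P \<pi> \<phi> where c: "canonical_arrow C Sp I P \<pi> \<phi>" and k: "is_kernel C \<phi> S k"
    using assms unfolding canonical_kernel_def by blast
  have \<phi>: "\<phi> \<in> Arr C" "Src C \<phi> = I" "Tgt C \<phi> = P" and P: "is_product C (SIGMA J:Sp. Rad C I J) fst P \<pi>"
    using c unfolding canonical_arrow_def by auto
  show "k \<in> Arr C" "Src C k = S" "Tgt C k = I" "mono_arr C k" "S \<in> Obj C"
    using is_kernelD[OF k] is_kernel_mono[OF k] \<phi> by auto
  show "f \<odot> k = Zero C S J" if J: "J \<in> Sp" "f \<in> Rad C I J"
  proof -
    have \<pi>\<phi>: "\<pi> (J, f) \<odot> \<phi> = f" using c J unfolding canonical_arrow_def by blast
    have \<pi>: "\<pi> (J, f) \<in> Arr C" "Src C (\<pi> (J, f)) = P" "Tgt C (\<pi> (J, f)) = J"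
      using is_productD(2-4)[OF P, of "(J, f)"] J by simp_all
    have "f \<odot> k = \<pi> (J, f) \<odot> (\<phi> \<odot> k)"
      by (rule Comp_eq_Comp[OF \<pi>\<phi>, symmetric]) (use \<pi> \<phi> is_kernelD[OF k] in auto)
    then show ?thesis using is_kernelD[OF k] \<phi> \<pi> by simp
  qed
qed

text \<open>Together with \<open>canonical_kernelD\<close> this describes \<open>k\<close> as the
  common kernel of all radical arrows from \<open>I\<close>, whichever product was chosen.\<close>

lemma canonical_kernel_factors:
  assumes "canonical_kernel C Sp I S k" "x \<in> Arr C" "Src C x = X" "Tgt C x = I"
    "\<And>J f. J \<in> Sp \<Longrightarrow> f \<in> Rad C I J \<Longrightarrow> f \<odot> x = Zero C X J"
  obtains u where "u \<in> Arr C" "Src C u = X" "Tgt C u = S" "k \<odot> u = x"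
proof -
  obtain P \<pi> \<phi> where c: "canonical_arrow C Sp I P \<pi> \<phi>" and k: "is_kernel C \<phi> S k"
    using assms(1) unfolding canonical_kernel_def by blast
  have \<phi>: "\<phi> \<in> Arr C" "Src C \<phi> = I" "Tgt C \<phi> = P" and P: "is_product C (SIGMA J:Sp. Rad C I J) fst P \<pi>"
    using c unfolding canonical_arrow_def by auto
  have "\<phi> \<odot> x = Zero C X P"
  proof (rule is_product_Zero[OF P])
    fix Jf assume Jf: "Jf \<in> (SIGMA J:Sp. Rad C I J)"
    obtain J f where Jf': "Jf = (J, f)" "J \<in> Sp" "f \<in> Rad C I J" using Jf by auto
    have \<pi>\<phi>: "\<pi> Jf \<odot> \<phi> = f" using c Jf' unfolding canonical_arrow_def by blast
    have "\<pi> Jf \<odot> (\<phi> \<odot> x) = f \<odot> x"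
      by (rule Comp_eq_Comp[OF \<pi>\<phi>]) (use is_productD(2-4)[OF P Jf] \<phi> assms(2-4) in auto)
    then show "\<pi> Jf \<odot> (\<phi> \<odot> x) = Zero C X (fst Jf)" using assms(5)[OF Jf'(2,3)] Jf' by simp
  qed (use \<phi> assms(2-4) in auto)
  then show thesis
    by - (rule is_kernelE[OF k assms(2,3) _ _ that], simp_all add: \<phi> assms(4))
qed

text \<open>After embedding \<open>Y\<close> into a product, \<open>x\<close> is tested by the
  projections; this replaces products by single arrows to members of \<open>E\<close>.\<close>

lemma cogenerating_Zero:
  fixes U :: "'u set"
  assumes "cogenerating U C E" "x \<in> Arr C" "Src C x = X" "Tgt C x = Y"
    "\<And>f J. J \<in> E \<Longrightarrow> f \<in> Arr C \<Longrightarrow> Src C f = Y \<Longrightarrow> Tgt C f = J \<Longrightarrow> f \<odot> x = Zero C X J"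
  shows "x = Zero C X Y"
proof -
  have Y: "Y \<in> Obj C" using assms(2,4) by auto
  obtain K :: "'u set" and A P \<pi> m where KAP: "K \<subseteq> U \<and> small U K \<and> (\<forall>k \<in> K. A k \<in> E) \<and>
      is_product C K A P \<pi> \<and> m \<in> Hom C Y P \<and> mono_arr C m"
    using assms(1)[unfolded cogenerating_def, THEN bspec, OF Y] by (elim exE) (rule that)
  have K: "\<forall>k \<in> K. A k \<in> E" and P: "is_product C K A P \<pi>" and m: "m \<in> Hom C Y P" "mono_arr C m"
    using KAP by blast+
  have m': "m \<in> Arr C" "Src C m = Y" "Tgt C m = P" using m by auto
  have "m \<odot> x = Zero C X P"
  proof (rule is_product_Zero[OF P])
    fix k assume k: "k \<in> K"
    note \<pi> = is_productD(2-4)[OF P k]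
    have "(\<pi> k \<odot> m) \<odot> x = Zero C X (A k)"
      by (rule assms(5)) (use K k \<pi> m' in auto)
    then show "\<pi> k \<odot> (m \<odot> x) = Zero C X (A k)" using \<pi> m' assms(2,4) by simp
  qed (use m' assms(2-4) in auto)
  then have "x = Zero C X (Src C m)" using m' assms(2-4) by - (rule mono_arr_ZeroD[OF m(2)], auto)
  then show ?thesis using m' by simp
qed

lemma spectrumD:
  assumes "is_spectrum C Sp" "I \<in> Sp"
  shows "injective C I" "indecomposable C I" "I \<in> Obj C" "\<not> zero_object C I"
    "J \<in> Sp \<Longrightarrow> isomorphic C I J \<Longrightarrow> I = J"
proof -
  show I: "injective C I" "indecomposable C I" using assms unfolding is_spectrum_def by blast+
  show O: "I \<in> Obj C" "\<not> zero_object C I" using indecomposableD[OF I(2)] .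
  show "I = J" if "J \<in> Sp" "isomorphic C I J"
    using assms I that isomorphic_refl[OF O(1)] unfolding is_spectrum_def by blast
qed

end

context grothendieck_category
begin

text \<open>Uniformity makes \<open>m\<close> essential, so the extension \<open>f\<close> of
  \<open>s\<close> along \<open>m\<close> is monic, and a monomorphism between indecomposable
  injectives is invertible.\<close>

lemma isomorphic_if_common_subobject:
  assumes "injective C I" "indecomposable C I" "injective C J" "indecomposable C J"
    "mono_arr C m" "Tgt C m = I" "mono_arr C s" "Tgt C s = J" "Src C s = Src C m" "\<not> zero_object C (Src C m)"
  shows "isomorphic C I J"
proof -
  have e: "essential m" by (rule indecomposable_injective_uniform[OF assms(1,2,5,6,10)])
  obtain f where f: "f \<in> Arr C" "Src C f = Tgt C m" "Tgt C f = J" "f \<odot> m = s"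
    by (rule injectiveE[OF assms(3,5) mono_Arr[OF assms(7)] assms(9,8)])
  have "mono_arr C f" by (rule essentialD(3)[OF e f(1,2)]) (use f(4) assms(7) in simp)
  then have "iso_arr C f"
    by - (rule mono_injective_indecomposable_iso,
      use f(2,3) assms(1,4,6) indecomposableD[OF assms(2)] in auto)
  then show ?thesis unfolding isomorphic_def using f assms(6) by auto
qed

lemma small_spectrum:
  assumes "is_spectrum C Sp"
  shows "small U Sp"
proof -
  note Sp = spectrumD[OF assms]
  obtain G where gen: "is_generator C G" using has_generator by blast
  then have G: "G \<in> Obj C" unfolding is_generator_def by blast
  have "\<exists>h. h \<in> Arr C \<and> Src C h = G \<and> Tgt C h = I \<and> h \<noteq> Zero C G I" if I: "I \<in> Sp" for I
  proof (rule ccontr)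
    assume no: "\<nexists>h. h \<in> Arr C \<and> Src C h = G \<and> Tgt C h = I \<and> h \<noteq> Zero C G I"
    have "Idn C I = Zero C I I"
    proof (rule generator_Zero[OF gen])
      fix h assume h: "h \<in> Arr C" "Src C h = G" "Tgt C h = I"
      then have "Idn C I \<odot> h = h" by simp
      then show "Idn C I \<odot> h = Zero C G I" using no h by metis
    qed (use Sp(3)[OF I] in auto)
    then show False using Sp(3,4)[OF I] unfolding zero_object_iff by blast
  qed
  then obtain h where h: "h I \<in> Arr C" "Src C (h I) = G" "Tgt C (h I) = I" "h I \<noteq> Zero C G I"
    if "I \<in> Sp" for I by metis
  \<comment> \<open>The kernel of \<open>h I\<close>, recorded as a right ideal of endomorphisms of
    \<open>G\<close>. Equal ideals give isomorphic images of \<open>h I\<close> and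
    \<open>h J\<close>, that is, a common nonzero subobject of \<open>I\<close> and
    \<open>J\<close>.\<close>
  define K where "K I = {x \<in> Hom C G G. h I \<odot> x = Zero C G I}" for I
  have "inj_on K Sp"
  proof (rule inj_onI)
    fix I J assume IJ: "I \<in> Sp" "J \<in> Sp" "K I = K J"
    note hI = h[OF IJ(1)] and hJ = h[OF IJ(2)]
    obtain L l where l: "is_kernel C (h I) L l" using has_kernels[OF hI(1)] by blast
    obtain L' l' where l': "is_kernel C (h J) L' l'" using has_kernels[OF hJ(1)] by blast
    obtain E e where e: "is_cokernel C l E e" using has_cokernels is_kernelD(3)[OF l] by blast
    obtain E' e' where e': "is_cokernel C l' E' e'" using has_cokernels is_kernelD(3)[OF l'] by blast
    obtain m where m: "m \<in> Arr C" "Src C m = E" "Tgt C m = Tgt C (h I)" "m \<odot> e = h I" "mono_arr C m"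
      by (rule image_factorization[OF hI(1) l e])
    obtain m' where m': "m' \<in> Arr C" "Src C m' = E'" "Tgt C m' = Tgt C (h J)" "m' \<odot> e' = h J" "mono_arr C m'"
      by (rule image_factorization[OF hJ(1) l' e'])
    have eA: "e \<in> Arr C" "Src C e = G" "Tgt C e = E" "epi_arr C e"
      using is_cokernelD[OF e] is_cokernel_epi[OF e] is_kernelD[OF l] hI by auto
    have eA': "e' \<in> Arr C" "Src C e' = G" "Tgt C e' = E'" "epi_arr C e'"
      using is_cokernelD[OF e'] is_cokernel_epi[OF e'] is_kernelD[OF l'] hJ by auto
    have KIJ: "x \<in> K I \<longleftrightarrow> x \<in> K J" for x using IJ(3) by simp
    have "coarser e e'"
      by (rule coarser_image_epi[OF gen hI(1,2) hJ(1,2) _ l e m'(5) eA'(1,2)])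
        (use KIJ hI(3) hJ(3) m' eA' in \<open>auto simp: K_def\<close>)
    then obtain t where t: "t \<in> Arr C" "Src C t = Tgt C e" "Tgt C t = Tgt C e'" "t \<odot> e = e'"
      by (rule coarserE)
    have "coarser e' e"
      by (rule coarser_image_epi[OF gen hJ(1,2) hI(1,2) _ l' e' m(5) eA(1,2)])
        (use KIJ hI(3) hJ(3) m eA in \<open>auto simp: K_def\<close>)
    then obtain t' where t': "t' \<in> Arr C" "Src C t' = Tgt C e'" "Tgt C t' = Tgt C e" "t' \<odot> e' = e"
      by (rule coarserE)
    have "mono_arr C t"
      by (rule mono_arr_if_retract_on_epi[OF eA(4) t(1) t'(1)]) (use t t' in auto)
    then have "mono_arr C (m' \<odot> t)" using m'(5) by (rule mono_arr_Comp) (use t m' eA' in auto)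
    moreover have "\<not> zero_object C E"
    proof
      assume "zero_object C E"
      then have "m = Zero C E I" using m hI by (intro zero_objectD(2)) auto
      then have "m \<odot> e = Zero C G I" using eA Sp(3)[OF IJ(1)] by simp
      then show False using m(4) hI(4) by simp
    qed
    ultimately have "isomorphic C I J"
      by - (rule isomorphic_if_common_subobject[OF Sp(1,2)[OF IJ(1)] Sp(1,2)[OF IJ(2)] m(5),
          where s = "m' \<odot> t"],
        use m m' t eA eA' hI hJ in auto)
    then show "I = J" by (rule Sp(5)[OF IJ(1,2)])
  qed
  moreover have "K ` Sp \<subseteq> Pow (Hom C G G)" unfolding K_def by blast
  moreover have "small U (Pow (Hom C G G))" by (intro small_Pow universe locally_small G)
  ultimately show ?thesis by (rule small_inj_on)
qed

text \<open>The theorem speaks of all choices of kernels, and existence keeps this from being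
  vacuous. The product exists since the pairs \<open>(J, f)\<close> form a small set.\<close>

lemma ex_canonical_kernel:
  assumes "is_spectrum C Sp" "I \<in> Sp"
  shows "\<exists>S k. canonical_kernel C Sp I S k"
proof -
  note I = spectrumD(3)[OF assms]
  have "small U (Rad C I J)" if "J \<in> Sp" for J
    by (rule small_subset[OF _ locally_small[OF I spectrumD(3)[OF assms(1) that]]]) (use Rad_Hom in blast)
  then have "small U (SIGMA J:Sp. Rad C I J)"
    by (rule small_Sigma[OF universe small_spectrum[OF assms(1)]])
  then obtain P \<pi> where P: "is_product C (SIGMA J:Sp. Rad C I J) fst P \<pi>"
    by (rule ex_product[of _ fst]) (use spectrumD(3)[OF assms(1)] in auto)
  obtain \<phi> where \<phi>: "\<phi> \<in> Arr C" "Src C \<phi> = I" "Tgt C \<phi> = P"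
    "\<And>Jf. Jf \<in> (SIGMA J:Sp. Rad C I J) \<Longrightarrow> \<pi> Jf \<odot> \<phi> = snd Jf"
    by (rule is_productE[OF P I, of snd]) (use Rad_Hom in auto)
  then have "canonical_arrow C Sp I P \<pi> \<phi>" unfolding canonical_arrow_def using P by auto
  moreover obtain S k where "is_kernel C \<phi> S k" using has_kernels[OF \<phi>(1)] by blast
  ultimately show ?thesis unfolding canonical_kernel_def by blast
qed

lemma canonical_kernel_essential:
  assumes "is_spectrum C Sp" "I \<in> Sp" "canonical_kernel C Sp I S k" "\<not> zero_object C S"
  shows "essential k"
  by (rule indecomposable_injective_uniform[OF spectrumD(1,2)[OF assms(1,2)]])
    (use canonical_kernelD[OF assms(3)] assms(4) in auto)

lemma canonical_kernel_simple:
  assumes "is_spectrum C Sp" "cogenerating U C Sp" "I \<in> Sp" "canonical_kernel C Sp I S k" "\<not> zero_object C S"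
  shows "simple C S"
  unfolding simple_def
proof (intro conjI allI impI)
  note k = canonical_kernelD[OF assms(4)] and I = spectrumD[OF assms(1,3)]
  show "S \<in> Obj C" "\<not> zero_object C S" by (fact k assms)+
  fix m assume "mono_arr C m \<and> Tgt C m = S"
  then have m: "mono_arr C m" "m \<in> Arr C" "Tgt C m = S" using mono_Arr by auto
  define T where "T = Src C m"
  have km: "k \<odot> m \<in> Arr C" "Src C (k \<odot> m) = T" "Tgt C (k \<odot> m) = I" "mono_arr C (k \<odot> m)"
    using k m by (auto simp: T_def intro!: mono_arr_Comp)
  show "zero_object C (Src C m) \<or> iso_arr C m"
  proof (intro disjCI)
    assume "\<not> iso_arr C m"
    show "zero_object C (Src C m)"
    proof (rule ccontr)
      assume "\<not> zero_object C (Src C m)"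
      then have ess: "essential (k \<odot> m)"
        by - (rule indecomposable_injective_uniform[OF I(1,2)], use km in \<open>auto simp: T_def\<close>)
      obtain D c where c: "is_cokernel C (k \<odot> m) D c" using has_cokernels[OF km(1)] by blast
      have c': "D \<in> Obj C" "c \<in> Arr C" "Src C c = I" "Tgt C c = D" "c \<odot> (k \<odot> m) = Zero C T D"
        using is_cokernelD[OF c] km by auto
      \<comment> \<open>Arrows from \<open>D\<close> to members of \<open>Sp\<close> amount to
        arrows from \<open>I\<close> that kill the essential subobject \<open>k \<odot> m\<close>;
        these are radical and so kill \<open>k\<close>. Cogeneration then gives
        \<open>c \<odot> k = 0\<close>, which puts \<open>k\<close> inside
        \<open>k \<odot> m\<close>.\<close>
      have "c \<odot> k = Zero C S D"
      proof (rule cogenerating_Zero[OF assms(2)])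
        fix f J assume J: "J \<in> Sp" and f: "f \<in> Arr C" "Src C f = D" "Tgt C f = J"
        have "(f \<odot> c) \<odot> (k \<odot> m) = f \<odot> (c \<odot> (k \<odot> m))"
          using f c' km by (intro assoc) auto
        also have "\<dots> = Zero C T J" unfolding c'(5) using f km by (auto simp: T_def m)
        finally have "(f \<odot> c) \<odot> (k \<odot> m) = Zero C T J" .
        then have "f \<odot> c \<in> Rad C I J"
          by - (rule kills_essential_in_Rad[OF I(1,2) ess], use f c' km in \<open>auto simp del: assoc\<close>)
        then have "(f \<odot> c) \<odot> k = Zero C S J" by (rule k(6)[OF J])
        then show "f \<odot> (c \<odot> k) = Zero C S J" using f c' k by simp
      qed (use c' k in auto)
      then obtain u where u: "u \<in> Arr C" "Src C u = S" "Tgt C u = Src C (k \<odot> m)" "(k \<odot> m) \<odot> u = k"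
        using k km by - (rule mono_factors[OF km(4) c k(1,2)], auto)
      have "m \<odot> u = Idn C S"
        by (rule mono_arrD[OF k(4)]) (use u k m km in \<open>auto simp: T_def\<close>)
      then have "iso_arr C m"
        by - (rule mono_split_iso[OF m(1) u(1)], use u m km in \<open>auto simp: T_def\<close>)
      then show False using \<open>\<not> iso_arr C m\<close> by blast
    qed
  qed
qed

text \<open>An isomorphism between the kernels makes \<open>S\<close> a common nonzero subobject of
  \<open>I\<close> and \<open>J\<close>.\<close>

lemma canonical_kernels_not_isomorphic:
  assumes "is_spectrum C Sp" "I \<in> Sp" "J \<in> Sp" "canonical_kernel C Sp I S k" "canonical_kernel C Sp J T l"
    "\<not> zero_object C S" "isomorphic C S T"
  shows "I = J"
proof -
  note k = canonical_kernelD[OF assms(4)] and l = canonical_kernelD[OF assms(5)]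
  obtain t where "t \<in> Hom C S T" "iso_arr C t" using assms(7) unfolding isomorphic_def by blast
  then have t: "t \<in> Arr C" "Src C t = S" "Tgt C t = T" "mono_arr C t" using iso_mono by auto
  have "mono_arr C (l \<odot> t)" by (rule mono_arr_Comp) (use t l in auto)
  then have "isomorphic C I J"
    by - (rule isomorphic_if_common_subobject[OF spectrumD(1,2)[OF assms(1,2)] spectrumD(1,2)[OF assms(1,3)]
        k(4), where s = "l \<odot> t"],
      use k l t assms(6) in auto)
  then show ?thesis by (rule spectrumD(5)[OF assms(1-3)])
qed

text \<open>If every arrow from \<open>X\<close> to a member of \<open>Sp\<close> were zero,
  cogeneration would make the identity of \<open>X\<close> zero. A nonzero \<open>i\<close> is monic
  by simplicity and is killed by radical arrows, so it factors through \<open>k I\<close>; the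
  factor \<open>u\<close> is a monomorphism into a simple object.\<close>

lemma simple_isomorphic_canonical_kernel:
  assumes "is_spectrum C Sp" "cogenerating U C Sp" "\<And>I. I \<in> Sp \<Longrightarrow> canonical_kernel C Sp I (S I) (k I)"
    "simple C X"
  shows "\<exists>I \<in> Sp. \<not> zero_object C (S I) \<and> isomorphic C X (S I)"
proof -
  have X: "X \<in> Obj C" "\<not> zero_object C X" using assms(4) unfolding simple_def by blast+
  have "\<exists>I i. I \<in> Sp \<and> i \<in> Arr C \<and> Src C i = X \<and> Tgt C i = I \<and> i \<noteq> Zero C X I"
  proof (rule ccontr)
    assume no: "\<nexists>I i. I \<in> Sp \<and> i \<in> Arr C \<and> Src C i = X \<and> Tgt C i = I \<and> i \<noteq> Zero C X I"
    have "Idn C X = Zero C X X"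
    proof (rule cogenerating_Zero[OF assms(2)])
      fix f J assume J: "J \<in> Sp" and f: "f \<in> Arr C" "Src C f = X" "Tgt C f = J"
      then have "f \<odot> Idn C X = f" by simp
      then show "f \<odot> Idn C X = Zero C X J" using no J f by metis
    qed (use X in auto)
    then show False using X unfolding zero_object_iff by blast
  qed
  then obtain I i where I: "I \<in> Sp" and i: "i \<in> Arr C" "Src C i = X" "Tgt C i = I" "i \<noteq> Zero C X I"
    by blast
  note ck = assms(3)[OF I]
  note k = canonical_kernelD[OF ck]
  have im: "mono_arr C i" by (rule simple_arr_mono[OF assms(4) i])
  obtain u where u: "u \<in> Arr C" "Src C u = X" "Tgt C u = S I" "k I \<odot> u = i"
    by (rule canonical_kernel_factors[OF ck i(1-3)])
      (rule Rad_kills_simple[OF _ spectrumD(1)[OF assms(1) I] assms(4) i], assumption+)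
  have "mono_arr C (k I \<odot> u)" using im u(4) by simp
  then have um: "mono_arr C u" by (rule mono_arr_cancel) (use u k in auto)
  have nz: "\<not> zero_object C (S I)" using mono_to_zero_object[OF um] u X by auto
  have "simple C (S I)" by (rule canonical_kernel_simple[OF assms(1,2) I ck nz])
  then have "iso_arr C u" using um u X unfolding simple_def by blast
  then have "isomorphic C X (S I)" unfolding isomorphic_def using u by auto
  then show ?thesis using I nz by blast
qed

end

theorem theorem1p2:
  fixes U :: "'u set" and C :: "('o, 'm, 'z) addcat_scheme" and Sp :: "'o set"
  assumes "grothendieck_category U C"
    and "is_spectrum C Sp"
    and "cogenerating U C Sp"
  shows "(\<forall>I \<in> Sp. \<exists>S k. canonical_kernel C Sp I S k) \<and>
    (\<forall>(S :: 'o \<Rightarrow> 'o) (k :: 'o \<Rightarrow> 'm). (\<forall>I \<in> Sp. canonical_kernel C Sp I (S I) (k I)) \<longrightarrow>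
      (let \<S> = {S I | I. I \<in> Sp \<and> \<not> zero_object C (S I)} in
        (\<forall>X \<in> \<S>. simple C X) \<and>
        (\<forall>I \<in> Sp. \<forall>J \<in> Sp. \<not> zero_object C (S I) \<and> \<not> zero_object C (S J) \<and> I \<noteq> J \<longrightarrow>
          \<not> isomorphic C (S I) (S J)) \<and>
        (\<forall>X. simple C X \<longrightarrow> (\<exists>Y \<in> \<S>. isomorphic C X Y)) \<and>
        (\<forall>I \<in> Sp. \<not> zero_object C (S I) \<longrightarrow> injective_envelope C (S I) I (k I))))"
proof -
  interpret grothendieck_category U C by (rule assms(1))
  note Sp = assms(2)
  have "\<exists>S k. canonical_kernel C Sp I S k" if "I \<in> Sp" for I
    by (rule ex_canonical_kernel[OF Sp that])
  moreover have "let \<S> = {S I | I. I \<in> Sp \<and> \<not> zero_object C (S I)} in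
        (\<forall>X \<in> \<S>. simple C X) \<and>
        (\<forall>I \<in> Sp. \<forall>J \<in> Sp. \<not> zero_object C (S I) \<and> \<not> zero_object C (S J) \<and> I \<noteq> J \<longrightarrow>
          \<not> isomorphic C (S I) (S J)) \<and>
        (\<forall>X. simple C X \<longrightarrow> (\<exists>Y \<in> \<S>. isomorphic C X Y)) \<and>
        (\<forall>I \<in> Sp. \<not> zero_object C (S I) \<longrightarrow> injective_envelope C (S I) I (k I))"
    if "\<forall>I \<in> Sp. canonical_kernel C Sp I (S I) (k I)" for S k
  proof -
    have ck: "canonical_kernel C Sp I (S I) (k I)" if "I \<in> Sp" for I
      using \<open>\<forall>I \<in> Sp. canonical_kernel C Sp I (S I) (k I)\<close> that by blast
    have simple: "simple C (S I)" if "I \<in> Sp" "\<not> zero_object C (S I)" for I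
      by (rule canonical_kernel_simple[OF Sp assms(3) that(1) ck[OF that(1)] that(2)])
    have non_isomorphic: "\<not> isomorphic C (S I) (S J)"
      if "I \<in> Sp" "J \<in> Sp" "\<not> zero_object C (S I)" "I \<noteq> J" for I J
      using canonical_kernels_not_isomorphic[OF Sp that(1,2) ck[OF that(1)] ck[OF that(2)] that(3)] that(4)
      by blast
    have complete: "\<exists>I \<in> Sp. \<not> zero_object C (S I) \<and> isomorphic C X (S I)" if "simple C X" for X
      by (rule simple_isomorphic_canonical_kernel[OF Sp assms(3) ck that])
    \<comment> \<open>The nonzero \<open>S I\<close> is essential by uniformity of \<open>I\<close>,
      and \<open>I\<close> is injective as a member of the spectrum.\<close>
    have envelope: "injective_envelope C (S I) I (k I)" if "I \<in> Sp" "\<not> zero_object C (S I)" for I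
      unfolding injective_envelope_def essential_mono_iff
      using spectrumD(1)[OF Sp that(1)] canonical_kernelD(1-3)[OF ck[OF that(1)]]
        canonical_kernel_essential[OF Sp that(1) ck[OF that(1)] that(2)] by simp
    show ?thesis unfolding Let_def
    proof (intro conjI allI ballI impI)
      show "simple C X" if "X \<in> {S I | I. I \<in> Sp \<and> \<not> zero_object C (S I)}" for X
        using that simple by blast
      show "\<not> isomorphic C (S I) (S J)"
        if "I \<in> Sp" "J \<in> Sp" "\<not> zero_object C (S I) \<and> \<not> zero_object C (S J) \<and> I \<noteq> J" for I J
        using that non_isomorphic by blast
      show "\<exists>Y \<in> {S I | I. I \<in> Sp \<and> \<not> zero_object C (S I)}. isomorphic C X Y" if "simple C X" for X
        using complete[OF that] by blast
      show "injective_envelope C (S I) I (k I)" if "I \<in> Sp" "\<not> zero_object C (S I)" for I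
        by (rule envelope[OF that])
    qed
  qed
  ultimately show ?thesis by blast
qed

end
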